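(* Let $A$ be an isotropic dilation matrix, let $W$ be the associated quadratic form $W(\xi)=\xi^TQ^2\xi$, let $$G(\xi)=4\sum_{1\le i\le d}q_{ii}\sin^2\frac{\xi_i}{2}+2\sum_{1\le i<j\le d}q_{ij}\sin\xi_i\sin\xi_j ,\qquad Q^2=[q_{ij}],$$ and let the mask be $$m_0(\xi)=\frac{\prod_{s\in\mathcal S(A^T)\setminus\{0\}}G(\xi+2\pi s)}{\prod_{s\in\mathcal S(A^T)\setminus\{0\}}G(2\pi s)} .$$ Let $m\in\{1,2,\dots\}$ and let $\phi^m$ be the elliptic scaling function of order $m$ corresponding to the dilation matrix $A$ and the mask $m_0$. Then any algebraic polynomial $P$ reproduced by integer shifts of $\phi^m$ (that is, contained in the span of $\{\phi^m(\cdot-k):k\in\mathbb Z^d\}$) belongs to $\ker W(-iD)^m$. Moreover, the space of polynomials contained in the span of integer shifts of $\phi^m$ is affinely invariant.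
   Context: A dilation matrix is a real $d\times d$ matrix with integer entries all of whose eigenvalues are greater than $1$ in absolute value. A square matrix is isotropic if it is diagonalizable over $\mathbb C$ and all its eigenvalues are equal in absolute value. For an isotropic dilation matrix $A$, put $q=|\det A|$ and $A^{-T}=(A^T)^{-1}$; one can factor $A^{-T}=q^{-1/d}Q^{-1}UQ$ with $U$ orthogonal and $Q$ real symmetric positive definite, and such a factorization is fixed; it defines $W(\xi)=\xi^TQ^2\xi$ (so $W(A^{-T}\xi)=q^{-2/d}W(\xi)$). $\mathcal S(A^T)=\{s\in[0,1)^d: A^Ts\in\mathbb Z^d\}$, so that $A^T\mathcal S(A^T)$ is a set of representatives of $\mathbb Z^d/A^T\mathbb Z^d$. The elliptic scaling function $\phi$ corresponding to $A$ and $m_0$ is the compactly supported tempered distribution with $\hat\phi(\xi)=\prod_{j=1}^\infty m_0\left((A^{-T})^j\xi\right)$; the elliptic scaling function of order $m$ is $\phi^m$ defined in the Fourier domain by $\widehat{\phi^m}(\xi)=(\hat\phi(\xi))^m$ (in particular $\phi^1=\phi$). The Fourier transform is $\hat f(\xi)=(2\pi)^{-d/2}\int f(x)e^{-i\xi\cdot x}dx$. $W(-iD)$ is the differential operator obtained by substituting $-iD_n$ for the $n$th variable of $W$; $\ker W(-iD)^m$ is its $m$th power's null-space. Spans are over $\mathbb R$, and "span of integer shifts" of a compactly supported $f$ means the set of all (possibly infinite) combinations $\sum_{k\in\mathbb Z^d}c_kf(\cdot-k)$. A polynomial space is affinely invariant if it is shift-invariant (closed under $P\mapsto P(\cdot+h)$,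 $h\in\mathbb R^d$) and scale-invariant (closed under $P\mapsto P(\lambda\,\cdot)$, $\lambda\in\mathbb R\setminus\{0\}$). *)

theory Defs
  imports "HOL-Analysis.Analysis"
begin

section \<open>Isotropic dilation matrices\<close>

definition eigenvalue_complex :: "real^'n^'n \<Rightarrow> complex \<Rightarrow> bool" where
  "eigenvalue_complex A z \<longleftrightarrow>
     (\<exists>v. v \<noteq> 0 \<and> map_matrix complex_of_real A *v v = z *s v)"

definition diagonalizable_complex :: "real^'n^'n \<Rightarrow> bool" where
  "diagonalizable_complex A \<longleftrightarrow>
     (\<exists>(S::complex^'n^'n) D. invertible S \<and> (\<forall>i j. i \<noteq> j \<longrightarrow> D $ i $ j = 0) \<and>
        map_matrix complex_of_real A = S ** D ** matrix_inv S)"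

definition dilation_matrix :: "real^'n^'n \<Rightarrow> bool" where
  "dilation_matrix A \<longleftrightarrow>
     (\<forall>i j. A $ i $ j \<in> \<int>) \<and> (\<forall>z. eigenvalue_complex A z \<longrightarrow> norm z > 1)"

definition isotropic :: "real^'n^'n \<Rightarrow> bool" where
  "isotropic A \<longleftrightarrow> diagonalizable_complex A \<and>
     (\<forall>z w. eigenvalue_complex A z \<longrightarrow> eigenvalue_complex A w \<longrightarrow> norm z = norm w)"

definition sym_pos_def :: "real^'n^'n \<Rightarrow> bool" where
  "sym_pos_def Q \<longleftrightarrow> transpose Q = Q \<and> (\<forall>x. x \<noteq> 0 \<longrightarrow> x \<bullet> (Q *v x) > 0)"

definition inv_transpose :: "real^'n^'n \<Rightarrow> real^'n^'n" where
  "inv_transpose A = matrix_inv (transpose A)"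

definition isotropic_factorization :: "real^'n^'n \<Rightarrow> real^'n^'n \<Rightarrow> real^'n^'n \<Rightarrow> bool" where
  "isotropic_factorization A Q U \<longleftrightarrow> sym_pos_def Q \<and> orthogonal_matrix U \<and>
     inv_transpose A =
       (\<bar>det A\<bar> powr (- 1 / real CARD('n))) *\<^sub>R (matrix_inv Q ** U ** Q)"


section \<open>The mask\<close>

definition digit_set :: "real^'n^'n \<Rightarrow> (real^'n) set" where
  "digit_set B = {s. (\<forall>i. 0 \<le> s $ i \<and> s $ i < 1) \<and> (\<forall>i. (B *v s) $ i \<in> \<int>)}"

text \<open>
  The linear order on the index type only serves to write sums over \<open>i < j\<close>;
  every positive dimension is the cardinality of such a type.
\<close>

definition elliptic_G ::
    "real^('n::{finite,linorder})^('n::{finite,linorder})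
       \<Rightarrow> real^('n::{finite,linorder}) \<Rightarrow> real" where
  "elliptic_G Q \<xi> =
     4 * (\<Sum>i\<in>UNIV. (Q ** Q) $ i $ i * (sin (\<xi> $ i / 2))\<^sup>2) +
     2 * (\<Sum>(i, j)\<in>{(i, j). i < j}. (Q ** Q) $ i $ j * sin (\<xi> $ i) * sin (\<xi> $ j))"

definition elliptic_mask ::
    "real^('n::{finite,linorder})^('n::{finite,linorder})
       \<Rightarrow> real^('n::{finite,linorder})^('n::{finite,linorder})
       \<Rightarrow> real^('n::{finite,linorder}) \<Rightarrow> real" where
  "elliptic_mask A Q \<xi> =
     (\<Prod>s\<in>digit_set (transpose A) - {0}. elliptic_G Q (\<xi> + (2 * pi) *\<^sub>R s)) /
     (\<Prod>s\<in>digit_set (transpose A) - {0}. elliptic_G Q ((2 * pi) *\<^sub>R s))"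


section \<open>Tempered distributions\<close>

definition pderiv_at :: "'n \<Rightarrow> (real^'n \<Rightarrow> complex) \<Rightarrow> real^'n \<Rightarrow> complex" where
  "pderiv_at i f x = frechet_derivative f (at x) (axis i 1)"

definition iter_pderiv :: "'n list \<Rightarrow> (real^'n \<Rightarrow> complex) \<Rightarrow> real^'n \<Rightarrow> complex" where
  "iter_pderiv is f = foldr pderiv_at is f"

definition smooth :: "(real^'n \<Rightarrow> complex) \<Rightarrow> bool" where
  "smooth f \<longleftrightarrow> (\<forall>is. iter_pderiv is f differentiable_on UNIV)"

definition test_function :: "(real^'n \<Rightarrow> complex) \<Rightarrow> bool" where
  "test_function f \<longleftrightarrow> smooth f \<and> compact (closure {x. f x \<noteq> 0})"

definition schwartz :: "(real^'n \<Rightarrow> complex) \<Rightarrow> bool" where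
  "schwartz f \<longleftrightarrow> smooth f \<and>
     (\<forall>N is. bounded (range (\<lambda>x. (1 + norm x) ^ N *\<^sub>R iter_pderiv is f x)))"

definition schwartz_seminorm :: "nat \<Rightarrow> (real^'n \<Rightarrow> complex) \<Rightarrow> real" where
  "schwartz_seminorm N f =
     (SUP (is, x) \<in> {is. length is \<le> N} \<times> UNIV. (1 + norm x) ^ N * norm (iter_pderiv is f x))"

text \<open>
  A distribution is a functional on all functions, of which only the values on Schwartz
  functions are meaningful.
\<close>

type_synonym 'n distr = "(real^'n \<Rightarrow> complex) \<Rightarrow> complex"

definition tempered_distribution :: "'n::finite distr \<Rightarrow> bool" where
  "tempered_distribution T \<longleftrightarrow>
     (\<forall>f g. schwartz f \<longrightarrow> schwartz g \<longrightarrow> T (\<lambda>x. f x + g x) = T f + T g) \<and>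
     (\<forall>c f. schwartz f \<longrightarrow> T (\<lambda>x. c * f x) = c * T f) \<and>
     (\<exists>C N. \<forall>f. schwartz f \<longrightarrow> norm (T f) \<le> C * schwartz_seminorm N f)"

definition compactly_supported :: "'n::finite distr \<Rightarrow> bool" where
  "compactly_supported T \<longleftrightarrow>
     (\<exists>K. compact K \<and>
        (\<forall>f. test_function f \<longrightarrow> closure {x. f x \<noteq> 0} \<inter> K = {} \<longrightarrow> T f = 0))"

definition fourier :: "(real^'n \<Rightarrow> complex) \<Rightarrow> real^'n \<Rightarrow> complex" where
  "fourier f \<xi> = of_real ((2 * pi) powr (- real CARD('n) / 2)) *
     (LINT x|lborel. f x * exp (- \<i> * of_real (\<xi> \<bullet> x)))"

text \<open>
  The Fourier transform of \<open>T\<close>, given by duality as \<open>f \<mapsto> T (fourier f)\<close>, is the regular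
  distribution with density \<open>F\<close>.
\<close>

definition has_fourier_transform :: "'n::finite distr \<Rightarrow> (real^'n \<Rightarrow> complex) \<Rightarrow> bool" where
  "has_fourier_transform T F \<longleftrightarrow>
     (\<forall>f. schwartz f \<longrightarrow> integrable lborel (\<lambda>\<xi>. F \<xi> * f \<xi>) \<and>
        T (fourier f) = (LINT \<xi>|lborel. F \<xi> * f \<xi>))"


section \<open>Elliptic scaling functions\<close>

text \<open>The product starts at \<open>j = 1\<close>, hence the \<open>Suc\<close>; matrix powers act by iteration.\<close>

definition mask_product :: "real^'n^'n \<Rightarrow> (real^'n \<Rightarrow> real) \<Rightarrow> real^'n \<Rightarrow> real" where
  "mask_product A m\<^sub>0 \<xi> = prodinf (\<lambda>j. m\<^sub>0 (((\<lambda>\<eta>. inv_transpose A *v \<eta>) ^^ Suc j) \<xi>))"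

text \<open>
  For \<open>m = 1\<close> this is the scaling function of the mask \<open>m\<^sub>0\<close> itself. A compactly supported
  tempered distribution is determined, on Schwartz functions, by its Fourier transform.
\<close>

definition scaling_function_of_order ::
    "nat \<Rightarrow> real^'n^'n \<Rightarrow> (real^'n \<Rightarrow> real) \<Rightarrow> 'n::finite distr \<Rightarrow> bool" where
  "scaling_function_of_order m A m\<^sub>0 \<phi> \<longleftrightarrow>
     tempered_distribution \<phi> \<and> compactly_supported \<phi> \<and>
     has_fourier_transform \<phi> (\<lambda>\<xi>. (complex_of_real (mask_product A m\<^sub>0 \<xi>)) ^ m)"


section \<open>Polynomials in the span of integer shifts\<close>

text \<open>
  The shift \<open>\<phi>(\<cdot> - k)\<close> acts on a test function \<open>f\<close> as \<open>\<phi>\<close> acts on \<open>f(\<cdot> + k)\<close>. For compactly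
  supported \<open>\<phi>\<close> only finitely many terms of the sum are nonzero for each \<open>f\<close>. The polynomial
  is identified with the regular distribution it defines.
\<close>

definition in_shift_span :: "'n::finite distr \<Rightarrow> (real^'n \<Rightarrow> real) \<Rightarrow> bool" where
  "in_shift_span \<phi> P \<longleftrightarrow>
     (\<exists>c :: int^'n \<Rightarrow> real. \<forall>f. test_function f \<longrightarrow>
        ((\<lambda>k. of_real (c k) * \<phi> (\<lambda>x. f (x + (\<chi> i. real_of_int (k $ i)))))
           has_sum (LINT x|lborel. of_real (P x) * f x)) UNIV)"

definition reproduced_polynomials :: "'n::finite distr \<Rightarrow> (real^'n \<Rightarrow> real) set" where
  "reproduced_polynomials \<phi> = {P. real_polynomial_function P \<and> in_shift_span \<phi> P}"

definition affinely_invariant :: "(real^'n \<Rightarrow> real) set \<Rightarrow> bool" where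
  "affinely_invariant V \<longleftrightarrow>
     (\<forall>P\<in>V. \<forall>h. (\<lambda>x. P (x + h)) \<in> V) \<and>
     (\<forall>P\<in>V. \<forall>c. c \<noteq> 0 \<longrightarrow> (\<lambda>x. P (c *\<^sub>R x)) \<in> V)"

text \<open>
  \<open>W(-iD)\<close> for the quadratic form \<open>W(\<xi>) = \<xi>\<^sup>T M \<xi> = \<Sum>\<^sub>i\<^sub>j M\<^sub>i\<^sub>j \<xi>\<^sub>i \<xi>\<^sub>j\<close>.
\<close>

definition quadratic_form_operator ::
    "real^'n^'n \<Rightarrow> (real^'n \<Rightarrow> complex) \<Rightarrow> real^'n \<Rightarrow> complex" where
  "quadratic_form_operator M f x =
     (let miD = (\<lambda>i g y. - \<i> * pderiv_at i g y)
      in \<Sum>i\<in>UNIV. \<Sum>j\<in>UNIV. of_real (M $ i $ j) * miD i (miD j f) x)"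

definition kernel_of_power ::
    "((real^'n \<Rightarrow> complex) \<Rightarrow> real^'n \<Rightarrow> complex) \<Rightarrow> nat \<Rightarrow> (real^'n \<Rightarrow> real) set" where
  "kernel_of_power L m = {P. (L ^^ m) (\<lambda>x. complex_of_real (P x)) = (\<lambda>x. 0)}"

end

(* For p = 2 pi s with s a nonzero digit, the character n \<mapsto> exp(i <p, n>) is trivial on A Z^d. Writing a
   reproduced polynomial R as a combination of shifts of phi via the refinement equation
   phi = sum a_j phi(A . - j) and moving the character from one factor of a convolution to another gives an
   equality between a polynomial and a nontrivial character times a polynomial on Z^d; hence both sides
   vanish. Since the Fourier transform of phi does not vanish at p, what remains is that the difference
   operator with symbol m_0(. + p)^m annihilates R. This symbol is G^m times a trigonometric polynomial that
   is nonzero at 0, so the difference operator with symbol G^m annihilates R.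

   The reproduced polynomials are stable under integer shifts and under R \<mapsto> R o A^(-1). The normalised powers
   of A^(-1) accumulate at the identity because U is orthogonal, so the homogeneous parts of R are pointwise limits of
   such dilates inside a finite-dimensional space. This yields scale invariance, and conjugating integer shifts
   by scalings yields all real shifts. Applying the annihilation result to R(t .) and letting t \<rightarrow> 0 turns the
   difference operator into W(-iD)^m. *)

theory Submission
  imports Defs "HOL-Probability.Probability" "HOL-Library.Groups_Big_Fun"
begin

section \<open>Smooth functions and test functions\<close>

text \<open>The coefficients of a polynomial in the span form an arbitrary real sequence: their
  growth is unrestricted and the polynomial need not determine them, so there is no Fourier series
  of coefficients to work with. Everything is therefore tested against compactly supported
  functions, where only finitely many coefficients enter, and a polynomial is seen through its
  averages against test functions, which are polynomials again. Fourier analysis is applied to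
  \<open>\<phi>\<close> alone, through a form of Poisson summation: if the sums of its values on the
  integer shifts of f, weighted by the character, vanish for all f, then the transform of
  \<open>\<phi>\<close> vanishes at p. The factor G^m arises because the twist by s meets the factor
  of m_0 belonging to the digit congruent to -s. The refinement equation reaches only polynomials of
  the form P o A^(-1), so closure under P \<mapsto> P o A must be established as well; it comes from
  the same recurrence of powers. Since spans are real, the refinement coefficients must be real,
  which is where the evenness of m_0 enters.\<close>

lemma iter_pderiv_Nil [simp]: "iter_pderiv [] f = f"
  and iter_pderiv_Cons [simp]: "iter_pderiv (i # is) f = pderiv_at i (iter_pderiv is f)"
  by (simp_all add: iter_pderiv_def)

lemma iter_pderiv_append: "iter_pderiv (is @ js) f = iter_pderiv is (iter_pderiv js f)"
  by (simp add: iter_pderiv_def)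

lemma iter_pderiv_closed:
  assumes "f \<in> C" and "\<And>g i. g \<in> C \<Longrightarrow> pderiv_at i g \<in> C"
  shows "iter_pderiv is f \<in> C"
  by (induction "is") (simp_all add: assms)

text \<open>A class of differentiable functions that is closed under partial derivatives replaces
  explicit formulas for iterated derivatives. The smoothness proofs for concrete functions below
  each exhibit such a class.\<close>

lemma smoothI:
  assumes "f \<in> C" and "\<And>g. g \<in> C \<Longrightarrow> g differentiable_on UNIV"
    and "\<And>g i. g \<in> C \<Longrightarrow> pderiv_at i g \<in> C"
  shows "smooth f"
  unfolding smooth_def using iter_pderiv_closed[of f C] assms by blast

lemma smooth_pderiv: "smooth f \<Longrightarrow> smooth (pderiv_at i f)"
  unfolding smooth_def by (metis iter_pderiv_Cons iter_pderiv_Nil iter_pderiv_append)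

lemma smooth_differentiable: "smooth f \<Longrightarrow> f differentiable (at x)"
  unfolding smooth_def by (metis UNIV_I differentiable_on_def iter_pderiv_Nil)

lemma smooth_continuous_on: "smooth f \<Longrightarrow> continuous_on S f"
  by (meson continuous_at_imp_continuous_on differentiable_imp_continuous_within smooth_differentiable)

lemma pderiv_at_eq:
  "(f has_derivative D) (at x) \<Longrightarrow> pderiv_at i f x = D (axis i 1)"
  unfolding pderiv_at_def by (metis frechet_derivative_at)

lemma pderiv_at_add:
  assumes "f differentiable (at x)" "g differentiable (at x)"
  shows "pderiv_at i (\<lambda>x. f x + g x) x = pderiv_at i f x + pderiv_at i g x"
proof -
  have "((\<lambda>x. f x + g x) has_derivative
      (\<lambda>h. frechet_derivative f (at x) h + frechet_derivative g (at x) h)) (at x)"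
    using assms by (intro has_derivative_add) (simp_all flip: frechet_derivative_works)
  then show ?thesis
    by (simp add: pderiv_at_eq) (simp add: pderiv_at_def)
qed

lemma pderiv_at_mult:
  assumes "f differentiable (at x)" "g differentiable (at x)"
  shows "pderiv_at i (\<lambda>x. f x * g x) x = f x * pderiv_at i g x + pderiv_at i f x * g x"
proof -
  have "((\<lambda>x. f x * g x) has_derivative
      (\<lambda>h. f x * frechet_derivative g (at x) h + frechet_derivative f (at x) h * g x)) (at x)"
    using assms by (intro has_derivative_mult) (simp_all flip: frechet_derivative_works)
  then show ?thesis
    by (simp add: pderiv_at_eq) (simp add: pderiv_at_def)
qed

lemma pderiv_at_const: "pderiv_at i (\<lambda>x. c) = (\<lambda>x. 0)"
  by (rule ext) (simp add: pderiv_at_eq[OF has_derivative_const])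

lemma has_derivative_coord:
  "((\<lambda>x::real^'n. of_real (x $ k) :: 'a::real_normed_field) has_derivative (\<lambda>h. of_real (h $ k))) (at x within S)"
  by (intro bounded_linear_imp_has_derivative bounded_linear_compose[OF bounded_linear_of_real]
      bounded_linear_vec_nth)

lemma pderiv_at_coord: "pderiv_at i (\<lambda>x. of_real (x $ k)) = (\<lambda>x. if i = k then 1 else 0)"
  by (rule ext) (auto simp: pderiv_at_eq[OF has_derivative_coord] axis_def)

lemma smooth_const [simp]: "smooth (\<lambda>x. c)"
  by (rule smoothI[where C = "range (\<lambda>c x. c)"]) (auto simp: pderiv_at_const)

lemma smooth_coord [simp]: "smooth (\<lambda>x. of_real (x $ k))"
proof (rule smoothI[where C = "insert (\<lambda>x. of_real (x $ k)) (range (\<lambda>c x. c))"])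
  fix g :: "real^'a \<Rightarrow> complex"
  assume "g \<in> insert (\<lambda>x. of_real (x $ k)) (range (\<lambda>c x. c))"
  then show "g differentiable_on UNIV"
    using has_derivative_coord[of k, where 'a = complex]
    by (auto simp: differentiable_on_def intro: differentiableI)
next
  fix g :: "real^'a \<Rightarrow> complex" and i
  assume "g \<in> insert (\<lambda>x. of_real (x $ k)) (range (\<lambda>c x. c))"
  then show "pderiv_at i g \<in> insert (\<lambda>x. of_real (x $ k)) (range (\<lambda>c x. c))"
    by (auto simp: pderiv_at_const pderiv_at_coord)
qed simp

lemma smooth_add [simp]: "smooth f \<Longrightarrow> smooth g \<Longrightarrow> smooth (\<lambda>x. f x + g x)"
proof (rule smoothI[where C = "{\<lambda>x. u x + v x | u v. smooth u \<and> smooth v}"])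
  fix h i assume "h \<in> {\<lambda>x. u x + v x | u v. smooth u \<and> smooth (v :: real^'a \<Rightarrow> complex)}"
  then obtain u v where h: "h = (\<lambda>x. u x + v x)" "smooth u" "smooth v" by blast
  then have "pderiv_at i h = (\<lambda>x. pderiv_at i u x + pderiv_at i v x)"
    by (auto simp: pderiv_at_add smooth_differentiable)
  then show "pderiv_at i h \<in> {\<lambda>x. u x + v x | u v. smooth u \<and> smooth v}"
    using h smooth_pderiv by blast
next
  fix h assume "h \<in> {\<lambda>x. u x + v x | u v. smooth u \<and> smooth (v :: real^'a \<Rightarrow> complex)}"
  then show "h differentiable_on UNIV"
    by (auto simp: differentiable_on_def intro!: derivative_intros intro: smooth_differentiable)
qed blast

text \<open>The Leibniz rule turns one product into a sum of two, so the class for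
  \<open>smoothI\<close> has to contain sums of products.\<close>

inductive_set sum_prod :: "(real^'n \<Rightarrow> complex) set" where
  prod: "smooth f \<Longrightarrow> smooth g \<Longrightarrow> (\<lambda>x. f x * g x) \<in> sum_prod"
| add: "f \<in> sum_prod \<Longrightarrow> g \<in> sum_prod \<Longrightarrow> (\<lambda>x. f x + g x) \<in> sum_prod"

lemma sum_prod_differentiable: "f \<in> sum_prod \<Longrightarrow> f differentiable (at x)"
  by (induction rule: sum_prod.induct) (auto intro!: derivative_intros intro: smooth_differentiable)

lemma sum_prod_pderiv: "f \<in> sum_prod \<Longrightarrow> pderiv_at i f \<in> sum_prod"
proof (induction rule: sum_prod.induct)
  case (prod f g)
  then have "pderiv_at i (\<lambda>x. f x * g x) = (\<lambda>x. f x * pderiv_at i g x + pderiv_at i f x * g x)"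
    by (auto simp: pderiv_at_mult smooth_differentiable)
  then show ?case using prod by (auto intro!: sum_prod.intros smooth_pderiv)
next
  case (add f g)
  then have "pderiv_at i (\<lambda>x. f x + g x) = (\<lambda>x. pderiv_at i f x + pderiv_at i g x)"
    by (auto simp: pderiv_at_add sum_prod_differentiable)
  then show ?case using add by (auto intro!: sum_prod.intros)
qed

lemma smooth_mult [simp]: "smooth f \<Longrightarrow> smooth g \<Longrightarrow> smooth (\<lambda>x. f x * g x)"
  by (rule smoothI[where C = sum_prod])
    (auto intro: sum_prod.intros sum_prod_pderiv sum_prod_differentiable differentiable_at_imp_differentiable_on)

lemma smooth_prod: "(\<And>i. i \<in> I \<Longrightarrow> smooth (f i)) \<Longrightarrow> smooth (\<lambda>x. \<Prod>i\<in>I. f i x)"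
  by (induction I rule: infinite_finite_induct) auto

text \<open>The chain rule yields a sum over the coordinates of such compositions, hence the closure
  under addition.\<close>

inductive_set affine_comp :: "real^'n^'n \<Rightarrow> real^'n \<Rightarrow> (real^'n \<Rightarrow> complex) set" for M h where
  comp: "smooth f \<Longrightarrow> (\<lambda>x. f (M *v x + h)) \<in> affine_comp M h"
| add: "f \<in> affine_comp M h \<Longrightarrow> g \<in> affine_comp M h \<Longrightarrow> (\<lambda>x. f x + g x) \<in> affine_comp M h"

lemma affine_comp_sum:
  assumes "finite I" "\<And>i. i \<in> I \<Longrightarrow> f i \<in> affine_comp M h"
  shows "(\<lambda>x. \<Sum>i\<in>I. f i x) \<in> affine_comp M h"
  using assms
proof (induction I rule: finite_induct)
  case empty
  then show ?case using affine_comp.comp[of "\<lambda>x. 0"] by simp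
qed (auto intro: affine_comp.add)

lemma has_derivative_affine_comp:
  fixes f :: "real^'n \<Rightarrow> 'b::real_normed_vector"
  assumes "(f has_derivative D) (at (M *v x + h))"
  shows "((\<lambda>x. f (M *v x + h)) has_derivative (\<lambda>v. D (M *v v))) (at x)"
proof -
  have "((\<lambda>x. M *v x + h) has_derivative (\<lambda>v. M *v v)) (at x)"
    by (auto intro!: derivative_eq_intros bounded_linear_imp_has_derivative matrix_vector_mul_bounded_linear)
  from diff_chain_at[OF this assms] show ?thesis by (simp add: o_def)
qed

lemma linear_axis_expand:
  fixes D :: "real^'n \<Rightarrow> 'b::real_vector"
  assumes "linear D"
  shows "D v = (\<Sum>k\<in>UNIV. v $ k *\<^sub>R D (axis k 1))"
proof -
  have "D v = D (\<Sum>k\<in>UNIV. v $ k *\<^sub>R axis k 1)"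
    by (simp add: basis_expansion flip: scalar_mult_eq_scaleR)
  then show ?thesis by (simp add: linear_sum[OF assms] linear_scale[OF assms])
qed

lemma affine_comp_differentiable: "f \<in> affine_comp M h \<Longrightarrow> f differentiable (at x)"
proof (induction rule: affine_comp.induct)
  case (comp f)
  then show ?case
    using has_derivative_affine_comp[of f _ M x h] smooth_differentiable[of f "M *v x + h"]
    by (auto simp: differentiable_def)
qed (rule differentiable_add)

lemma affine_comp_pderiv: "f \<in> affine_comp M h \<Longrightarrow> pderiv_at i f \<in> affine_comp M h"
proof (induction rule: affine_comp.induct)
  case (comp f)
  have "pderiv_at i (\<lambda>x. f (M *v x + h)) x =
     (\<Sum>k\<in>UNIV. of_real ((M *v axis i 1) $ k) * pderiv_at k f (M *v x + h))" for x
  proof -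
    let ?D = "frechet_derivative f (at (M *v x + h))"
    have D: "(f has_derivative ?D) (at (M *v x + h))"
      by (simp add: comp smooth_differentiable flip: frechet_derivative_works)
    have "pderiv_at i (\<lambda>x. f (M *v x + h)) x = ?D (M *v axis i 1)"
      using has_derivative_affine_comp[OF D] by (rule pderiv_at_eq)
    also have "\<dots> = (\<Sum>k\<in>UNIV. (M *v axis i 1) $ k *\<^sub>R ?D (axis k 1))"
      using D by (intro linear_axis_expand) (rule has_derivative_linear)
    finally show ?thesis by (simp add: pderiv_at_def scaleR_conv_of_real)
  qed
  then have eq: "pderiv_at i (\<lambda>x. f (M *v x + h)) =
     (\<lambda>x. \<Sum>k\<in>UNIV. of_real ((M *v axis i 1) $ k) * pderiv_at k f (M *v x + h))" ..
  show ?case unfolding eq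
    using affine_comp.comp[of "\<lambda>x. of_real ((M *v axis i 1) $ k) * pderiv_at k f x" M h for k] comp
    by (intro affine_comp_sum) (auto simp: smooth_pderiv)
next
  case (add f g)
  then have "pderiv_at i (\<lambda>x. f x + g x) = (\<lambda>x. pderiv_at i f x + pderiv_at i g x)"
    by (auto simp: pderiv_at_add affine_comp_differentiable)
  then show ?case using add by (auto intro!: affine_comp.intros)
qed

lemma smooth_affine:
  fixes M :: "real^'n^'n"
  shows "smooth f \<Longrightarrow> smooth (\<lambda>x. f (M *v x + h))"
  by (rule smoothI[where C = "affine_comp M h"])
    (auto intro: affine_comp.intros affine_comp_pderiv affine_comp_differentiable
      differentiable_at_imp_differentiable_on)

lemma test_function_iff: "test_function f \<longleftrightarrow> smooth f \<and> (\<exists>r. \<forall>x. f x \<noteq> 0 \<longrightarrow> norm x \<le> r)"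
  by (auto simp: test_function_def bounded_iff)

lemma test_function_smooth: "test_function f \<Longrightarrow> smooth f"
  by (simp add: test_function_def)

lemma test_function_support:
  assumes "test_function f"
  obtains r where "r > 0" "\<And>x. norm x \<ge> r \<Longrightarrow> f x = 0"
proof -
  obtain r where r: "\<forall>x. f x \<noteq> 0 \<longrightarrow> norm x \<le> r" using assms by (auto simp: test_function_iff)
  show ?thesis
  proof (rule that[of "\<bar>r\<bar> + 1"])
    show "f x = 0" if "norm x \<ge> \<bar>r\<bar> + 1" for x
      using r[rule_format, of x] that by (cases "f x = 0") auto
  qed simp
qed

lemma test_function_mult: "smooth f \<Longrightarrow> test_function g \<Longrightarrow> test_function (\<lambda>x. f x * g x)"
  by (auto simp: test_function_iff)

lemma test_function_pderiv:
  assumes "test_function f" shows "test_function (pderiv_at i f)"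
proof -
  obtain r where r: "r > 0" "\<And>x. norm x \<ge> r \<Longrightarrow> f x = 0"
    using test_function_support[OF assms] by metis
  have "pderiv_at i f x = 0" if "norm x > r" for x
  proof -
    have "(f has_derivative (\<lambda>h. 0)) (at x)"
    proof (rule has_derivative_transform_within_open[where f = "\<lambda>x. 0" and s = "{x. norm x > r}"])
      have "{x::real^'a. norm x > r} = - cball 0 r" by auto
      then show "open {x::real^'a. norm x > r}" by (metis closed_cball open_Compl)
    qed (use that r in auto)
    then show ?thesis by (simp add: pderiv_at_eq)
  qed
  then have "\<forall>x. pderiv_at i f x \<noteq> 0 \<longrightarrow> norm x \<le> r" by (metis not_le)
  then show ?thesis
    using assms by (auto simp: test_function_iff smooth_pderiv)
qed

lemma test_function_affine:
  fixes f :: "real^'n \<Rightarrow> complex" and M :: "real^'n^'n"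
  assumes "test_function f" "invertible M" shows "test_function (\<lambda>x. f (M *v x + h))"
proof -
  obtain r where r: "r > 0" "\<And>x. norm x \<ge> r \<Longrightarrow> f x = 0"
    using test_function_support[OF assms(1)] by metis
  obtain M' where M': "M' ** M = mat 1" using assms(2) by (auto simp: invertible_def)
  have "bounded ((\<lambda>y. M' *v (y - h)) ` cball 0 r)"
    by (intro compact_imp_bounded compact_continuous_image continuous_intros
         continuous_on_compose2[OF matrix_vector_mult_linear_continuous_on]) auto
  then obtain R where R: "\<And>y. norm y \<le> r \<Longrightarrow> norm (M' *v (y - h)) \<le> R"
    by (force simp: bounded_iff)
  have supp: "norm x \<le> R" if "f (M *v x + h) \<noteq> 0" for x
  proof -
    have "norm (M *v x + h) \<le> r" using r(2)[of "M *v x + h"] that by force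
    from R[OF this] show ?thesis by (simp add: matrix_vector_mul_assoc M')
  qed
  moreover have "smooth (\<lambda>x. f (M *v x + h))"
    by (rule smooth_affine[OF test_function_smooth[OF assms(1)]])
  ultimately show ?thesis unfolding test_function_iff by blast
qed

lemma test_function_shift: "test_function f \<Longrightarrow> test_function (\<lambda>x. f (x + h))"
  using test_function_affine[of f "mat 1" h] by (auto simp: invertible_def intro!: exI[of _ "mat 1"])

lemma test_function_linear:
  fixes M :: "real^'n^'n"
  shows "test_function f \<Longrightarrow> invertible M \<Longrightarrow> test_function (\<lambda>x. f (M *v x))"
  using test_function_affine[of f M 0] by simp

subsection \<open>Bump functions\<close>

text \<open>The flat function exp(-1/t), extended by 0. The polynomial factor in 1/t is a parameter
  because differentiation stays within this family.\<close>

definition exp_bump :: "real poly \<Rightarrow> real \<Rightarrow> real" where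
  "exp_bump p t = (if t > 0 then poly p (inverse t) * exp (- inverse t) else 0)"

lemma exp_bump_0 [simp]: "exp_bump 0 t = 0"
  by (simp add: exp_bump_def)

lemma minus_matrix_vector_mult: "(- M) *v x = - (M *v x)" for M :: "'a::comm_ring_1^'n^'m"
  by (simp add: vec_eq_iff matrix_vector_mult_def sum_negf)

lemma tendsto_poly_exp_0: "((\<lambda>x::real. x ^ k * poly p x * exp (- x)) \<longlongrightarrow> 0) at_top"
proof (induction p arbitrary: k)
  case 0
  then show ?case by simp
next
  case (pCons a p)
  have "((\<lambda>x::real. a * (x ^ k / exp x) + x ^ Suc k * poly p x * exp (- x)) \<longlongrightarrow> a * 0 + 0) at_top"
    by (intro tendsto_intros tendsto_power_div_exp_0 pCons.IH)
  then show ?case by (simp add: algebra_simps exp_minus divide_inverse)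
qed

text \<open>With u = 1/t one has du/dt = -u^2, so p(u) exp(-u) has derivative u^2 (p - p')(u)
  exp(-u). At t = 0 the difference quotient is u p(u) exp(-u), which tends to 0 as u grows.\<close>

lemma exp_bump_deriv:
  "(exp_bump p has_real_derivative exp_bump ([:0, 0, 1:] * (p - pderiv p)) t) (at t)"
proof -
  consider "t > 0" | "t < 0" | "t = 0" by linarith
  then show ?thesis
  proof cases
    case 1
    have "((\<lambda>t. poly p (inverse t) * exp (- inverse t)) has_real_derivative
        exp_bump ([:0, 0, 1:] * (p - pderiv p)) t) (at t)"
      using 1
      by (auto intro!: derivative_eq_intros DERIV_chain2[OF poly_DERIV]
          simp: exp_bump_def algebra_simps power2_eq_square)
    then show ?thesis
      by (rule has_field_derivative_transform_within_open[where S = "{0<..}"]) (use 1 in \<open>auto simp: exp_bump_def\<close>)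
  next
    case 2
    have "((\<lambda>t. 0) has_real_derivative exp_bump ([:0, 0, 1:] * (p - pderiv p)) t) (at t)"
      using 2 by (simp add: exp_bump_def)
    then show ?thesis
      by (rule has_field_derivative_transform_within_open[where S = "{..<0}"]) (use 2 in \<open>auto simp: exp_bump_def\<close>)
  next
    case 3
    have "((\<lambda>h. exp_bump p h / h) \<longlongrightarrow> 0) (at_left 0)"
      by (rule tendsto_eventually) (auto simp: eventually_at_filter exp_bump_def)
    moreover have "((\<lambda>h. exp_bump p h / h) \<longlongrightarrow> 0) (at_right 0)"
    proof -
      have "((\<lambda>h::real. inverse h ^ 1 * poly p (inverse h) * exp (- inverse h)) \<longlongrightarrow> 0) (at_right 0)"
        by (rule filterlim_compose[OF tendsto_poly_exp_0 filterlim_inverse_at_top_right])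
      then show ?thesis
        by (rule Lim_transform_eventually) (auto simp: eventually_at_filter exp_bump_def divide_inverse)
    qed
    ultimately have "((\<lambda>h. exp_bump p h / h) \<longlongrightarrow> 0) (at 0)"
      by (simp add: filterlim_at_split)
    then show ?thesis using 3 by (simp add: has_field_derivative_iff exp_bump_def)
  qed
qed

lemma smooth_exp_bump: "smooth (\<lambda>x. complex_of_real (exp_bump p (x $ i)))"
proof -
  let ?C = "range (\<lambda>p x. complex_of_real (exp_bump p (x $ i)))"
  have D: "((\<lambda>x. complex_of_real (exp_bump p (x $ i))) has_derivative
      (\<lambda>h. of_real (h $ i * exp_bump ([:0, 0, 1:] * (p - pderiv p)) (x $ i)))) (at x)" for p and x :: "real^'a"
    by (auto intro!: derivative_eq_intros has_derivative_of_real
        DERIV_compose_FDERIV[OF exp_bump_deriv] bounded_linear_imp_has_derivative bounded_linear_vec_nth)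
  have "pderiv_at j (\<lambda>x. complex_of_real (exp_bump p (x $ i))) =
      (\<lambda>x. complex_of_real (exp_bump (if j = i then [:0, 0, 1:] * (p - pderiv p) else 0) (x $ i)))" for j :: 'a and p
    by (rule ext) (auto simp: pderiv_at_eq[OF D] axis_def)
  then show ?thesis
    using D by (intro smoothI[where C = ?C]) (auto simp: differentiable_on_def intro!: differentiableI)
qed

lemma bump_exists:
  fixes x0 :: "real^'n"
  assumes "\<delta> > 0"
  obtains \<beta> where "test_function (\<lambda>x. complex_of_real (\<beta> x))" "\<And>x. \<beta> x \<ge> 0" "\<beta> x0 > 0"
    "\<And>x. \<beta> x \<noteq> 0 \<Longrightarrow> norm (x - x0) < \<delta>"
proof
  \<comment> \<open>The support is a cube with half-side \<open>e\<close>, and the norm is at most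
    the sum of the absolute values of the d coordinates.\<close>
  define e where "e = \<delta> / real CARD('n)"
  define \<beta> where "\<beta> = (\<lambda>x. \<Prod>i\<in>UNIV. exp_bump 1 (x $ i - x0 $ i + e) * exp_bump 1 (x0 $ i - x $ i + e))"
  have e: "e > 0" using assms by (simp add: e_def)
  have "smooth (\<lambda>x::real^'n. complex_of_real (exp_bump 1 (x $ i - x0 $ i + e)) * complex_of_real (exp_bump 1 (x0 $ i - x $ i + e)))" for i
  proof (rule smooth_mult)
    have "smooth (\<lambda>x. complex_of_real (exp_bump 1 ((mat 1 *v x + (\<chi> i. e - x0 $ i)) $ i)))"
      by (rule smooth_affine[OF smooth_exp_bump])
    then show "smooth (\<lambda>x::real^'n. complex_of_real (exp_bump 1 (x $ i - x0 $ i + e)))" by (simp add: algebra_simps)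
    have "smooth (\<lambda>x. complex_of_real (exp_bump 1 (((- mat 1) *v x + (\<chi> i. e + x0 $ i)) $ i)))"
      by (rule smooth_affine[OF smooth_exp_bump])
    then show "smooth (\<lambda>x::real^'n. complex_of_real (exp_bump 1 (x0 $ i - x $ i + e)))"
      by (simp add: algebra_simps minus_matrix_vector_mult)
  qed
  then have sm: "smooth (\<lambda>x. complex_of_real (\<beta> x))"
    unfolding \<beta>_def of_real_prod of_real_mult by (rule smooth_prod)
  show supp: "norm (x - x0) < \<delta>" if "\<beta> x \<noteq> 0" for x
  proof -
    have "\<bar>(x - x0) $ i\<bar> < e" for i
      using that by (auto simp: \<beta>_def exp_bump_def split: if_splits dest: spec[of _ i])
    then have "(\<Sum>i\<in>UNIV. \<bar>(x - x0) $ i\<bar>) < (\<Sum>i\<in>(UNIV::'n set). e)"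
      by (intro sum_strict_mono) auto
    then show ?thesis using norm_le_l1_cart[of "x - x0"] by (simp add: e_def)
  qed
  have "norm x \<le> norm x0 + \<delta>" if "complex_of_real (\<beta> x) \<noteq> 0" for x
    using supp[of x] that norm_triangle_ineq2[of x x0] by simp
  then show "test_function (\<lambda>x. complex_of_real (\<beta> x))"
    using sm by (auto simp: test_function_iff)
  show "\<beta> x \<ge> 0" for x by (auto simp: \<beta>_def exp_bump_def intro!: prod_nonneg)
  show "\<beta> x0 > 0" using e by (auto simp: \<beta>_def exp_bump_def intro!: prod_pos)
qed

subsection \<open>Integration\<close>

lemma integrable_compact_support:
  fixes f :: "'a::euclidean_space \<Rightarrow> 'b::{banach, second_countable_topology}"
  assumes "continuous_on UNIV f" "\<And>x. norm x \<ge> r \<Longrightarrow> f x = 0"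
  shows "integrable lborel f"
proof -
  have "integrable lborel (\<lambda>x. indicator (cball 0 r) x *\<^sub>R f x)"
    by (rule borel_integrable_compact) (auto intro: continuous_on_subset[OF assms(1)])
  also have "(\<lambda>x. indicator (cball 0 r) x *\<^sub>R f x) = f"
    using assms(2) by (force simp: indicator_def fun_eq_iff)
  finally show ?thesis .
qed

lemma integrable_mult_test:
  assumes "continuous_on UNIV g" "test_function f"
  shows "integrable lborel (\<lambda>x. g x * f x)"
proof -
  obtain r where "\<And>x. norm x \<ge> r \<Longrightarrow> f x = 0"
    using test_function_support[OF assms(2)] by metis
  then show ?thesis
    using assms by (intro integrable_compact_support[where r = r] continuous_intros)
      (auto intro: smooth_continuous_on test_function_smooth)
qed

lemma integrable_test: "test_function f \<Longrightarrow> integrable lborel f"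
  using integrable_mult_test[of "\<lambda>x. 1" f] by simp

text \<open>The set where \<open>f\<close> is nonzero is open and null, and a nonempty open set is
  not null.\<close>

lemma continuous_integral_0_imp_0:
  fixes f :: "'a::euclidean_space \<Rightarrow> real"
  assumes "continuous_on UNIV f" "\<And>x. f x \<ge> 0" "integrable lborel f" "(LINT x|lborel. f x) = 0"
  shows "f x = 0"
proof (rule ccontr)
  assume "f x \<noteq> 0"
  have "AE x in lborel. f x = 0"
    using integral_nonneg_eq_0_iff_AE[of lborel f] assms by auto
  moreover have op: "open {x. f x \<noteq> 0}"
    using open_Collect_neq[OF assms(1) continuous_on_const] by simp
  ultimately have "{x. f x \<noteq> 0} \<in> null_sets lborel"
    using AE_iff_measurable[of "{x. f x \<noteq> 0}" lborel "\<lambda>x. f x = 0"] by (auto intro: null_setsI)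
  then have "negligible {x. f x \<noteq> 0}"
    by (simp add: negligible_iff_null_sets null_sets_completionI)
  with op \<open>f x \<noteq> 0\<close> show False using open_not_negligible by blast
qed

text \<open>The fundamental lemma of the calculus of variations. Multiplication by the conjugate of
  \<open>g x\<close> makes the real part positive near \<open>x\<close>, where a bump then gives a
  positive integral.\<close>

lemma continuous_eq_0I:
  fixes g :: "real^'n \<Rightarrow> complex"
  assumes cont: "continuous_on UNIV g"
    and zero: "\<And>f. test_function f \<Longrightarrow> (LINT x|lborel. g x * f x) = 0"
  shows "g x = 0"
proof (rule ccontr)
  assume nz: "g x \<noteq> 0"
  define G where "G = (\<lambda>y. Re (cnj (g x) * g y))"
  have contG: "continuous_on UNIV G"
    unfolding G_def by (intro continuous_intros cont)
  have "G x > 0" using nz by (simp add: G_def complex_neq_0 flip: power2_eq_square)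
  moreover have "open {y. G y > 0}" using open_Collect_less[OF continuous_on_const contG] by simp
  ultimately obtain \<delta> where \<delta>: "\<delta> > 0" "\<And>y. norm (y - x) < \<delta> \<Longrightarrow> G y > 0"
    by (auto simp: open_dist dist_norm)
  obtain \<beta> where \<beta>: "test_function (\<lambda>x. complex_of_real (\<beta> x))" "\<And>x. \<beta> x \<ge> 0" "\<beta> x > 0"
    "\<And>y. \<beta> y \<noteq> 0 \<Longrightarrow> norm (y - x) < \<delta>"
    using bump_exists[OF \<delta>(1), of x] by metis
  have cb: "continuous_on UNIV \<beta>"
    using continuous_on_Re[OF smooth_continuous_on[OF test_function_smooth[OF \<beta>(1)]]] by simp
  have int: "integrable lborel (\<lambda>y. cnj (g x) * (g y * of_real (\<beta> y)))"
    by (intro integrable_mult_right integrable_mult_test cont \<beta>)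
  have eq: "G y * \<beta> y = Re (cnj (g x) * (g y * of_real (\<beta> y)))" for y
    by (simp add: G_def algebra_simps)
  have "integrable lborel (\<lambda>y. G y * \<beta> y)" unfolding eq by (rule integrable_Re[OF int])
  moreover have "(LINT y|lborel. G y * \<beta> y) = 0"
    unfolding eq integral_Re[OF int] by (simp add: zero[OF \<beta>(1)])
  moreover have "G y * \<beta> y \<ge> 0" for y
    using \<beta>(2)[of y] \<beta>(4)[of y] \<delta>(2)[of y] by (cases "\<beta> y = 0") (auto simp: less_imp_le)
  ultimately have "G x * \<beta> x = 0"
    using continuous_integral_0_imp_0[of "\<lambda>y. G y * \<beta> y"] contG cb by (auto intro: continuous_intros)
  with \<open>G x > 0\<close> \<beta>(3) show False by simp
qed

section \<open>Translations and linear substitutions in Lebesgue integrals\<close>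

lemma lborel_integrable_shiftI:
  fixes f :: "'a::euclidean_space \<Rightarrow> 'b::{banach, second_countable_topology}"
  assumes "integrable lborel f"
  shows "integrable lborel (\<lambda>x. f (x + h))" and "(LINT x|lborel. f (x + h)) = (LINT x|lborel. f x)"
proof -
  have [measurable]: "f \<in> borel_measurable borel"
    using borel_measurable_integrable[OF assms] by simp
  show "integrable lborel (\<lambda>x. f (x + h))"
    using integrable_distr_eq[of "(+) h" lborel borel f] assms by (simp add: lborel_distr_plus add.commute)
  show "(LINT x|lborel. f (x + h)) = (LINT x|lborel. f x)"
    using integral_distr[of "(+) h" lborel borel f] by (simp add: lborel_distr_plus add.commute)
qed

text \<open>If \<open>f\<close> is not integrable, neither is its translate, and both Bochner
  integrals take the default value 0.\<close>

lemma lborel_integral_shift: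
  fixes f :: "'a::euclidean_space \<Rightarrow> 'b::{banach, second_countable_topology}"
  shows "(LINT x|lborel. f (x + h)) = (LINT x|lborel. f x)"
proof (cases "integrable lborel f")
  case True
  then show ?thesis by (rule lborel_integrable_shiftI)
next
  case False
  then have "\<not> integrable lborel (\<lambda>x. f (x + h))"
    using lborel_integrable_shiftI(1)[of "\<lambda>x. f (x + h)" "- h"] by auto
  with False show ?thesis by (simp add: not_integrable_integral_eq)
qed

lemma lborel_nn_integral_shift:
  fixes f :: "'a::euclidean_space \<Rightarrow> ennreal"
  assumes [measurable]: "f \<in> borel_measurable borel"
  shows "(\<integral>\<^sup>+x. f (x + h) \<partial>lborel) = (\<integral>\<^sup>+x. f x \<partial>lborel)"
  using nn_integral_distr[of "(+) h" lborel borel f] by (simp add: lborel_distr_plus add.commute)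

lemma measurable_matrix_vector_mult [measurable]:
  "(\<lambda>x. M *v x) \<in> borel_measurable borel" for M :: "real^'n^'m"
  by (intro borel_measurable_continuous_onI matrix_vector_mult_linear_continuous_on)

text \<open>Uniqueness of Haar measure: integrate \<open>f (M x) g (y - M x)\<close> over \<open>x\<close> and \<open>y\<close> in either order.\<close>

lemma linear_image_lborel:
  fixes M :: "real^'n^'n"
  assumes "invertible M"
  obtains \<kappa> where "\<kappa> > 0" "distr lborel borel (\<lambda>x. M *v x) = density lborel (\<lambda>_. ennreal \<kappa>)"
proof -
  obtain M' where M': "M' ** M = mat 1" "M ** M' = mat 1" using assms by (auto simp: invertible_def)
  \<comment> \<open>Any function with positive finite integral would serve; the unit ball makes both
    constants measures of explicit sets.\<close>
  define g where "g = (indicator (ball 0 1) :: real^'n \<Rightarrow> ennreal)"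
  have [measurable]: "g \<in> borel_measurable borel"
    unfolding g_def by (intro borel_measurable_indicator) simp
  let ?b = "emeasure lborel (ball (0::real^'n) 1)"
  let ?c = "\<integral>\<^sup>+x. g (- (M *v x)) \<partial>lborel"
  have main: "(\<integral>\<^sup>+x. f (M *v x) \<partial>lborel) * ?b = ?c * (\<integral>\<^sup>+x. f x \<partial>lborel)"
    if [measurable]: "f \<in> borel_measurable borel" for f :: "real^'n \<Rightarrow> ennreal"
  proof -
    have "(\<integral>\<^sup>+x. f (M *v x) \<partial>lborel) * ?b = (\<integral>\<^sup>+x. f (M *v x) * (\<integral>\<^sup>+y. g y \<partial>lborel) \<partial>lborel)"
      by (simp add: nn_integral_multc g_def)
    also have "\<dots> = (\<integral>\<^sup>+x. f (M *v x) * (\<integral>\<^sup>+y. g (y + - (M *v x)) \<partial>lborel) \<partial>lborel)"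
      by (subst lborel_nn_integral_shift) auto
    also have "\<dots> = (\<integral>\<^sup>+x. (\<integral>\<^sup>+y. f (M *v x) * g (y + - (M *v x)) \<partial>lborel) \<partial>lborel)"
      by (subst nn_integral_cmult) auto
    also have "\<dots> = (\<integral>\<^sup>+y. (\<integral>\<^sup>+x. f (M *v x) * g (y + - (M *v x)) \<partial>lborel) \<partial>lborel)"
      by (rule lborel_pair.Fubini') simp
    \<comment> \<open>Translating \<open>x\<close> by the preimage of \<open>y\<close> removes
      \<open>y\<close> from the argument of \<open>g\<close>.\<close>
    also have "\<dots> = (\<integral>\<^sup>+y. (\<integral>\<^sup>+x. f (M *v (x + M' *v y)) * g (y + - (M *v (x + M' *v y))) \<partial>lborel) \<partial>lborel)"
      by (intro nn_integral_cong lborel_nn_integral_shift[symmetric]) measurable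
    also have "\<dots> = (\<integral>\<^sup>+y. (\<integral>\<^sup>+x. f (M *v x + y) * g (- (M *v x)) \<partial>lborel) \<partial>lborel)"
      by (simp add: matrix_vector_right_distrib matrix_vector_mul_assoc M')
    also have "\<dots> = (\<integral>\<^sup>+x. (\<integral>\<^sup>+y. f (M *v x + y) * g (- (M *v x)) \<partial>lborel) \<partial>lborel)"
      by (rule lborel_pair.Fubini'[symmetric]) simp
    also have "\<dots> = (\<integral>\<^sup>+x. (\<integral>\<^sup>+y. f (y + M *v x) \<partial>lborel) * g (- (M *v x)) \<partial>lborel)"
      by (simp add: nn_integral_multc add.commute)
    also have "\<dots> = ?c * (\<integral>\<^sup>+x. f x \<partial>lborel)"
      by (simp add: lborel_nn_integral_shift nn_integral_cmult mult.commute)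
    finally show ?thesis .
  qed
  have b: "?b > 0" "?b < \<infinity>"
    using emeasure_lborel_ball_finite[of "0::real^'n" 1] content_ball_pos[of 1 "0::real^'n"]
    by (auto simp: emeasure_eq_ennreal_measure top.not_eq_extremum)
  obtain K where K: "K > 0" "\<And>x. norm (M *v x) \<le> norm x * K"
    using bounded_linear.pos_bounded[OF matrix_vector_mul_bounded_linear[of M]] by auto
  obtain K' where K': "K' > 0" "\<And>x. norm (M' *v x) \<le> norm x * K'"
    using bounded_linear.pos_bounded[OF matrix_vector_mul_bounded_linear[of M']] by auto
  have c: "?c = emeasure lborel {x. norm (M *v x) < 1}"
  proof -
    have "?c = (\<integral>\<^sup>+x. indicator {x. norm (M *v x) < 1} x \<partial>lborel)"
      by (intro nn_integral_cong) (auto simp: g_def indicator_def)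
    also have "\<dots> = emeasure lborel {x. norm (M *v x) < 1}"
      by (rule nn_integral_indicator) measurable
    finally show ?thesis .
  qed
  \<comment> \<open>The set measured by \<open>?c\<close> contains a ball and is contained in one,
    so \<open>?c\<close> is positive and finite and the equation can be solved for the image
    measure.\<close>
  have "ball 0 (inverse K) \<subseteq> {x. norm (M *v x) < 1}"
  proof
    fix x :: "real^'n" assume "x \<in> ball 0 (inverse K)"
    then have "norm x * K < 1" using K(1) by (simp add: field_simps)
    with K(2)[of x] show "x \<in> {x. norm (M *v x) < 1}" by simp
  qed
  then have "emeasure lborel (ball (0::real^'n) (inverse K)) \<le> ?c"
    unfolding c by (intro emeasure_mono) measurable
  moreover have "emeasure lborel (ball (0::real^'n) (inverse K)) > 0"
    using emeasure_lborel_ball_finite[of "0::real^'n" "inverse K"] content_ball_pos[of "inverse K" "0::real^'n"] K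
    by (auto simp: emeasure_eq_ennreal_measure top.not_eq_extremum)
  ultimately have c0: "?c > 0" by (rule order.strict_trans2[rotated])
  have "{x. norm (M *v x) < 1} \<subseteq> ball 0 (K' + 1)"
  proof
    fix x assume x: "x \<in> {x. norm (M *v x) < 1}"
    have "norm x \<le> norm (M *v x) * K'" using K'(2)[of "M *v x"] by (simp add: matrix_vector_mul_assoc M')
    also have "\<dots> \<le> 1 * K'" using x K' by (intro mult_right_mono) auto
    finally show "x \<in> ball 0 (K' + 1)" by simp
  qed
  then have "?c \<le> emeasure lborel (ball (0::real^'n) (K' + 1))"
    unfolding c by (intro emeasure_mono) auto
  also have "\<dots> < \<infinity>" by (rule emeasure_lborel_ball_finite)
  finally have c1: "?c < \<infinity>" .
  obtain b' where b': "?b = ennreal b'" "b' > 0"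
    using b by (auto simp: less_top_ennreal ennreal_less_zero_iff)
  obtain c' where c': "?c = ennreal c'" "c' > 0"
    using c0 c1 by (auto simp: less_top_ennreal ennreal_less_zero_iff)
  define \<kappa> where "\<kappa> = c' / b'"
  have \<kappa>: "\<kappa> > 0"
    using b' c' by (simp add: \<kappa>_def)
  show ?thesis
  proof (rule that[OF \<kappa>], rule measure_eqI)
    fix S assume "S \<in> sets (distr lborel borel (\<lambda>x. M *v x))"
    then have [measurable]: "S \<in> sets borel" by simp
    have "emeasure (distr lborel borel (\<lambda>x. M *v x)) S * ?b = ?c * emeasure lborel S"
      using main[of "indicator S"] nn_integral_distr[of "\<lambda>x. M *v x" lborel borel "indicator S"] by simp
    then have *: "emeasure (distr lborel borel (\<lambda>x. M *v x)) S * ennreal b' = ennreal c' * emeasure lborel S"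
      by (simp only: b' c')
    have "emeasure (distr lborel borel (\<lambda>x. M *v x)) S
      = emeasure (distr lborel borel (\<lambda>x. M *v x)) S * (ennreal b' * ennreal (1 / b'))"
      using b' by (simp flip: ennreal_mult)
    also have "\<dots> = ennreal c' * ennreal (1 / b') * emeasure lborel S"
      by (simp only: mult.assoc[symmetric] *) (simp only: mult_ac)
    also have "\<dots> = ennreal \<kappa> * emeasure lborel S"
      using b' c' by (simp add: \<kappa>_def flip: ennreal_mult)
    also have "\<dots> = emeasure (density lborel (\<lambda>_. ennreal \<kappa>)) S"
      by (simp add: emeasure_density_const)
    finally show "emeasure (distr lborel borel (\<lambda>x. M *v x)) S = emeasure (density lborel (\<lambda>_. ennreal \<kappa>)) S" .
  qed simp
qed

text \<open>The factor is the reciprocal of |det M|. It is left abstract and absorbed into the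
  constant of the refinement equation.\<close>

lemma linear_substitution:
  fixes M :: "real^'n^'n"
  assumes "invertible M"
  obtains \<kappa> where "\<kappa> > 0"
    "\<And>f :: real^'n \<Rightarrow> 'b::{banach, second_countable_topology}. integrable lborel f \<Longrightarrow> integrable lborel (\<lambda>x. f (M *v x))"
    "\<And>f :: real^'n \<Rightarrow> 'b. (LINT x|lborel. f (M *v x)) = \<kappa> *\<^sub>R (LINT x|lborel. f x)"
proof -
  obtain M' where M': "M' ** M = mat 1" "M ** M' = mat 1" using assms by (auto simp: invertible_def)
  obtain \<kappa> where \<kappa>: "\<kappa> > 0" "distr lborel borel (\<lambda>x. M *v x) = density lborel (\<lambda>_. ennreal \<kappa>)"
    using linear_image_lborel[OF assms] .
  have eq: "integrable lborel (\<lambda>x. f (M *v x)) \<longleftrightarrow> integrable lborel f"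
     "(LINT x|lborel. f (M *v x)) = \<kappa> *\<^sub>R (LINT x|lborel. f x)"
    if [measurable]: "f \<in> borel_measurable borel" for f :: "real^'n \<Rightarrow> 'b"
    using \<kappa> integrable_scaleR_right[of "inverse \<kappa>" lborel "\<lambda>x. \<kappa> *\<^sub>R f x"]
      integrable_distr_eq[of "\<lambda>x. M *v x" lborel borel f] integral_distr[of "\<lambda>x. M *v x" lborel borel f]
      integrable_density[of f lborel "\<lambda>_. \<kappa>"] integral_density[of f lborel "\<lambda>_. \<kappa>"] by auto
  show ?thesis
  proof (rule that[OF \<kappa>(1)])
    fix f :: "real^'n \<Rightarrow> 'b"
    show "integrable lborel (\<lambda>x. f (M *v x))" if "integrable lborel f"
      using eq(1)[of f] that borel_measurable_integrable[OF that] by simp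
    show "(LINT x|lborel. f (M *v x)) = \<kappa> *\<^sub>R (LINT x|lborel. f x)"
    proof (cases "f \<in> borel_measurable borel")
      case True
      then show ?thesis by (rule eq)
    next
      \<comment> \<open>Composition with the invertible \<open>M\<close> preserves
        non-measurability, so both integrals are 0 by default.\<close>
      case False
      have "f = (\<lambda>x. f (M *v (M' *v x)))" by (simp add: matrix_vector_mul_assoc M')
      then have "(\<lambda>x. f (M *v x)) \<notin> borel_measurable borel"
        using False measurable_compose[OF measurable_matrix_vector_mult[of M'], of "\<lambda>x. f (M *v x)" borel] by metis
      then have "\<not> integrable lborel (\<lambda>x. f (M *v x))" "\<not> integrable lborel f"
        using False borel_measurable_integrable by fastforce+
      then show ?thesis by (simp add: not_integrable_integral_eq)
    qed
  qed
qed

subsection \<open>Fourier transforms of test functions\<close>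

text \<open>The Fourier integral with positive sign and without the factor (2 pi)^(-d/2). Both
  \<open>fourier\<close> and its inverse are multiples of it, up to the sign of the
  argument.\<close>

definition cis_transform :: "(real^'n \<Rightarrow> complex) \<Rightarrow> real^'n \<Rightarrow> complex" where
  "cis_transform f \<xi> = (LINT x|lborel. f x * cis (\<xi> \<bullet> x))"

lemma fourier_eq_cis_transform:
  "fourier f \<xi> = of_real ((2 * pi) powr (- real CARD('n) / 2)) * cis_transform f (- \<xi>)" for \<xi> :: "real^'n"
  by (simp add: fourier_def cis_transform_def cis_conv_exp)

lemma measurable_cis_inner [measurable]: "(\<lambda>x. cis (\<xi> \<bullet> x)) \<in> borel_measurable borel"
  "(\<lambda>x. cis (x \<bullet> \<xi>)) \<in> borel_measurable borel" for \<xi> :: "'a::euclidean_space"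
  by (auto intro!: borel_measurable_continuous_onI continuous_intros simp: cis_conv_exp)

lemma integrable_mult_cis [simp]:
  fixes f :: "'a::euclidean_space \<Rightarrow> complex"
  assumes "integrable lborel f"
  shows "integrable lborel (\<lambda>x. f x * cis (\<xi> \<bullet> x))" "integrable lborel (\<lambda>x. f x * cis (x \<bullet> \<xi>))"
    "integrable lborel (\<lambda>x. f x * cis (- (x \<bullet> \<xi>)))"
proof -
  have [measurable]: "f \<in> borel_measurable borel" using borel_measurable_integrable[OF assms] by simp
  have [measurable]: "(\<lambda>x. cis (- (x \<bullet> \<xi>))) \<in> borel_measurable borel"
    using measurable_cis_inner(2)[of "- \<xi>"] by simp
  show "integrable lborel (\<lambda>x. f x * cis (\<xi> \<bullet> x))" "integrable lborel (\<lambda>x. f x * cis (x \<bullet> \<xi>))"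
    "integrable lborel (\<lambda>x. f x * cis (- (x \<bullet> \<xi>)))"
    by (rule Bochner_Integration.integrable_bound[OF assms]; simp add: norm_mult)+
qed

lemma cis_transform_cmult: "cis_transform (\<lambda>x. c * f x) \<xi> = c * cis_transform f \<xi>"
  by (simp add: cis_transform_def mult.assoc)

lemma cis_transform_shift: "cis_transform (\<lambda>x. f (x + h)) \<xi> = cis (- (\<xi> \<bullet> h)) * cis_transform f \<xi>"
proof -
  have "cis_transform (\<lambda>x. f (x + h)) \<xi> = (LINT x|lborel. f (x + h) * cis (\<xi> \<bullet> ((x + h) - h)))"
    by (simp add: cis_transform_def)
  also have "\<dots> = (LINT x|lborel. f x * cis (\<xi> \<bullet> (x - h)))"
    by (rule lborel_integral_shift[of "\<lambda>x. f x * cis (\<xi> \<bullet> (x - h))" h])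
  also have "\<dots> = (LINT x|lborel. cis (- (\<xi> \<bullet> h)) * (f x * cis (\<xi> \<bullet> x)))"
    by (intro Bochner_Integration.integral_cong refl) (simp add: inner_diff_right mult.left_commute cis_mult)
  finally show ?thesis by (simp add: cis_transform_def)
qed

lemma norm_cis_transform_le: "norm (cis_transform f \<xi>) \<le> (LINT x|lborel. norm (f x))"
proof -
  have "norm (cis_transform f \<xi>) \<le> (LINT x|lborel. norm (f x * cis (\<xi> \<bullet> x)))"
    unfolding cis_transform_def by (rule integral_norm_bound)
  then show ?thesis by (simp add: norm_mult)
qed

lemma cis_approx: "norm (cis (s + t) - cis s - \<i> * of_real t * cis s) \<le> t\<^sup>2"
proof -
  have "cis (s + t) - cis s - \<i> * of_real t * cis s = cis s * (cis t - 1 - \<i> * of_real t)"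
    by (simp add: algebra_simps cis_mult)
  then have "norm (cis (s + t) - cis s - \<i> * of_real t * cis s) = norm (cis t - 1 - \<i> * of_real t)"
    by (simp add: norm_mult)
  also have "\<dots> \<le> \<bar>t\<bar> ^ 2 / 2"
    using iexp_approx1[of t 1] by (simp add: cis_conv_exp algebra_simps numeral_2_eq_2)
  also have "\<dots> \<le> t\<^sup>2" by simp
  finally show ?thesis .
qed

text \<open>The second-order remainder of \<open>cis\<close> is at most the square of the increment,
  by \<open>cis_approx\<close>. Integrated against |f| this gives an error of order |y - \<xi>|^2,
  with the second absolute moment of \<open>f\<close> as constant.\<close>

lemma cis_transform_has_derivative:
  assumes f: "test_function f"
  shows "(cis_transform f has_derivative
    (\<lambda>k. LINT x|lborel. (\<i> * of_real (k \<bullet> x) * f x) * cis (\<xi> \<bullet> x))) (at \<xi>)" (is "(_ has_derivative ?D) _")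
proof -
  have int: "integrable lborel (\<lambda>x. (\<i> * of_real (k \<bullet> x) * f x) * cis (\<xi> \<bullet> x))" for k \<xi>
    by (intro integrable_mult_cis integrable_mult_test f continuous_intros)
  have "linear ?D"
  proof
    show "?D (k + l) = ?D k + ?D l" for k l
      unfolding Bochner_Integration.integral_add[OF int int, symmetric]
      by (simp add: inner_add_left algebra_simps)
    show "?D (c *\<^sub>R k) = c *\<^sub>R ?D k" for c k
      unfolding integral_scaleR_right[symmetric]
      by (intro Bochner_Integration.integral_cong refl) (simp add: scaleR_conv_of_real[where 'a = complex] mult_ac)
  qed
  then have bl: "bounded_linear ?D" by (rule linear_conv_bounded_linear[THEN iffD1])
  define C where "C = (LINT x|lborel. norm (of_real ((norm x)\<^sup>2) * f x))"
  have intC: "integrable lborel (\<lambda>x. of_real ((norm x)\<^sup>2) * f x)"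
    by (intro integrable_mult_test f continuous_intros)
  show ?thesis
  proof (rule has_derivativeI_sandwich[OF zero_less_one bl, where H = "\<lambda>y. C * norm (y - \<xi>)"])
    fix y assume "y \<noteq> \<xi>"
    have "norm (cis_transform f y - cis_transform f \<xi> - ?D (y - \<xi>))
      = norm (LINT x|lborel. f x * cis (y \<bullet> x) - f x * cis (\<xi> \<bullet> x) - (\<i> * of_real ((y - \<xi>) \<bullet> x) * f x) * cis (\<xi> \<bullet> x))"
      unfolding cis_transform_def
      using int[of "y - \<xi>" \<xi>] integrable_test[OF f] by simp
    also have "\<dots> \<le> (LINT x|lborel. norm (y - \<xi>) ^ 2 * norm (of_real ((norm x)\<^sup>2) * f x))"
    proof (rule order.trans[OF integral_norm_bound integral_mono])
      show "integrable lborel (\<lambda>x. norm (y - \<xi>) ^ 2 * norm (of_real ((norm x)\<^sup>2) * f x))"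
        using intC by (intro integrable_mult_right integrable_norm)
      show "integrable lborel (\<lambda>x. norm (f x * cis (y \<bullet> x) - f x * cis (\<xi> \<bullet> x) - (\<i> * of_real ((y - \<xi>) \<bullet> x) * f x) * cis (\<xi> \<bullet> x)))"
        by (intro integrable_norm Bochner_Integration.integrable_diff integrable_mult_cis(1) int integrable_test f)
      fix x :: "real^'a"
      have "norm (cis (y \<bullet> x) - cis (\<xi> \<bullet> x) - \<i> * of_real ((y - \<xi>) \<bullet> x) * cis (\<xi> \<bullet> x)) \<le> ((y - \<xi>) \<bullet> x)\<^sup>2"
        using cis_approx[of "\<xi> \<bullet> x" "(y - \<xi>) \<bullet> x"] by (simp add: inner_diff_left)
      also have "\<dots> \<le> (norm (y - \<xi>) * norm x)\<^sup>2"
        using Cauchy_Schwarz_ineq2[of "y - \<xi>" x] by (intro abs_le_square_iff[THEN iffD1]) simp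
      finally have "norm (f x) * norm (cis (y \<bullet> x) - cis (\<xi> \<bullet> x) - \<i> * of_real ((y - \<xi>) \<bullet> x) * cis (\<xi> \<bullet> x))
        \<le> norm (f x) * (norm (y - \<xi>) * norm x)\<^sup>2" by (intro mult_left_mono) auto
      moreover have "f x * cis (y \<bullet> x) - f x * cis (\<xi> \<bullet> x) - (\<i> * of_real ((y - \<xi>) \<bullet> x) * f x) * cis (\<xi> \<bullet> x)
        = f x * (cis (y \<bullet> x) - cis (\<xi> \<bullet> x) - \<i> * of_real ((y - \<xi>) \<bullet> x) * cis (\<xi> \<bullet> x))"
        by (simp add: algebra_simps)
      moreover have "norm (y - \<xi>) ^ 2 * norm (of_real ((norm x)\<^sup>2) * f x) = norm (f x) * (norm (y - \<xi>) * norm x)\<^sup>2"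
        unfolding norm_mult norm_of_real by (simp add: power_mult_distrib)
      ultimately show "norm (f x * cis (y \<bullet> x) - f x * cis (\<xi> \<bullet> x) - (\<i> * of_real ((y - \<xi>) \<bullet> x) * f x) * cis (\<xi> \<bullet> x))
        \<le> norm (y - \<xi>) ^ 2 * norm (of_real ((norm x)\<^sup>2) * f x)"
        by (simp only: norm_mult)
    qed
    also have "\<dots> = norm (y - \<xi>) ^ 2 * C" by (simp add: C_def)
    finally show "norm (cis_transform f y - cis_transform f \<xi> - ?D (y - \<xi>)) / norm (y - \<xi>) \<le> C * norm (y - \<xi>)"
      using \<open>y \<noteq> \<xi>\<close> by (simp add: field_simps power2_eq_square)
  next
    show "((\<lambda>y. C * norm (y - \<xi>)) \<longlongrightarrow> 0) (at \<xi>)"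
      by (auto intro!: tendsto_eq_intros)
  qed
qed

lemma pderiv_cis_transform:
  "test_function f \<Longrightarrow> pderiv_at j (cis_transform f) = cis_transform (\<lambda>x. \<i> * of_real (x $ j) * f x)"
  by (rule ext)
    (simp add: pderiv_at_eq[OF cis_transform_has_derivative] cis_transform_def inner_axis' )

lemma test_function_mult_coord: "test_function f \<Longrightarrow> test_function (\<lambda>x. c * of_real (x $ j) * f x)"
  by (rule test_function_mult) auto

lemma smooth_cis_transform: "test_function f \<Longrightarrow> smooth (cis_transform f)"
proof (rule smoothI[where C = "cis_transform ` Collect test_function"])
  fix g :: "real^'a \<Rightarrow> complex" assume "g \<in> cis_transform ` Collect test_function"
  then show "g differentiable_on UNIV"
    using cis_transform_has_derivative by (fastforce simp: differentiable_on_def intro: differentiableI)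
next
  fix g :: "real^'a \<Rightarrow> complex" and i assume "g \<in> cis_transform ` Collect test_function"
  then show "pderiv_at i g \<in> cis_transform ` Collect test_function"
    by (auto simp: pderiv_cis_transform intro!: imageI test_function_mult_coord)
qed simp

lemma difference_quotient_tendsto:
  fixes f :: "'a::real_normed_vector \<Rightarrow> 'b::real_normed_vector"
  assumes "(f has_derivative D) (at x)" "norm v = 1"
  shows "(\<lambda>n. real (Suc n) *\<^sub>R (f (x + (1 / real (Suc n)) *\<^sub>R v) - f x)) \<longlonglongrightarrow> D v"
proof -
  interpret bounded_linear D using assms(1) by (rule has_derivative_bounded_linear)
  let ?h = "\<lambda>n. (1 / real (Suc n)) *\<^sub>R v"
  have "?h \<longlonglongrightarrow> 0 *\<^sub>R v" by (intro tendsto_intros LIMSEQ_Suc[OF lim_1_over_n])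
  then have "filterlim ?h (at 0) sequentially" using assms(2) by (auto simp: filterlim_at)
  moreover have "(\<lambda>h. norm (f (x + h) - f x - D h) / norm h) \<midarrow>0\<rightarrow> 0"
    using assms(1) by (simp add: has_derivative_at)
  ultimately have "(\<lambda>n. norm (f (x + ?h n) - f x - D (?h n)) / norm (?h n)) \<longlonglongrightarrow> 0"
    by (rule filterlim_compose[rotated])
  moreover have "norm (f (x + ?h n) - f x - D (?h n)) / norm (?h n) =
      norm (real (Suc n) *\<^sub>R (f (x + ?h n) - f x) - D v)" for n
  proof -
    have "real (Suc n) *\<^sub>R (f (x + ?h n) - f x) - D v = real (Suc n) *\<^sub>R (f (x + ?h n) - f x - D (?h n))"
      by (simp add: scaleR scaleR_diff_right del: of_nat_Suc)
    then have "norm (real (Suc n) *\<^sub>R (f (x + ?h n) - f x) - D v) =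
        real (Suc n) * norm (f (x + ?h n) - f x - D (?h n))"
      by (simp only: norm_scaleR abs_of_nat)
    then show ?thesis using assms(2) by (simp add: del: of_nat_Suc)
  qed
  ultimately have "(\<lambda>n. norm (real (Suc n) *\<^sub>R (f (x + ?h n) - f x) - D v)) \<longlonglongrightarrow> 0" by simp
  then show ?thesis by (simp add: tendsto_norm_zero_iff LIM_zero_iff)
qed

lemma test_function_bounded:
  assumes "test_function f"
  obtains M where "M > 0" "\<And>x. norm (f x) \<le> M"
proof -
  obtain r where r: "r > 0" "\<And>x. norm x \<ge> r \<Longrightarrow> f x = 0"
    using test_function_support[OF assms] by metis
  have "bounded (f ` cball 0 r)"
    using assms by (intro compact_imp_bounded compact_continuous_image smooth_continuous_on test_function_smooth) auto
  then obtain M where M: "M > 0" "\<And>x. x \<in> cball 0 r \<Longrightarrow> norm (f x) \<le> M" by (auto simp: bounded_pos)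
  have "norm (f x) \<le> M" for x
    using M r(2)[of x] by (cases "norm x \<le> r") auto
  with M(1) that show ?thesis by blast
qed

text \<open>Integration by parts through difference quotients: a translation of \<open>f\<close>
  multiplies the transform by a character, so the quotients of \<open>f\<close> become quotients of
  the character. Dominated convergence handles the limit on the other side.\<close>

lemma cis_transform_pderiv:
  fixes f :: "real^'n \<Rightarrow> complex"
  assumes f: "test_function f"
  shows "cis_transform (pderiv_at j f) \<xi> = - \<i> * of_real (\<xi> $ j) * cis_transform f \<xi>"
proof -
  let ?e = "axis j 1 :: real^'n"
  let ?q = "\<lambda>n x. real (Suc n) *\<^sub>R (f (x + (1 / real (Suc n)) *\<^sub>R ?e) - f x)"
  obtain r where r: "r > 0" "\<And>x. norm x \<ge> r \<Longrightarrow> f x = 0"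
    using test_function_support[OF f] by metis
  obtain M where M: "M > 0" "\<And>x. norm (pderiv_at j f x) \<le> M"
    using test_function_bounded[OF test_function_pderiv[OF f]] by metis
  have der: "(f has_derivative frechet_derivative f (at x)) (at x)" for x
    using f by (simp add: smooth_differentiable test_function_smooth flip: frechet_derivative_works)
  have qb: "norm (?q n x) \<le> M" for n x
  proof -
    let ?t = "1 / real (Suc n)"
    have "norm (f (x + ?t *\<^sub>R ?e) - f (x + 0 *\<^sub>R ?e)) \<le> M * norm (?t - 0)"
    proof (rule differentiable_bound[where S = UNIV and f = "\<lambda>t. f (x + t *\<^sub>R ?e)" and
          f' = "\<lambda>t h. h *\<^sub>R pderiv_at j f (x + t *\<^sub>R ?e)"])
      fix t :: real
      have "((\<lambda>t. x + t *\<^sub>R ?e) has_derivative (\<lambda>h. h *\<^sub>R ?e)) (at t)"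
        by (auto intro!: derivative_eq_intros)
      from diff_chain_at[OF this der]
      show "((\<lambda>t. f (x + t *\<^sub>R ?e)) has_derivative (\<lambda>h. h *\<^sub>R pderiv_at j f (x + t *\<^sub>R ?e))) (at t within UNIV)"
        by (simp add: o_def pderiv_at_def linear_scale[OF has_derivative_linear[OF der]])
      show "onorm (\<lambda>h::real. h *\<^sub>R pderiv_at j f (x + t *\<^sub>R ?e)) \<le> M"
      proof (rule onorm_le)
        fix h :: real
        have "\<bar>h\<bar> * norm (pderiv_at j f (x + t *\<^sub>R ?e)) \<le> \<bar>h\<bar> * M"
          using M by (intro mult_left_mono) auto
        then show "norm (h *\<^sub>R pderiv_at j f (x + t *\<^sub>R ?e)) \<le> M * norm h" by (simp add: mult.commute)
      qed
    qed auto
    then have "real (Suc n) * norm (f (x + ?t *\<^sub>R ?e) - f x) \<le> M" by (simp add: field_simps del: of_nat_Suc)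
    then show ?thesis by (simp only: norm_scaleR abs_of_nat)
  qed
  \<comment> \<open>The steps 1/(n+1) are at most 1, so all quotients vanish outside one common
    ball.\<close>
  have q0: "?q n x = 0" if "norm x \<ge> r + 1" for n x
  proof -
    have "norm ((1 / real (Suc n)) *\<^sub>R ?e) \<le> 1" by (simp add: divide_simps)
    then have "norm (x + (1 / real (Suc n)) *\<^sub>R ?e) \<ge> r"
      using that norm_diff_ineq[of x "(1 / real (Suc n)) *\<^sub>R ?e"] by linarith
    then show ?thesis using r that by simp
  qed
  have int: "integrable lborel (\<lambda>x. f (x + h))" for h
    by (intro integrable_test test_function_shift f)
  have "(\<lambda>n. LINT x|lborel. ?q n x * cis (\<xi> \<bullet> x)) \<longlonglongrightarrow> (LINT x|lborel. pderiv_at j f x * cis (\<xi> \<bullet> x))"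
  proof (rule integral_dominated_convergence[where w = "\<lambda>x. M * indicator (ball 0 (r + 1)) x"])
    show "integrable lborel (\<lambda>x::real^'n. M * indicator (ball 0 (r + 1)) x)"
      using emeasure_lborel_ball_finite[of "0::real^'n" "r + 1"] by (intro integrable_mult_right) simp
    show "AE x in lborel. (\<lambda>n. ?q n x * cis (\<xi> \<bullet> x)) \<longlonglongrightarrow> pderiv_at j f x * cis (\<xi> \<bullet> x)"
      unfolding pderiv_at_def by (intro AE_I2 tendsto_intros difference_quotient_tendsto[OF der]) simp
    show "AE x in lborel. norm (?q n x * cis (\<xi> \<bullet> x)) \<le> M * indicator (ball 0 (r + 1)) x" for n
      using qb[of n] q0[of _ n] by (intro AE_I2) (auto simp: norm_mult indicator_def not_less)
    show "(\<lambda>x. ?q n x * cis (\<xi> \<bullet> x)) \<in> borel_measurable lborel" for n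
      using borel_measurable_integrable[OF int[of 0]] borel_measurable_integrable[OF int[of "(1 / real (Suc n)) *\<^sub>R ?e"]]
      by (intro borel_measurable_times borel_measurable_scaleR borel_measurable_diff) auto
    show "(\<lambda>x. pderiv_at j f x * cis (\<xi> \<bullet> x)) \<in> borel_measurable lborel"
      using borel_measurable_integrable[OF integrable_test[OF test_function_pderiv[OF f]]] by auto
  qed
  moreover have "(LINT x|lborel. ?q n x * cis (\<xi> \<bullet> x)) =
      real (Suc n) *\<^sub>R (cis (- (\<xi> \<bullet> (0 + (1 / real (Suc n)) *\<^sub>R ?e))) - cis (- (\<xi> \<bullet> 0))) * cis_transform f \<xi>" for n
  proof -
    have "(LINT x|lborel. ?q n x * cis (\<xi> \<bullet> x)) = (LINT x|lborel. real (Suc n) *\<^sub>R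
       (f (x + (1 / real (Suc n)) *\<^sub>R ?e) * cis (\<xi> \<bullet> x) - f (x + 0) * cis (\<xi> \<bullet> x)))"
      by (simp only: mult_scaleR_left left_diff_distrib add_0_right)
    also have "\<dots> = real (Suc n) *\<^sub>R
       ((LINT x|lborel. f (x + (1 / real (Suc n)) *\<^sub>R ?e) * cis (\<xi> \<bullet> x)) - (LINT x|lborel. f (x + 0) * cis (\<xi> \<bullet> x)))"
      by (simp only: integral_scaleR_right Bochner_Integration.integral_diff[OF integrable_mult_cis(1)[OF int] integrable_mult_cis(1)[OF int]])
    finally have "(LINT x|lborel. ?q n x * cis (\<xi> \<bullet> x)) = real (Suc n) *\<^sub>R
       (cis_transform (\<lambda>x. f (x + (1 / real (Suc n)) *\<^sub>R ?e)) \<xi> - cis_transform f \<xi>)"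
      by (simp add: cis_transform_def)
    then show ?thesis
      by (simp add: cis_transform_shift left_diff_distrib del: of_nat_Suc)
  qed
  moreover have "(\<lambda>n. real (Suc n) *\<^sub>R (cis (- (\<xi> \<bullet> (0 + (1 / real (Suc n)) *\<^sub>R ?e))) - cis (- (\<xi> \<bullet> 0))) * cis_transform f \<xi>)
     \<longlonglongrightarrow> (- \<i> * of_real (\<xi> \<bullet> ?e)) * cis_transform f \<xi>"
  proof (intro tendsto_intros difference_quotient_tendsto)
    show "((\<lambda>x. cis (- (\<xi> \<bullet> x))) has_derivative (\<lambda>h. - \<i> * of_real (\<xi> \<bullet> h))) (at 0)"
      by (auto intro!: derivative_eq_intros simp: scaleR_conv_of_real mult_ac)
  qed simp
  ultimately have "(LINT x|lborel. pderiv_at j f x * cis (\<xi> \<bullet> x)) = (- \<i> * of_real (\<xi> \<bullet> ?e)) * cis_transform f \<xi>"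
    by (simp only: LIMSEQ_unique)
  then show ?thesis by (simp add: cis_transform_def inner_axis)
qed

text \<open>Each further factor 1 + |\<xi>| is at most 1 plus the sum of the |\<xi>_j|, and
  multiplication by \<xi>_j amounts to a partial derivative of the test function. Hence the
  induction generalises over \<open>f\<close>.\<close>

lemma cis_transform_decay:
  fixes f :: "real^'n \<Rightarrow> complex"
  assumes "test_function f"
  shows "\<exists>C. \<forall>\<xi>. (1 + norm \<xi>) ^ N * norm (cis_transform f \<xi>) \<le> C"
  using assms
proof (induction N arbitrary: f)
  case 0
  then show ?case using norm_cis_transform_le[of f] by auto
next
  case (Suc N)
  obtain C where C: "\<And>\<xi>. (1 + norm \<xi>) ^ N * norm (cis_transform f \<xi>) \<le> C" using Suc by blast
  have "\<exists>C. \<forall>\<xi>. (1 + norm \<xi>) ^ N * norm (cis_transform (pderiv_at j f) \<xi>) \<le> C" for j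
    using Suc by (simp add: test_function_pderiv)
  then obtain D where D: "\<And>j \<xi>. (1 + norm \<xi>) ^ N * norm (cis_transform (pderiv_at j f) \<xi>) \<le> D j" by metis
  have "(1 + norm \<xi>) ^ Suc N * norm (cis_transform f \<xi>) \<le> C + (\<Sum>j\<in>UNIV. D j)" for \<xi> :: "real^'n"
  proof -
    have "(1 + norm \<xi>) ^ Suc N * norm (cis_transform f \<xi>)
      \<le> (1 + norm \<xi>) ^ N * norm (cis_transform f \<xi>) * (1 + (\<Sum>j\<in>UNIV. \<bar>\<xi> $ j\<bar>))"
    proof -
      have "(1 + norm \<xi>) ^ N * norm (cis_transform f \<xi>) * (1 + norm \<xi>)
        \<le> (1 + norm \<xi>) ^ N * norm (cis_transform f \<xi>) * (1 + (\<Sum>j\<in>UNIV. \<bar>\<xi> $ j\<bar>))"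
        using norm_le_l1_cart[of \<xi>] by (intro mult_left_mono) auto
      then show ?thesis by (simp add: mult_ac)
    qed
    also have "\<dots> = (1 + norm \<xi>) ^ N * norm (cis_transform f \<xi>)
      + (\<Sum>j\<in>UNIV. (1 + norm \<xi>) ^ N * norm (cis_transform (pderiv_at j f) \<xi>))"
      using Suc by (simp add: cis_transform_pderiv norm_mult distrib_left sum_distrib_left mult_ac)
    also have "\<dots> \<le> C + (\<Sum>j\<in>UNIV. D j)" by (intro add_mono C sum_mono D)
    finally show ?thesis .
  qed
  then show ?case by blast
qed

lemma schwartz_cis_transform:
  assumes "test_function f"
  shows "schwartz (cis_transform f)"
  unfolding schwartz_def
proof (intro conjI allI smooth_cis_transform assms)
  fix N :: nat and "is" :: "'a list"
  have "iter_pderiv is (cis_transform f) \<in> cis_transform ` Collect test_function"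
    by (rule iter_pderiv_closed)
      (use assms in \<open>auto simp: pderiv_cis_transform intro!: imageI test_function_mult_coord\<close>)
  then obtain g where g: "test_function g" "iter_pderiv is (cis_transform f) = cis_transform g" by auto
  obtain C where "\<And>\<xi>. (1 + norm \<xi>) ^ N * norm (cis_transform g \<xi>) \<le> C" using cis_transform_decay[OF g(1)] by blast
  then show "bounded (range (\<lambda>x. (1 + norm x) ^ N *\<^sub>R iter_pderiv is (cis_transform f) x))"
    by (auto simp: bounded_iff g(2))
qed

subsection \<open>Fourier inversion\<close>

lemma product_lborel:
  fixes f :: "'a::euclidean_space \<Rightarrow> real \<Rightarrow> complex"
  assumes "\<And>b. b \<in> Basis \<Longrightarrow> integrable lborel (f b)"
  shows "integrable lborel (\<lambda>x::'a. \<Prod>b\<in>Basis. f b (x \<bullet> b))"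
    and "(LINT x|lborel. (\<Prod>b\<in>Basis. f b ((x::'a) \<bullet> b))) = (\<Prod>b\<in>Basis. (LINT t|lborel. f b t))"
proof -
  interpret P: product_sigma_finite "\<lambda>_::'a. lborel :: real measure" ..
  let ?T = "\<lambda>f. \<Sum>b\<in>Basis. f b *\<^sub>R b :: 'a"
  have [measurable]: "f b \<in> borel_measurable borel" if "b \<in> Basis" for b
    using borel_measurable_integrable[OF assms[OF that]] by simp
  have eq: "(\<Prod>b\<in>Basis. f b (?T g \<bullet> b)) = (\<Prod>b\<in>Basis. f b (g b))" for g
    by (rule prod.cong) (simp_all add: inner_sum_left inner_Basis if_distrib sum.delta cong: if_cong)
  have "integrable (\<Pi>\<^sub>M b\<in>Basis. lborel) (\<lambda>g. \<Prod>b\<in>Basis. f b (?T g \<bullet> b))"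
    unfolding eq by (rule P.product_integrable_prod) (simp_all add: assms)
  then show "integrable lborel (\<lambda>x::'a. \<Prod>b\<in>Basis. f b (x \<bullet> b))"
    by (subst lborel_eq, subst integrable_distr_eq) simp_all
  have "(LINT g|(\<Pi>\<^sub>M b\<in>Basis. lborel). (\<Prod>b\<in>Basis. f b (?T g \<bullet> b))) = (\<Prod>b\<in>Basis. (LINT t|lborel. f b t))"
    unfolding eq by (rule P.product_integral_prod) (simp_all add: assms)
  then show "(LINT x|lborel. (\<Prod>b\<in>Basis. f b ((x::'a) \<bullet> b))) = (\<Prod>b\<in>Basis. (LINT t|lborel. f b t))"
    by (subst lborel_eq, subst integral_distr) simp_all
qed

definition gauss :: "'a::euclidean_space \<Rightarrow> complex" where
  "gauss x = of_real (exp (- (norm x)\<^sup>2 / 2))"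

lemma continuous_on_gauss [continuous_intros]: "continuous_on S gauss"
  unfolding gauss_def by (intro continuous_intros) simp

text \<open>The characteristic function of the standard normal distribution, up to
  normalisation.\<close>

lemma gauss_1d:
  "integrable lborel (\<lambda>t. gauss t * cis (s * t))"
  "(LINT t|lborel. gauss t * cis (s * t)) = of_real (sqrt (2 * pi)) * gauss s"
proof -
  have dens: "gauss t = of_real (sqrt (2 * pi) * std_normal_density t)" for t :: real
    by (simp add: gauss_def std_normal_density_def)
  have "integrable lborel (gauss :: real \<Rightarrow> complex)"
    unfolding dens by (intro integrable_of_real integrable_mult_right) simp
  from integrable_mult_cis(1)[OF this, of s]
  show "integrable lborel (\<lambda>t. gauss t * cis (s * t))" by simp
  have "(LINT t|lborel. gauss t * cis (s * t))
      = of_real (sqrt (2 * pi)) * (LINT t|lborel. std_normal_density t *\<^sub>R iexp (s * t))"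
    unfolding dens integral_mult_right_zero[symmetric] scaleR_conv_of_real
    by (intro Bochner_Integration.integral_cong refl) (simp add: cis_conv_exp mult.assoc)
  also have "(LINT t|lborel. std_normal_density t *\<^sub>R iexp (s * t)) = char std_normal_distribution s"
    unfolding char_def by (subst integral_density) simp_all
  also have "\<dots> = gauss s" by (simp add: char_std_normal_distribution gauss_def)
  finally show "(LINT t|lborel. gauss t * cis (s * t)) = of_real (sqrt (2 * pi)) * gauss s" .
qed

lemma norm_power2_Basis: "(norm x)\<^sup>2 = (\<Sum>b\<in>Basis. (x \<bullet> b)\<^sup>2)" for x :: "'a::euclidean_space"
  unfolding power2_norm_eq_inner by (subst euclidean_inner) (simp add: power2_eq_square)

lemma prod_cis: "(\<Prod>b\<in>B. cis (f b)) = cis (\<Sum>b\<in>B. f b)"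
  by (induction B rule: infinite_finite_induct) (simp_all add: cis_mult)

lemma gauss_prod: "gauss x = (\<Prod>b\<in>Basis. gauss (x \<bullet> b))" for x :: "'a::euclidean_space"
  by (simp add: gauss_def norm_power2_Basis exp_sum sum_negf sum_divide_distrib[symmetric] flip: of_real_prod exp_sum)

lemma gauss_cis_prod: "gauss x * cis (v \<bullet> x) = (\<Prod>b\<in>Basis. gauss (x \<bullet> b) * cis ((v \<bullet> b) * (x \<bullet> b)))"
  for x :: "'a::euclidean_space"
  by (simp add: prod.distrib prod_cis gauss_prod[of x] euclidean_inner[of v x])

lemma gauss_transform:
  fixes v :: "'a::euclidean_space"
  shows "integrable lborel (\<lambda>x::'a. gauss x * cis (v \<bullet> x))"
    and "(LINT x|lborel. gauss x * cis (v \<bullet> x)) = of_real (sqrt (2 * pi) ^ DIM('a)) * gauss v"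
  unfolding gauss_cis_prod
  using product_lborel[of "\<lambda>b t. gauss t * cis ((v \<bullet> b) * t)"] gauss_1d gauss_prod[of v]
  by (simp_all add: prod.distrib)

lemma integrable_gauss: "integrable lborel (gauss :: 'a::euclidean_space \<Rightarrow> complex)"
  using gauss_transform(1)[of 0] by simp

lemma scale_substitution:
  fixes f :: "'a::euclidean_space \<Rightarrow> complex"
  assumes [measurable]: "f \<in> borel_measurable borel" and "c > 0"
  shows "integrable lborel (\<lambda>x. f (c *\<^sub>R x)) \<longleftrightarrow> integrable lborel f"
    and "(LINT x|lborel. f x) = of_real (c ^ DIM('a)) * (LINT x|lborel. f (c *\<^sub>R x))"
proof -
  have L: "lborel = density (distr lborel borel (\<lambda>x::'a. c *\<^sub>R x)) (\<lambda>_. c ^ DIM('a))"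
    using lborel_affine[of c "0::'a"] assms by simp
  have int: "integrable lborel f \<longleftrightarrow> integrable lborel (\<lambda>x. (c ^ DIM('a)) *\<^sub>R f (c *\<^sub>R x))"
    using assms(2) by (subst L, subst integrable_density) (simp_all add: integrable_distr_eq)
  then show "integrable lborel (\<lambda>x. f (c *\<^sub>R x)) \<longleftrightarrow> integrable lborel f"
    using assms(2) integrable_scaleR_right[of "inverse (c ^ DIM('a))" lborel "\<lambda>x. (c ^ DIM('a)) *\<^sub>R f (c *\<^sub>R x)"]
    by auto
  have "(LINT x|lborel. f x) = (LINT x|lborel. (c ^ DIM('a)) *\<^sub>R f (c *\<^sub>R x))"
    using assms(2) by (subst L, subst integral_density) (simp_all add: integral_distr)
  then show "(LINT x|lborel. f x) = of_real (c ^ DIM('a)) * (LINT x|lborel. f (c *\<^sub>R x))"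
    by (simp add: scaleR_conv_of_real)
qed

text \<open>Fubini moves the transform from one factor to the other. In the inversion theorem
  \<open>g\<close> is a Gaussian times a character, whose transform is an approximate
  identity.\<close>

lemma cis_transform_mult_formula:
  fixes H g :: "real^'n \<Rightarrow> complex"
  assumes "integrable lborel H" "integrable lborel g"
  shows "(LINT \<xi>|lborel. cis_transform H \<xi> * g \<xi>) = (LINT y|lborel. H y * cis_transform g y)"
proof -
  have [measurable]: "H \<in> borel_measurable borel" "g \<in> borel_measurable borel"
    using assms[THEN borel_measurable_integrable] by simp_all
  have [measurable]: "(\<lambda>p::(real^'n) \<times> (real^'n). cis (fst p \<bullet> snd p)) \<in> borel_measurable (borel \<Otimes>\<^sub>M borel)"
    unfolding borel_prod cis_conv_exp by (intro borel_measurable_continuous_onI continuous_intros)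
  have *: "integrable (lborel \<Otimes>\<^sub>M lborel) (\<lambda>(\<xi>, y). H y * cis (\<xi> \<bullet> y) * g \<xi>)"
  proof (rule lborel_pair.Fubini_integrable)
    show "(\<lambda>(\<xi>, y). H y * cis (\<xi> \<bullet> y) * g \<xi>) \<in> borel_measurable (lborel \<Otimes>\<^sub>M lborel)"
      unfolding split_beta' by measurable
    show "integrable lborel (\<lambda>\<xi>. (LINT y|lborel. norm (case (\<xi>, y) of (\<xi>, y) \<Rightarrow> H y * cis (\<xi> \<bullet> y) * g \<xi>)))"
      using assms by (simp add: norm_mult)
    show "AE \<xi> in lborel. integrable lborel (\<lambda>y. case (\<xi>, y) of (\<xi>, y) \<Rightarrow> H y * cis (\<xi> \<bullet> y) * g \<xi>)"
      using assms by (simp add: integrable_mult_cis)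
  qed
  have "(LINT \<xi>|lborel. cis_transform H \<xi> * g \<xi>) = (LINT \<xi>|lborel. (LINT y|lborel. H y * cis (\<xi> \<bullet> y) * g \<xi>))"
    by (simp add: cis_transform_def)
  also have "\<dots> = (LINT y|lborel. (LINT \<xi>|lborel. H y * cis (\<xi> \<bullet> y) * g \<xi>))"
    by (rule lborel_pair.Fubini_integral[OF *, symmetric])
  also have "\<dots> = (LINT y|lborel. H y * cis_transform g y)"
    unfolding cis_transform_def integral_mult_right_zero[symmetric]
    by (simp add: inner_commute mult_ac)
  finally show ?thesis .
qed

lemma power_mult_exp_tendsto_0:
  assumes "c > 0"
  shows "(\<lambda>k. real (Suc k) ^ N * exp (- (c * (real (Suc k))\<^sup>2))) \<longlonglongrightarrow> 0"
proof -
  have "filterlim (\<lambda>k. c * real (Suc k)) at_top sequentially"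
    using assms by (intro filterlim_tendsto_pos_mult_at_top[OF tendsto_const] filterlim_compose[OF filterlim_real_sequentially filterlim_Suc])
  from filterlim_compose[OF tendsto_power_div_exp_0 this, of N]
  have "(\<lambda>k. inverse (c ^ N) * ((c * real (Suc k)) ^ N / exp (c * real (Suc k)))) \<longlonglongrightarrow> inverse (c ^ N) * 0"
    by (intro tendsto_intros)
  then have "(\<lambda>k. real (Suc k) ^ N * exp (- (c * real (Suc k)))) \<longlonglongrightarrow> 0"
    using assms by (simp add: power_mult_distrib exp_minus field_simps del: of_nat_Suc)
  then show ?thesis
  proof (rule tendsto_sandwich[OF _ _ tendsto_const, rotated 2], goal_cases)
    case 1
    show ?case by (intro always_eventually) simp
  next
    case 2
    have "c * real (Suc k) \<le> c * (real (Suc k))\<^sup>2" for k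
      using assms by (intro mult_left_mono) (auto simp: power2_eq_square)
    then show ?case by (intro always_eventually allI mult_left_mono) auto
  qed
qed

text \<open>Gaussian summation: a wide Gaussian is inserted under the integral, and the
  multiplication formula turns it into a kernel concentrated at \<open>x\<close>. Continuity is
  asked at the single point \<open>x\<close> because the theorem is also applied to the transform of
  \<open>\<phi>\<close> times a Schwartz function, of which continuity is what has been
  established.\<close>

theorem fourier_inversion:
  fixes H :: "real^'n \<Rightarrow> complex"
  assumes H: "integrable lborel H" and cont: "isCont H x" and JH: "integrable lborel (cis_transform H)"
  shows "(LINT \<xi>|lborel. cis_transform H \<xi> * cis (- (\<xi> \<bullet> x))) = of_real ((2 * pi) ^ CARD('n)) * H x"
proof -
  let ?N = "CARD('n)"
  let ?k = "\<lambda>n. real (Suc n)"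
  let ?L = "\<lambda>n. LINT \<xi>|lborel. cis_transform H \<xi> * (gauss ((1 / ?k n) *\<^sub>R \<xi>) * cis (- (\<xi> \<bullet> x)))"
  have [measurable]: "H \<in> borel_measurable borel" using borel_measurable_integrable[OF H] by simp
  have [measurable]: "gauss \<in> borel_measurable (borel :: (real^'n) measure)"
    using borel_measurable_integrable[OF integrable_gauss] by simp
  have gauss_le: "norm (gauss y) \<le> 1" for y :: "real^'n" by (simp add: gauss_def)
  have k0: "(\<lambda>n. 1 / ?k n) \<longlonglongrightarrow> 0" by (rule LIMSEQ_Suc[OF lim_1_over_n])
  have int_k: "integrable lborel (\<lambda>\<xi>::real^'n. gauss ((1 / ?k n) *\<^sub>R \<xi>))" for n
    by (subst scale_substitution) (auto simp: integrable_gauss)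
  have lim1: "?L \<longlonglongrightarrow> (LINT \<xi>|lborel. cis_transform H \<xi> * cis (- (\<xi> \<bullet> x)))"
  proof (rule integral_dominated_convergence[where w = "\<lambda>\<xi>. norm (cis_transform H \<xi>)"])
    show "(\<lambda>\<xi>. cis_transform H \<xi> * cis (- (\<xi> \<bullet> x))) \<in> borel_measurable lborel"
      by (rule borel_measurable_integrable) (rule integrable_mult_cis(3)[OF JH])
    show "(\<lambda>\<xi>. cis_transform H \<xi> * (gauss ((1 / ?k n) *\<^sub>R \<xi>) * cis (- (\<xi> \<bullet> x)))) \<in> borel_measurable lborel" for n
      using borel_measurable_integrable[OF JH] borel_measurable_integrable[OF integrable_mult_cis(3)[OF int_k, of n x]]
      by (rule borel_measurable_times)
    show "integrable lborel (\<lambda>\<xi>. norm (cis_transform H \<xi>))" using JH by simp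
    show "AE \<xi> in lborel. norm (cis_transform H \<xi> * (gauss ((1 / ?k n) *\<^sub>R \<xi>) * cis (- (\<xi> \<bullet> x)))) \<le> norm (cis_transform H \<xi>)" for n
      using gauss_le by (intro AE_I2) (auto simp: norm_mult intro!: mult_left_le)
    show "AE \<xi> in lborel. (\<lambda>n. cis_transform H \<xi> * (gauss ((1 / ?k n) *\<^sub>R \<xi>) * cis (- (\<xi> \<bullet> x))))
        \<longlonglongrightarrow> cis_transform H \<xi> * cis (- (\<xi> \<bullet> x))"
    proof (rule AE_I2)
      fix \<xi> :: "real^'n"
      have "(\<lambda>n. gauss ((1 / ?k n) *\<^sub>R \<xi>)) \<longlonglongrightarrow> gauss (0 *\<^sub>R \<xi>)"
        by (rule continuous_on_tendsto_compose[OF continuous_on_gauss[of UNIV] tendsto_scaleR[OF k0 tendsto_const]]) auto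
      moreover have "gauss (0 *\<^sub>R \<xi>) = 1" by (simp add: gauss_def)
      ultimately have "(\<lambda>n. gauss ((1 / ?k n) *\<^sub>R \<xi>)) \<longlonglongrightarrow> 1" by simp
      from tendsto_mult[OF tendsto_const[of "cis_transform H \<xi>"] tendsto_mult[OF this tendsto_const[of "cis (- (\<xi> \<bullet> x))"]]]
      show "(\<lambda>n. cis_transform H \<xi> * (gauss ((1 / ?k n) *\<^sub>R \<xi>) * cis (- (\<xi> \<bullet> x))))
        \<longlonglongrightarrow> cis_transform H \<xi> * cis (- (\<xi> \<bullet> x))"
        by (simp only: mult_1_left)
    qed
  qed
  have Jg: "cis_transform (\<lambda>\<xi>. gauss ((1 / ?k n) *\<^sub>R \<xi>) * cis (- (\<xi> \<bullet> x))) y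
     = of_real (?k n ^ ?N) * (of_real (sqrt (2 * pi) ^ ?N) * gauss (?k n *\<^sub>R (y - x)))" for n y
  proof -
    have "cis_transform (\<lambda>\<xi>. gauss ((1 / ?k n) *\<^sub>R \<xi>) * cis (- (\<xi> \<bullet> x))) y
       = (LINT \<xi>|lborel. gauss ((1 / ?k n) *\<^sub>R \<xi>) * cis ((y - x) \<bullet> \<xi>))"
      unfolding cis_transform_def
      by (intro Bochner_Integration.integral_cong refl) (simp add: mult.assoc cis_mult inner_diff_left inner_diff_right inner_commute)
    also have "\<dots> = of_real (?k n ^ ?N) * (LINT \<xi>|lborel. gauss \<xi> * cis ((?k n *\<^sub>R (y - x)) \<bullet> \<xi>))"
      by (subst scale_substitution(2)[where c = "?k n"]) (simp_all del: of_nat_Suc)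
    finally show ?thesis by (simp only: gauss_transform DIM_cart DIM_real mult_1_right)
  qed
  have L_eq: "?L n = of_real (sqrt (2 * pi) ^ ?N) * (LINT y|lborel. H (y + x) * (of_real (?k n ^ ?N) * gauss (?k n *\<^sub>R y)))" for n
  proof -
    have "?L n = (LINT y|lborel. H y * cis_transform (\<lambda>\<xi>. gauss ((1 / ?k n) *\<^sub>R \<xi>) * cis (- (\<xi> \<bullet> x))) y)"
      by (rule cis_transform_mult_formula[OF H integrable_mult_cis(3)[OF int_k]])
    also have "\<dots> = (LINT y|lborel. H (y + x) * cis_transform (\<lambda>\<xi>. gauss ((1 / ?k n) *\<^sub>R \<xi>) * cis (- (\<xi> \<bullet> x))) (y + x))"
      by (rule lborel_integral_shift[symmetric])
    also have "\<dots> = (LINT y|lborel. of_real (sqrt (2 * pi) ^ ?N) * (H (y + x) * (of_real (?k n ^ ?N) * gauss (?k n *\<^sub>R y))))"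
      by (simp only: Jg) (simp add: mult_ac del: of_nat_Suc)
    finally show ?thesis by (simp only: integral_mult_right_zero)
  qed
  obtain r where r: "r > 0" "\<And>y. norm y < r \<Longrightarrow> norm (H (y + x) - H x) < 1"
    using cont[unfolded continuous_at_eps_delta, rule_format, of 1] by (auto simp: dist_norm)
  \<comment> \<open>Near \<open>x\<close> the function is bounded, so rescaling leads to dominated
    convergence against a fixed Gaussian. Farther away it is merely integrable, but there the kernel
    tends to 0 uniformly.\<close>
  define H1 where "H1 = (\<lambda>y. H (y + x) * indicator (ball 0 r) y)"
  define H2 where "H2 = (\<lambda>y. H (y + x) * indicator (- ball 0 r) y)"
  have Hx: "integrable lborel (\<lambda>y. H (y + x))" by (rule lborel_integrable_shiftI[OF H])
  have [measurable]: "indicator (ball 0 r) \<in> borel_measurable (borel :: (real^'n) measure)"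
    "indicator (- ball 0 r) \<in> borel_measurable (borel :: (real^'n) measure)"
    by (auto intro!: borel_measurable_indicator)
  have H12: "integrable lborel H1" "integrable lborel H2"
    unfolding H1_def H2_def
    by (rule Bochner_Integration.integrable_bound[OF Hx]; measurable; auto simp: norm_mult indicator_def)+
  have H1b: "norm (H1 y) \<le> norm (H x) + 1" for y
    using r(2)[of y] norm_triangle_ineq2[of "H (y + x)" "H x"] by (auto simp: H1_def indicator_def)
  have lim_near: "(\<lambda>n. LINT y|lborel. H1 y * (of_real (?k n ^ ?N) * gauss (?k n *\<^sub>R y))) \<longlonglongrightarrow> H x * of_real (sqrt (2 * pi) ^ ?N)"
  proof -
    have [measurable]: "H1 \<in> borel_measurable borel" using borel_measurable_integrable[OF H12(1)] by simp
    have "(LINT y|lborel. H1 y * (of_real (?k n ^ ?N) * gauss (?k n *\<^sub>R y)))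
       = (LINT y|lborel. H1 ((1 / ?k n) *\<^sub>R y) * gauss y)" for n
    proof -
      have "(LINT y|lborel. H1 y * (of_real (?k n ^ ?N) * gauss (?k n *\<^sub>R y)))
        = (LINT y|lborel. of_real (?k n ^ ?N) * (H1 ((1 / ?k n) *\<^sub>R (?k n *\<^sub>R y)) * gauss (?k n *\<^sub>R y)))"
        by (simp add: mult_ac del: of_nat_Suc)
      also have "\<dots> = of_real (?k n ^ ?N) * (LINT y|lborel. H1 ((1 / ?k n) *\<^sub>R (?k n *\<^sub>R y)) * gauss (?k n *\<^sub>R y))"
        by (rule integral_mult_right_zero)
      also have "\<dots> = (LINT y|lborel. H1 ((1 / ?k n) *\<^sub>R y) * gauss y)"
        by (subst (2) scale_substitution(2)[where c = "?k n"]) (simp_all del: of_nat_Suc)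
      finally show ?thesis .
    qed
    moreover have "(\<lambda>n. LINT y|lborel. H1 ((1 / ?k n) *\<^sub>R y) * gauss y) \<longlonglongrightarrow> (LINT y|lborel. H x * gauss (y :: real^'n))"
    proof (rule integral_dominated_convergence[where w = "\<lambda>y. (norm (H x) + 1) * norm (gauss y)"])
      show "integrable lborel (\<lambda>y::real^'n. (norm (H x) + 1) * norm (gauss y))"
        by (intro integrable_mult_right integrable_norm integrable_gauss)
      show "AE y in lborel. norm (H1 ((1 / ?k n) *\<^sub>R y) * gauss y) \<le> (norm (H x) + 1) * norm (gauss y)" for n
        using H1b by (auto simp: norm_mult intro!: mult_right_mono)
      show "AE y::real^'n in lborel. (\<lambda>n. H1 ((1 / ?k n) *\<^sub>R y) * gauss y) \<longlonglongrightarrow> H x * gauss y"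
      proof (intro AE_I2 tendsto_intros)
        fix y :: "real^'n"
        have t0: "(\<lambda>n. (1 / ?k n) *\<^sub>R y) \<longlonglongrightarrow> 0" using tendsto_scaleR[OF k0 tendsto_const[of y]] by simp
        then have "(\<lambda>n. (1 / ?k n) *\<^sub>R y + x) \<longlonglongrightarrow> x" using tendsto_add[OF t0 tendsto_const[of x]] by simp
        then have "(\<lambda>n. H ((1 / ?k n) *\<^sub>R y + x)) \<longlonglongrightarrow> H x"
          using cont by (rule isCont_tendsto_compose[rotated])
        moreover have "\<forall>\<^sub>F n in sequentially. H ((1 / ?k n) *\<^sub>R y + x) = H1 ((1 / ?k n) *\<^sub>R y)"
          using tendstoD[OF t0 r(1)] by eventually_elim (simp add: H1_def)
        ultimately show "(\<lambda>n. H1 ((1 / ?k n) *\<^sub>R y)) \<longlonglongrightarrow> H x" by (rule Lim_transform_eventually)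
      qed
    qed measurable
    ultimately show ?thesis using gauss_transform(2)[of "0::real^'n"] by (simp add: gauss_def)
  qed
  \<comment> \<open>A bound for the rescaled Gaussian kernel outside the ball of radius
    \<open>r\<close>.\<close>
  let ?c = "\<lambda>n. ?k n ^ ?N * exp (- (r\<^sup>2 / 2 * (?k n)\<^sup>2))"
  have c0: "?c \<longlonglongrightarrow> 0" using r by (intro power_mult_exp_tendsto_0) auto
  have "Bseq ?c" by (rule convergent_imp_Bseq[OF convergentI[OF c0]])
  then obtain C where C: "\<And>n. norm (?c n) \<le> C" by (rule BseqE) blast
  have far: "norm (H2 y * (of_real (?k n ^ ?N) * gauss (?k n *\<^sub>R y))) \<le> norm (H2 y) * ?c n" for n y
  proof (cases "norm y < r")
    case False
    then have "r\<^sup>2 * (?k n)\<^sup>2 \<le> (norm y)\<^sup>2 * (?k n)\<^sup>2" using r by (intro mult_right_mono power_mono) auto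
    then show ?thesis
      by (auto simp: norm_mult norm_power gauss_def power_mult_distrib mult_ac simp del: of_nat_Suc intro!: mult_left_mono)
  qed (simp add: H2_def)
  have lim_far: "(\<lambda>n. LINT y|lborel. H2 y * (of_real (?k n ^ ?N) * gauss (?k n *\<^sub>R y))) \<longlonglongrightarrow> (LINT y::real^'n|lborel. 0)"
  proof (rule integral_dominated_convergence[where w = "\<lambda>y. norm (H2 y) * C"])
    have [measurable]: "H2 \<in> borel_measurable borel" using borel_measurable_integrable[OF H12(2)] by simp
    show "(\<lambda>y. H2 y * (of_real (?k n ^ ?N) * gauss (?k n *\<^sub>R y))) \<in> borel_measurable lborel" for n by measurable
    show "integrable lborel (\<lambda>y. norm (H2 y) * C)" using H12 by simp
    show "AE y in lborel. norm (H2 y * (of_real (?k n ^ ?N) * gauss (?k n *\<^sub>R y))) \<le> norm (H2 y) * C" for n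
    proof (rule AE_I2)
      fix y
      have "norm (H2 y) * ?c n \<le> norm (H2 y) * C" using C[of n] by (intro mult_left_mono) auto
      then show "norm (H2 y * (of_real (?k n ^ ?N) * gauss (?k n *\<^sub>R y))) \<le> norm (H2 y) * C"
        using far[of y n] by linarith
    qed
    show "AE y in lborel. (\<lambda>n. H2 y * (of_real (?k n ^ ?N) * gauss (?k n *\<^sub>R y))) \<longlonglongrightarrow> 0"
      by (intro AE_I2 Lim_null_comparison[OF always_eventually[OF allI[OF far]]] tendsto_mult_right_zero c0)
  qed simp
  have int_g: "integrable lborel (\<lambda>y. h y * (of_real (?k n ^ ?N) * gauss (?k n *\<^sub>R y)))"
    if h: "integrable lborel h" for h :: "real^'n \<Rightarrow> complex" and n
  proof (rule Bochner_Integration.integrable_bound[where f = "\<lambda>y. of_real (?k n ^ ?N) * h y"])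
    show "(\<lambda>y. h y * (of_real (?k n ^ ?N) * gauss (?k n *\<^sub>R y))) \<in> borel_measurable lborel"
      using borel_measurable_integrable[OF h] by measurable
    show "AE y in lborel. norm (h y * (of_real (?k n ^ ?N) * gauss (?k n *\<^sub>R y))) \<le> norm (of_real (?k n ^ ?N) * h y)"
      using gauss_le by (auto simp: norm_mult mult_ac intro!: mult_left_mono mult_left_le)
  qed (use h in simp)
  have split: "(LINT y|lborel. H (y + x) * (of_real (?k n ^ ?N) * gauss (?k n *\<^sub>R y)))
     = (LINT y|lborel. H1 y * (of_real (?k n ^ ?N) * gauss (?k n *\<^sub>R y)))
     + (LINT y|lborel. H2 y * (of_real (?k n ^ ?N) * gauss (?k n *\<^sub>R y)))" for n
    unfolding Bochner_Integration.integral_add[OF int_g[OF H12(1)] int_g[OF H12(2)], symmetric]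
    by (intro Bochner_Integration.integral_cong refl) (auto simp: H1_def H2_def indicator_def)
  have "?L \<longlonglongrightarrow> of_real (sqrt (2 * pi) ^ ?N) * (H x * of_real (sqrt (2 * pi) ^ ?N) + (LINT y::real^'n|lborel. 0))"
    unfolding L_eq split by (intro tendsto_intros lim_near lim_far)
  moreover have "of_real (sqrt (2 * pi) ^ ?N) * (H x * of_real (sqrt (2 * pi) ^ ?N)) = of_real ((2 * pi) ^ ?N) * H x"
  proof -
    have "complex_of_real (sqrt (2 * pi) ^ ?N) * of_real (sqrt (2 * pi) ^ ?N) = of_real ((2 * pi) ^ ?N)"
      unfolding of_real_mult[symmetric] power_mult_distrib[symmetric] by simp
    then show ?thesis by (metis mult.assoc mult.commute)
  qed
  ultimately show ?thesis using lim1 LIMSEQ_unique by fastforce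
qed

text \<open>The majorant is a product of d one-dimensional functions 1/(1 + t^2). Each of the d
  denominators is at most (1 + |\<xi>|)^2, which explains the decay exponent 2d.\<close>

lemma integrable_cis_transform:
  fixes f :: "real^'n \<Rightarrow> complex"
  assumes f: "test_function f"
  shows "integrable lborel (cis_transform f)"
proof -
  let ?N = "CARD('n)"
  let ?g = "\<lambda>t. complex_of_real (inverse (1 + t\<^sup>2))"
  obtain C where C: "\<And>\<xi>. (1 + norm \<xi>) ^ (2 * ?N) * norm (cis_transform f \<xi>) \<le> C"
    using cis_transform_decay[OF f] by blast
  have "integrable lborel (\<lambda>t::real. inverse (1 + t\<^sup>2))"
    using integrable_inverse_1_plus_square by (simp add: set_integrable_def einterval_eq)
  then have g: "integrable lborel ?g" by (rule integrable_of_real)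
  have int: "integrable lborel (\<lambda>x::real^'n. of_real C * (\<Prod>b\<in>Basis. ?g (x \<bullet> b)))"
    by (intro integrable_mult_right product_lborel g)
  show ?thesis
  proof (rule Bochner_Integration.integrable_bound[OF int])
    show "cis_transform f \<in> borel_measurable lborel"
      using smooth_continuous_on[OF smooth_cis_transform[OF f]]
      by (auto intro: borel_measurable_continuous_onI)
    show "AE \<xi> in lborel. norm (cis_transform f \<xi>) \<le> norm (of_real C * (\<Prod>b\<in>Basis. ?g (\<xi> \<bullet> b)))"
    proof (rule AE_I2)
      fix \<xi> :: "real^'n"
      let ?p = "\<Prod>b\<in>(Basis :: (real^'n) set). 1 + (\<xi> \<bullet> b)\<^sup>2"
      have p: "?p > 0" by (intro prod_pos) (auto intro: add_pos_nonneg)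
      have "1 + (\<xi> \<bullet> b)\<^sup>2 \<le> (1 + norm \<xi>)\<^sup>2" if "b \<in> Basis" for b
      proof -
        have "(\<xi> \<bullet> b)\<^sup>2 \<le> (norm \<xi>)\<^sup>2"
          using Basis_le_norm[OF that, of \<xi>] abs_le_square_iff[of "\<xi> \<bullet> b" "norm \<xi>"] by simp
        then show ?thesis using norm_ge_zero[of \<xi>] by (simp add: power2_sum add_increasing2)
      qed
      then have "?p \<le> (\<Prod>b\<in>(Basis :: (real^'n) set). (1 + norm \<xi>)\<^sup>2)"
        by (intro prod_mono) auto
      also have "\<dots> = (1 + norm \<xi>) ^ (2 * ?N)" by (simp add: power_mult)
      finally have "?p * norm (cis_transform f \<xi>) \<le> (1 + norm \<xi>) ^ (2 * ?N) * norm (cis_transform f \<xi>)"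
        by (intro mult_right_mono) auto
      then have "?p * norm (cis_transform f \<xi>) \<le> C" using C[of \<xi>] by linarith
      then have "norm (cis_transform f \<xi>) \<le> C * inverse ?p"
        using p by (simp add: field_simps)
      also have "\<dots> \<le> \<bar>C\<bar> * inverse ?p" using p by (intro mult_right_mono) auto
      also have "\<dots> = norm (complex_of_real C * (\<Prod>b\<in>Basis. ?g (\<xi> \<bullet> b)))"
      proof -
        have "(\<Prod>b\<in>Basis. ?g (\<xi> \<bullet> b)) = complex_of_real (inverse ?p)"
          by (simp only: prod_inversef[symmetric] of_real_prod o_def)
        then show ?thesis using p by (simp only: norm_mult norm_of_real) simp
      qed
      finally show "norm (cis_transform f \<xi>) \<le> norm (of_real C * (\<Prod>b\<in>Basis. ?g (\<xi> \<bullet> b)))" .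
    qed
  qed
qed

definition inv_fourier :: "(real^'n \<Rightarrow> complex) \<Rightarrow> real^'n \<Rightarrow> complex" where
  "inv_fourier f \<xi> = of_real ((2 * pi) powr (- real CARD('n) / 2)) * cis_transform f \<xi>"

lemma schwartz_inv_fourier:
  assumes "test_function f" shows "schwartz (inv_fourier f)"
proof -
  let ?c = "(2 * pi) powr (- real CARD('a) / 2)"
  have "inv_fourier f = cis_transform (\<lambda>x. of_real ?c * f x)"
    by (rule ext) (simp add: inv_fourier_def cis_transform_cmult)
  then show ?thesis
    using schwartz_cis_transform[OF test_function_mult[OF smooth_const assms]] by simp
qed

lemma fourier_inv_fourier:
  fixes f :: "real^'n \<Rightarrow> complex"
  assumes f: "test_function f"
  shows "fourier (inv_fourier f) = f"
proof
  fix x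
  let ?c = "(2 * pi) powr (- real CARD('n) / 2)"
  have "cis_transform (inv_fourier f) (- x) = of_real ?c * cis_transform (cis_transform f) (- x)"
    using cis_transform_cmult[of "of_real ?c" "cis_transform f" "- x"] by (simp add: inv_fourier_def[abs_def])
  also have "cis_transform (cis_transform f) (- x) = (LINT \<xi>|lborel. cis_transform f \<xi> * cis (- (\<xi> \<bullet> x)))"
    by (simp add: cis_transform_def[of "cis_transform f"] inner_commute)
  also have "\<dots> = of_real ((2 * pi) ^ CARD('n)) * f x"
  proof (rule fourier_inversion[OF integrable_test[OF f] _ integrable_cis_transform[OF f]])
    show "isCont f x"
      using smooth_continuous_on[OF test_function_smooth[OF f], of UNIV] by (simp add: continuous_on_eq_continuous_at)
  qed
  finally have "fourier (inv_fourier f) x = of_real (?c * ?c * (2 * pi) ^ CARD('n)) * f x"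
    by (simp add: fourier_eq_cis_transform mult_ac)
  also have "?c * ?c * (2 * pi) ^ CARD('n) = 1"
  proof -
    have "?c * ?c = (2 * pi) powr (- real CARD('n))" by (simp flip: powr_add)
    also have "\<dots> = inverse ((2 * pi) ^ CARD('n))" by (subst powr_minus, subst powr_realpow) simp_all
    finally have eq: "?c * ?c = inverse ((2 * pi) ^ CARD('n))" .
    show ?thesis unfolding eq by (rule left_inverse) simp
  qed
  finally show "fourier (inv_fourier f) x = f x" by simp
qed

lemma inv_fourier_shift: "inv_fourier (\<lambda>x. f (x + h)) \<xi> = cis (- (\<xi> \<bullet> h)) * inv_fourier f \<xi>"
  by (simp add: inv_fourier_def cis_transform_shift mult_ac)

section \<open>Linear changes of variables and the action of a distribution on test
  functions\<close>

lemma invertible_transpose': "invertible M \<Longrightarrow> invertible (transpose M)" for M :: "real^'n^'n"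
  by (simp add: invertible_det_nz)

lemma matrix_inv_mult:
  assumes "invertible A"
  shows "A ** matrix_inv A = mat 1" "matrix_inv A ** A = mat 1"
  using someI_ex[OF assms[unfolded invertible_def]] by (simp_all add: matrix_inv_def)

lemma transpose_inv_transpose:
  assumes "invertible A"
  shows "transpose A ** inv_transpose A = mat 1" "inv_transpose A ** transpose A = mat 1"
  using invertible_transpose'[OF assms] by (simp_all add: inv_transpose_def matrix_inv_mult)

lemma inner_inv_transpose:
  assumes "invertible A"
  shows "(inv_transpose A *v \<xi>) \<bullet> (A *v x) = \<xi> \<bullet> x"
proof -
  have "(inv_transpose A *v \<xi>) \<bullet> (A *v x) = (transpose A *v (inv_transpose A *v \<xi>)) \<bullet> x"
    by (simp add: transpose_matrix_vector dot_lmul_matrix)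
  then show ?thesis by (simp add: matrix_vector_mul_assoc transpose_inv_transpose[OF assms])
qed

lemma inv_fourier_linear:
  fixes A :: "real^'n^'n"
  assumes A: "invertible A"
  obtains \<kappa> where "\<kappa> > 0"
    "\<And>f \<xi>. inv_fourier (\<lambda>x. f (A *v x)) \<xi> = of_real \<kappa> * inv_fourier f (inv_transpose A *v \<xi>)"
proof -
  obtain \<kappa> where \<kappa>: "\<kappa> > 0"
    "\<And>f :: real^'n \<Rightarrow> complex. (LINT x|lborel. f (A *v x)) = \<kappa> *\<^sub>R (LINT x|lborel. f x)"
    using linear_substitution[OF A, where 'b = complex] by metis
  show ?thesis
  proof (rule that[OF \<kappa>(1)])
    fix f \<xi>
    have "cis_transform (\<lambda>x. f (A *v x)) \<xi> = (LINT x|lborel. f (A *v x) * cis ((inv_transpose A *v \<xi>) \<bullet> (A *v x)))"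
      by (simp add: cis_transform_def inner_inv_transpose[OF A])
    also have "\<dots> = \<kappa> *\<^sub>R (LINT x|lborel. f x * cis ((inv_transpose A *v \<xi>) \<bullet> x))"
      by (rule \<kappa>(2)[of "\<lambda>x. f x * cis ((inv_transpose A *v \<xi>) \<bullet> x)"])
    finally show "inv_fourier (\<lambda>x. f (A *v x)) \<xi> = of_real \<kappa> * inv_fourier f (inv_transpose A *v \<xi>)"
      by (simp add: inv_fourier_def cis_transform_def scaleR_conv_of_real mult_ac)
  qed
qed

text \<open>\<open>has_fourier_transform\<close> describes the distribution on functions of the form
  \<open>fourier g\<close>. A test function is brought into this form by its inverse transform,
  which is Schwartz.\<close>

lemma distr_test_function:
  assumes "has_fourier_transform \<phi> F" "test_function f"
  shows "integrable lborel (\<lambda>\<xi>. F \<xi> * inv_fourier f \<xi>)"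
    and "\<phi> f = (LINT \<xi>|lborel. F \<xi> * inv_fourier f \<xi>)"
  using assms schwartz_inv_fourier[OF assms(2)] fourier_inv_fourier[OF assms(2)]
  by (metis has_fourier_transform_def)+

section \<open>Integer shifts of a compactly supported distribution\<close>

definition intvec :: "int^'n \<Rightarrow> real^'n" where
  "intvec k = (\<chi> i. real_of_int (k $ i))"

lemma intvec_nth [simp]: "intvec k $ i = real_of_int (k $ i)"
  by (simp add: intvec_def)

lemma intvec_add: "intvec (k + l) = intvec k + intvec l"
  and intvec_diff: "intvec (k - l) = intvec k - intvec l"
  and intvec_minus: "intvec (- k) = - intvec k"
  and intvec_0 [simp]: "intvec 0 = 0"
  by (simp_all add: vec_eq_iff)

lemma intvec_eq_iff [simp]: "intvec k = intvec l \<longleftrightarrow> k = l"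
  by (simp add: vec_eq_iff)

lemma intvec_surj: "(\<And>i. x $ i \<in> \<int>) \<Longrightarrow> \<exists>k. x = intvec k"
  by (rule exI[of _ "\<chi> i. \<lfloor>x $ i\<rfloor>"]) (auto simp: vec_eq_iff Ints_def)

lemma finite_intvec_bounded: "finite {k :: int^'n. norm (intvec k) \<le> R}"
proof -
  have "{k :: int^'n. norm (intvec k) \<le> R} \<subseteq> vec_lambda ` (PiE UNIV (\<lambda>_. {- \<lceil>R\<rceil>..\<lceil>R\<rceil>}))"
  proof
    fix k :: "int^'n" assume k: "k \<in> {k. norm (intvec k) \<le> R}"
    have "k $ i \<in> {- \<lceil>R\<rceil>..\<lceil>R\<rceil>}" for i
    proof -
      have "\<bar>real_of_int (k $ i)\<bar> \<le> R" using component_le_norm_cart[of "intvec k" i] k by simp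
      then show ?thesis by (auto simp: abs_le_iff) linarith+
    qed
    then show "k \<in> vec_lambda ` (PiE UNIV (\<lambda>_. {- \<lceil>R\<rceil>..\<lceil>R\<rceil>}))"
      by (intro image_eqI[of _ _ "\<lambda>i. k $ i"]) auto
  qed
  then show ?thesis by (rule finite_subset) (intro finite_imageI finite_PiE; simp)
qed

lemma distr_shift_support:
  assumes "compactly_supported \<phi>" "test_function f"
  obtains R where "\<And>y. norm y \<ge> R \<Longrightarrow> \<phi> (\<lambda>x. f (x + y)) = 0"
proof -
  obtain K where K: "compact K" "\<And>f. test_function f \<Longrightarrow> closure {x. f x \<noteq> 0} \<inter> K = {} \<Longrightarrow> \<phi> f = 0"
    using assms(1) by (auto simp: compactly_supported_def)
  obtain a where a: "\<And>x. x \<in> K \<Longrightarrow> norm x \<le> a"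
    using compact_imp_bounded[OF K(1)] by (auto simp: bounded_iff)
  obtain r where r: "r > 0" "\<And>x. norm x \<ge> r \<Longrightarrow> f x = 0"
    using test_function_support[OF assms(2)] by metis
  show ?thesis
  proof (rule that[of "a + r + 1"], rule K(2))
    fix y :: "real^'a" assume y: "norm y \<ge> a + r + 1"
    have "closure {x. f (x + y) \<noteq> 0} \<subseteq> cball (- y) r"
    proof (rule closure_minimal)
      show "{x. f (x + y) \<noteq> 0} \<subseteq> cball (- y) r"
      proof
        fix x assume "x \<in> {x. f (x + y) \<noteq> 0}"
        then have "norm (x + y) < r" using r(2)[of "x + y"] by force
        then show "x \<in> cball (- y) r" by (simp add: dist_norm norm_minus_commute add.commute)
      qed
    qed simp
    moreover have "x \<notin> K" if "x \<in> cball (- y) r" for x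
    proof
      assume "x \<in> K"
      then have "norm x \<le> a" by (rule a)
      moreover have "norm (x + y) \<le> r" using that by (simp add: dist_norm norm_minus_commute add.commute)
      moreover have "norm y \<le> norm (x + y) + norm x" by (metis add_diff_cancel_left' norm_triangle_ineq4)
      ultimately show False using y by linarith
    qed
    ultimately show "closure {x. f (x + y) \<noteq> 0} \<inter> K = {}" by blast
  qed (rule test_function_shift[OF assms(2)])
qed

lemma finite_shift_support:
  assumes "compactly_supported \<phi>" "test_function f"
  shows "finite {k. \<phi> (\<lambda>x. f (x + intvec k)) \<noteq> 0}"
proof -
  obtain R where "\<And>y. norm y \<ge> R \<Longrightarrow> \<phi> (\<lambda>x. f (x + y)) = 0"
    using distr_shift_support[OF assms] by blast
  then have "norm (intvec k) \<le> R" if "\<phi> (\<lambda>x. f (x + intvec k)) \<noteq> 0" for k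
    using that linear[of "norm (intvec k)" R] by blast
  then have "{k. \<phi> (\<lambda>x. f (x + intvec k)) \<noteq> 0} \<subseteq> {k. norm (intvec k) \<le> R}" by blast
  then show ?thesis using finite_intvec_bounded finite_subset by blast
qed

text \<open>The integer translates of the half-open unit cube partition the space, so the integral
  over the space is the integral over the cube of the sum of all integer translates of
  \<open>w\<close>.\<close>

lemma integral_periodization_0:
  fixes w :: "real^'n \<Rightarrow> complex"
  assumes int: "integrable lborel w" and supp: "\<And>x. norm x \<ge> R \<Longrightarrow> w x = 0"
    and zero: "\<And>y. Sum_any (\<lambda>l. w (y - intvec l)) = 0"
  shows "(LINT x|lborel. w x) = 0"
proof -
  define Q where "Q = {x::real^'n. \<forall>i. 0 \<le> x $ i \<and> x $ i < 1}"
  \<comment> \<open>Points of the cube have norm at most d, so this finite set contains every shift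
    that carries a point of the support into the cube.\<close>
  define L where "L = {l :: int^'n. norm (intvec l) \<le> real CARD('n) + R}"
  have fin: "finite L" unfolding L_def by (rule finite_intvec_bounded)
  have [measurable]: "w \<in> borel_measurable borel" using borel_measurable_integrable[OF int] by simp
  have [measurable]: "Q \<in> sets borel" unfolding Q_def by measurable
  have Qn: "norm x \<le> real CARD('n)" if "x \<in> Q" for x
  proof -
    have "norm x \<le> (\<Sum>i\<in>UNIV. \<bar>x $ i\<bar>)" by (rule norm_le_l1_cart)
    also have "\<dots> \<le> (\<Sum>i\<in>(UNIV::'n set). 1)" using that by (intro sum_mono) (auto simp: Q_def abs_le_iff intro: less_imp_le order_trans)
    finally show ?thesis by simp
  qed
  have part: "w x = (\<Sum>l\<in>L. indicator Q (x + intvec l) * w x)" for x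
  proof (cases "norm x < R")
    case True
    let ?l = "\<chi> i. - \<lfloor>x $ i\<rfloor>"
    have iff: "x + intvec l \<in> Q \<longleftrightarrow> l = ?l" for l
    proof -
      have "0 \<le> x $ i + real_of_int (l $ i) \<and> x $ i + real_of_int (l $ i) < 1 \<longleftrightarrow> l $ i = - \<lfloor>x $ i\<rfloor>" for i
        by linarith
      then show ?thesis by (auto simp: Q_def vec_eq_iff)
    qed
    have "norm (intvec ?l) \<le> norm (x + intvec ?l) + norm x"
      by (metis add_diff_cancel_left' norm_triangle_ineq4)
    then have "?l \<in> L" using Qn[of "x + intvec ?l"] iff[of ?l] True by (simp add: L_def)
    then have "(\<Sum>l\<in>L. indicator Q (x + intvec l) * w x) = (\<Sum>l\<in>L. if l = ?l then w x else 0)"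
      by (intro sum.cong refl) (auto simp: indicator_def iff)
    then show ?thesis using fin \<open>?l \<in> L\<close> by simp
  qed (use supp in auto)
  have int1: "integrable lborel (\<lambda>x. indicator Q (x + intvec l) * w x)" for l
    by (rule Bochner_Integration.integrable_bound[OF int]) (measurable, auto simp: norm_mult indicator_def)
  have int2: "integrable lborel (\<lambda>x. indicator Q x * w (x - intvec l))" for l
    using lborel_integrable_shiftI(1)[OF int1[of l], of "- intvec l"] by simp
  have fold_0: "(\<Sum>l\<in>L. indicator Q x * w (x - intvec l)) = 0" for x
  proof (cases "x \<in> Q")
    case True
    have "{l. w (x - intvec l) \<noteq> 0} \<subseteq> L"
    proof
      fix l assume "l \<in> {l. w (x - intvec l) \<noteq> 0}"
      then have "norm (x - intvec l) < R" using supp[of "x - intvec l"] by force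
      moreover have "norm (intvec l) \<le> norm x + norm (x - intvec l)"
        by (metis diff_add_cancel norm_minus_commute norm_triangle_sub)
      ultimately show "l \<in> L" using Qn[OF True] by (simp add: L_def)
    qed
    then have "(\<Sum>l\<in>L. w (x - intvec l)) = 0"
      using zero[of x] Sum_any.expand_superset[OF fin, of "\<lambda>l. w (x - intvec l)"] by simp
    then show ?thesis using True by simp
  qed simp
  have "(LINT x|lborel. w x) = (LINT x|lborel. (\<Sum>l\<in>L. indicator Q (x + intvec l) * w x))"
    using part by simp
  also have "\<dots> = (\<Sum>l\<in>L. (LINT x|lborel. indicator Q (x + intvec l) * w x))"
    by (rule Bochner_Integration.integral_sum) (rule int1)
  also have "\<dots> = (\<Sum>l\<in>L. (LINT x|lborel. indicator Q x * w (x - intvec l)))"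
    using lborel_integral_shift[of "\<lambda>x. indicator Q (x + intvec l) * w x" "- intvec l" for l] by simp
  also have "\<dots> = (LINT x|lborel. (\<Sum>l\<in>L. indicator Q x * w (x - intvec l)))"
    by (rule Bochner_Integration.integral_sum[symmetric]) (rule int2)
  finally show ?thesis by (simp add: fold_0)
qed

text \<open>Poisson summation at one frequency. The transform of H = F times
  \<open>inv_fourier f\<close> at y is the value of \<open>\<phi>\<close> on f(. - y), hence
  compactly supported, and inversion recovers H(p) from it as an integral. Periodizing the integrand
  gives the twisted sum for a translate of f, which is 0; so F(p) times the inverse transform of f
  at p vanishes for every test function f.\<close>

lemma fourier_eq_0_of_twisted_sum:
  fixes \<phi> :: "'n::finite distr"
  assumes ft: "has_fourier_transform \<phi> F" and cs: "compactly_supported \<phi>" and cont: "isCont F p"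
    and zero: "\<And>f. test_function f \<Longrightarrow>
      Sum_any (\<lambda>l. cis (p \<bullet> intvec l) * \<phi> (\<lambda>x. f (x + intvec l))) = 0"
  shows "F p = 0"
proof -
  have "F p * inv_fourier f p = 0" if f: "test_function f" for f
  proof -
    define H where "H = (\<lambda>\<xi>. F \<xi> * inv_fourier f \<xi>)"
    define u where "u = (\<lambda>y. \<phi> (\<lambda>x. f (x + y)))"
    have H: "integrable lborel H" unfolding H_def by (rule distr_test_function[OF ft f])
    have u: "cis_transform H y = u (- y)" for y
    proof -
      have "u (- y) = (LINT \<xi>|lborel. F \<xi> * (cis (- (\<xi> \<bullet> - y)) * inv_fourier f \<xi>))"
        unfolding u_def distr_test_function(2)[OF ft test_function_shift[OF f]]
        by (simp only: inv_fourier_shift)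
      then show ?thesis by (simp add: cis_transform_def H_def inner_commute mult_ac)
    qed
    have contH: "isCont H p"
    proof -
      have "isCont (inv_fourier f) p"
        using schwartz_inv_fourier[OF f] unfolding schwartz_def
        by (metis UNIV_I continuous_on_eq_continuous_at open_UNIV smooth_continuous_on)
      with cont show ?thesis unfolding H_def by (intro continuous_intros)
    qed
    obtain R where R: "\<And>y. norm y \<ge> R \<Longrightarrow> u y = 0"
      using distr_shift_support[OF cs f] unfolding u_def by blast
    have JH: "integrable lborel (cis_transform H)"
    proof (rule Bochner_Integration.integrable_bound)
      let ?C = "LINT x|lborel. norm (H x)"
      show "integrable lborel (\<lambda>y::real^'n. indicator (ball 0 R) y *\<^sub>R ?C)"
        using emeasure_lborel_ball_finite[of "0::real^'n" R] by simp
      show "AE y in lborel. norm (cis_transform H y) \<le> norm (indicator (ball 0 R) y *\<^sub>R ?C)"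
        using norm_cis_transform_le[of H] R u by (intro AE_I2) (auto simp: indicator_def not_less abs_of_nonneg)
      have [measurable]: "H \<in> borel_measurable borel" using borel_measurable_integrable[OF H] by simp
      have [measurable]: "(\<lambda>p::(real^'n) \<times> (real^'n). cis (fst p \<bullet> snd p)) \<in> borel_measurable (borel \<Otimes>\<^sub>M borel)"
        unfolding borel_prod cis_conv_exp by (intro borel_measurable_continuous_onI continuous_intros)
      have "(\<lambda>(y, x). H x * cis (y \<bullet> x)) \<in> borel_measurable (lborel \<Otimes>\<^sub>M lborel)"
        unfolding split_beta' by measurable
      then show "cis_transform H \<in> borel_measurable lborel"
        unfolding cis_transform_def[abs_def] by (rule lborel.borel_measurable_lebesgue_integral)
    qed
    have "(LINT y|lborel. cis_transform H y * cis (- (y \<bullet> p))) = 0"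
    proof (rule integral_periodization_0)
      show "integrable lborel (\<lambda>y. cis_transform H y * cis (- (y \<bullet> p)))" by (rule integrable_mult_cis(3)[OF JH])
      show "cis_transform H y * cis (- (y \<bullet> p)) = 0" if "norm y \<ge> R" for y
        using R[of "- y"] that by (simp add: u)
      fix y
      have "Sum_any (\<lambda>l. cis_transform H (y - intvec l) * cis (- ((y - intvec l) \<bullet> p)))
         = Sum_any (\<lambda>l. cis (- (y \<bullet> p)) * (cis (p \<bullet> intvec l) * \<phi> (\<lambda>x. f (x + intvec l + - y))))"
        by (intro Sum_any.cong) (simp add: u u_def inner_diff_left cis_mult inner_commute add_ac algebra_simps)
      also have "\<dots> = cis (- (y \<bullet> p)) * Sum_any (\<lambda>l. cis (p \<bullet> intvec l) * \<phi> (\<lambda>x. f (x + intvec l + - y)))"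
        using finite_shift_support[OF cs test_function_shift[OF f, of "- y"]]
        by (intro Sum_any_right_distrib[symmetric]) simp
      also have "\<dots> = 0" using zero[OF test_function_shift[OF f, of "- y"]] by simp
      finally show "Sum_any (\<lambda>l. cis_transform H (y - intvec l) * cis (- ((y - intvec l) \<bullet> p))) = 0" .
    qed
    then have "H p = 0" using fourier_inversion[OF H contH JH] by simp
    then show ?thesis by (simp add: H_def)
  qed
  \<comment> \<open>Otherwise the character with frequency \<open>p\<close> would be orthogonal to
    all test functions.\<close>
  moreover have "\<exists>f. test_function f \<and> inv_fourier f p \<noteq> 0"
  proof (rule ccontr)
    assume "\<nexists>f. test_function f \<and> inv_fourier f p \<noteq> 0"
    then have "(LINT x|lborel. cis (p \<bullet> x) * f x) = 0" if "test_function f" for f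
      using that by (auto simp: inv_fourier_def cis_transform_def mult.commute)
    then have "cis (p \<bullet> (0::real^'n)) = 0"
      by (intro continuous_eq_0I[of "\<lambda>x. cis (p \<bullet> x)"]) (auto intro!: continuous_intros simp: cis_conv_exp)
    then show False by simp
  qed
  ultimately show ?thesis by auto
qed

section \<open>Polynomials\<close>

text \<open>Homogeneous polynomials of degree \<open>j\<close>. Splitting off one coordinate at a
  time makes the closure properties inductions on the degree; the splitting is not unique, so
  arguments choose one.\<close>

primrec hpoly :: "nat \<Rightarrow> (real^'n \<Rightarrow> 'a::real_normed_field) set" where
  "hpoly 0 = range (\<lambda>c x. c)"
| "hpoly (Suc j) = {\<lambda>x. \<Sum>i\<in>UNIV. of_real (x $ i) * p i x | p. \<forall>i. p i \<in> hpoly j}"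

lemma hpoly_SucI: "(\<And>i. p i \<in> hpoly j) \<Longrightarrow> (\<lambda>x. \<Sum>i\<in>UNIV. of_real (x $ i) * p i x) \<in> hpoly (Suc j)"
  by auto

lemma hpoly_add: "p \<in> hpoly j \<Longrightarrow> q \<in> hpoly j \<Longrightarrow> (\<lambda>x. p x + q x) \<in> hpoly j"
proof (induction j arbitrary: p q)
  case (Suc j)
  then obtain u v where uv: "\<And>i. u i \<in> hpoly j" "\<And>i. v i \<in> hpoly j"
    and *: "p = (\<lambda>x. \<Sum>i\<in>UNIV. of_real (x $ i) * u i x)" "q = (\<lambda>x. \<Sum>i\<in>UNIV. of_real (x $ i) * v i x)"
    by auto
  have "(\<lambda>x. \<Sum>i\<in>UNIV. of_real (x $ i) * (u i x + v i x)) \<in> hpoly (Suc j)"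
    by (intro hpoly_SucI Suc.IH uv)
  then show ?case by (simp add: * distrib_left sum.distrib)
qed auto

lemma hpoly_cmult: "p \<in> hpoly j \<Longrightarrow> (\<lambda>x. c * p x) \<in> hpoly j"
proof (induction j arbitrary: p)
  case (Suc j)
  then obtain u where u: "\<And>i. u i \<in> hpoly j" and *: "p = (\<lambda>x. \<Sum>i\<in>UNIV. of_real (x $ i) * u i x)"
    by auto
  have "(\<lambda>x. \<Sum>i\<in>UNIV. of_real (x $ i) * (c * u i x)) \<in> hpoly (Suc j)"
    by (intro hpoly_SucI Suc.IH u)
  then show ?case by (simp add: * sum_distrib_left mult_ac)
qed auto

lemma hpoly_0: "(\<lambda>x. 0) \<in> hpoly j"
proof (induction j)
  case (Suc j)
  then show ?case using hpoly_SucI[of "\<lambda>i x. 0" j] by simp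
qed auto

lemma hpoly_sum: "(\<And>i. i \<in> I \<Longrightarrow> p i \<in> hpoly j) \<Longrightarrow> (\<lambda>x. \<Sum>i\<in>I. p i x) \<in> hpoly j"
  by (induction I rule: infinite_finite_induct) (auto intro: hpoly_add hpoly_0)

lemma hpoly_coord:
  assumes "p \<in> hpoly j" shows "(\<lambda>x. of_real (x $ i) * p x) \<in> hpoly (Suc j)"
proof -
  have "(\<lambda>x. \<Sum>k\<in>UNIV. of_real (x $ k) * (if k = i then p else (\<lambda>x. 0)) x) \<in> hpoly (Suc j)"
    using assms by (intro hpoly_SucI) (auto intro: hpoly_0)
  also have "(\<lambda>x. \<Sum>k\<in>UNIV. of_real (x $ k) * (if k = i then p else (\<lambda>x. 0)) x) = (\<lambda>x. of_real (x $ i) * p x)"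
    by (simp add: if_distrib if_distribR sum.delta cong: if_cong)
  finally show ?thesis .
qed

lemma hpoly_linear:
  "p \<in> hpoly j \<Longrightarrow> (\<lambda>x. p (M *v x)) \<in> hpoly j" for M :: "real^'n^'n"
proof (induction j arbitrary: p)
  case (Suc j)
  then obtain u where u: "\<And>i. u i \<in> hpoly j" and *: "p = (\<lambda>x. \<Sum>i\<in>UNIV. of_real (x $ i) * u i x)"
    by auto
  have "(\<lambda>x. \<Sum>k\<in>UNIV. of_real (x $ k) * (\<Sum>i\<in>UNIV. of_real (M $ i $ k) * u i (M *v x))) \<in> hpoly (Suc j)"
    using Suc.IH[OF u] by (intro hpoly_SucI hpoly_sum hpoly_cmult)
  also have "(\<lambda>x. \<Sum>k\<in>UNIV. of_real (x $ k) * (\<Sum>i\<in>UNIV. of_real (M $ i $ k) * u i (M *v x))) = (\<lambda>x. p (M *v x))"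
  proof
    fix x
    have "(\<Sum>k\<in>UNIV. of_real (x $ k) * (\<Sum>i\<in>UNIV. of_real (M $ i $ k) * u i (M *v x)))
      = (\<Sum>k\<in>UNIV. \<Sum>i\<in>UNIV. of_real (M $ i $ k * x $ k) * u i (M *v x))"
      by (simp add: sum_distrib_left mult_ac)
    also have "\<dots> = (\<Sum>i\<in>UNIV. \<Sum>k\<in>UNIV. of_real (M $ i $ k * x $ k) * u i (M *v x))"
      by (rule sum.swap)
    also have "\<dots> = p (M *v x)"
      unfolding * by (simp add: matrix_vector_mult_def sum_distrib_right)
    finally show "(\<Sum>k\<in>UNIV. of_real (x $ k) * (\<Sum>i\<in>UNIV. of_real (M $ i $ k) * u i (M *v x))) = p (M *v x)" .
  qed
  finally show ?case .
qed auto

lemma hpoly_scale: "p \<in> hpoly j \<Longrightarrow> p (t *\<^sub>R x) = of_real t ^ j * p x"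
proof (induction j arbitrary: p)
  case (Suc j)
  then obtain u where u: "\<And>i. u i \<in> hpoly j" and *: "p = (\<lambda>x. \<Sum>i\<in>UNIV. of_real (x $ i) * u i x)"
    by auto
  show ?case by (simp add: * Suc.IH[OF u] sum_distrib_left mult_ac)
qed auto

lemma hpoly_continuous_on: "p \<in> hpoly j \<Longrightarrow> continuous_on S p"
proof (induction j arbitrary: p)
  case (Suc j)
  then obtain u where u: "\<And>i. u i \<in> hpoly j" and *: "p = (\<lambda>x. \<Sum>i\<in>UNIV. of_real (x $ i) * u i x)"
    by auto
  show ?case unfolding * by (intro continuous_intros Suc.IH u)
qed auto

text \<open>A form of \<open>real_polynomial_function\<close> over any real normed field.
  Multiplication by a single coordinate as generator makes inductions short and matches
  \<open>hpoly\<close>.\<close>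

inductive_set polys :: "(real^'n \<Rightarrow> 'a::real_normed_field) set" where
  const: "(\<lambda>x. c) \<in> polys"
| coord: "p \<in> polys \<Longrightarrow> (\<lambda>x. of_real (x $ i) * p x) \<in> polys"
| add: "p \<in> polys \<Longrightarrow> q \<in> polys \<Longrightarrow> (\<lambda>x. p x + q x) \<in> polys"

lemma polys_cmult: "p \<in> polys \<Longrightarrow> (\<lambda>x. c * p x) \<in> polys"
proof (induction rule: polys.induct)
  case (coord p i)
  then show ?case using polys.coord[of "\<lambda>x. c * p x" i] by (simp add: mult_ac)
qed (auto simp: distrib_left intro: polys.intros)

lemma polys_diff: "p \<in> polys \<Longrightarrow> q \<in> polys \<Longrightarrow> (\<lambda>x. p x - q x) \<in> polys"
  using polys.add[of p "\<lambda>x. - 1 * q x"] polys_cmult[of q "- 1"] by simp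

lemma polys_sum: "(\<And>i. i \<in> I \<Longrightarrow> p i \<in> polys) \<Longrightarrow> (\<lambda>x. \<Sum>i\<in>I. p i x) \<in> polys"
  by (induction I rule: infinite_finite_induct) (auto intro: polys.intros)

lemma polys_mult: "p \<in> polys \<Longrightarrow> q \<in> polys \<Longrightarrow> (\<lambda>x. p x * q x) \<in> polys"
proof (induction rule: polys.induct)
  case (coord p i)
  then show ?case using polys.coord[of "\<lambda>x. p x * q x" i] by (simp add: mult_ac)
qed (auto simp: distrib_right intro: polys.intros polys_cmult)

lemma polys_coordinate: "(\<lambda>x. of_real (x $ i)) \<in> polys"
  using polys.coord[OF polys.const[of 1], of i] by simp

lemma polys_affine: "p \<in> polys \<Longrightarrow> (\<lambda>x. p (M *v x + h)) \<in> polys" for M :: "real^'n^'n"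
proof (induction rule: polys.induct)
  case (coord p i)
  have "(\<lambda>x. of_real ((M *v x + h) $ i) :: 'a) = (\<lambda>x. (\<Sum>k\<in>UNIV. of_real (M $ i $ k) * of_real (x $ k)) + of_real (h $ i))"
    by (simp add: matrix_vector_mult_def)
  then have "(\<lambda>x. of_real ((M *v x + h) $ i) :: 'a) \<in> polys"
    by (auto intro!: polys.add polys_sum polys_cmult polys_coordinate polys.const)
  from polys_mult[OF this coord.IH] show ?case .
qed (auto intro: polys.intros)

lemma polys_shift: "p \<in> polys \<Longrightarrow> (\<lambda>x. p (x + h)) \<in> polys"
  using polys_affine[of p "mat 1" h] by simp

lemma polys_linear: "p \<in> polys \<Longrightarrow> (\<lambda>x. p (M *v x)) \<in> polys" for M :: "real^'n^'n"
  using polys_affine[of p M 0] by simp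

lemma polys_continuous_on: "p \<in> polys \<Longrightarrow> continuous_on S p"
  by (induction rule: polys.induct) (auto intro!: continuous_intros)

lemma polys_of_real: "P \<in> polys \<Longrightarrow> (\<lambda>x. of_real (P x)) \<in> polys"
  by (induction rule: polys.induct) (auto intro: polys.intros)

lemma real_polynomial_function_iff_polys: "real_polynomial_function P \<longleftrightarrow> P \<in> polys"
proof
  assume "real_polynomial_function P"
  then show "P \<in> polys"
  proof (induction rule: real_polynomial_function.induct)
    case (linear f)
    have "f x = (\<Sum>k\<in>UNIV. f (axis k 1) * of_real (x $ k))" for x
      using linear_axis_expand[OF bounded_linear.linear[OF linear], of x] by (simp add: mult.commute)
    then have eq: "f = (\<lambda>x. \<Sum>k\<in>UNIV. f (axis k 1) * of_real (x $ k))" ..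
    show ?case by (subst eq) (intro polys_sum polys_cmult polys_coordinate)
  qed (auto intro: polys.intros polys_mult)
next
  assume "P \<in> polys"
  then show "real_polynomial_function P"
  proof (induction rule: polys.induct)
    case (coord p i)
    have "real_polynomial_function (\<lambda>x. x $ i)"
      by (rule real_polynomial_function.intros(1)) (rule bounded_linear_vec_nth)
    with coord show ?case by (auto intro: real_polynomial_function.intros)
  qed (auto intro: real_polynomial_function.intros)
qed

text \<open>The sum represents \<open>p\<close> for every sufficiently large number of terms, so two
  decompositions can be padded to a common length and added.\<close>

lemma polys_decomp:
  assumes "p \<in> polys"
  shows "\<exists>h N. (\<forall>j. h j \<in> hpoly j) \<and> (\<forall>M\<ge>N. \<forall>x. p x = (\<Sum>j<M. h j x))"
  using assms
proof (induction rule: polys.induct)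
  case (const c)
  define h :: "nat \<Rightarrow> real^'a \<Rightarrow> 'b" where "h = (\<lambda>j x. if j = 0 then c else 0)"
  have "h j \<in> hpoly j" for j by (cases j) (auto simp: h_def hpoly_0 simp del: hpoly.simps(2))
  moreover have "\<forall>M\<ge>1. \<forall>x. c = (\<Sum>j<M. h j x)" by (simp add: h_def sum.delta)
  ultimately show ?case by blast
next
  case (coord p i)
  then obtain h N where h: "\<And>j. h j \<in> hpoly j" "\<And>M x. M \<ge> N \<Longrightarrow> p x = (\<Sum>j<M. h j x)" by blast
  define g where "g = (\<lambda>j. case j of 0 \<Rightarrow> \<lambda>x. 0 | Suc j \<Rightarrow> (\<lambda>x. of_real (x $ i) * h j x))"
  have "g j \<in> hpoly j" for j
    using hpoly_coord[OF h(1)] by (cases j) (auto simp: g_def hpoly_0 simp del: hpoly.simps(2))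
  moreover have "of_real (x $ i) * p x = (\<Sum>j<M. g j x)" if M: "M \<ge> Suc N" for M x
  proof -
    obtain M' where M': "M = Suc M'" "M' \<ge> N" using M by (cases M) auto
    show ?thesis unfolding M'(1) sum.lessThan_Suc_shift by (simp add: g_def h(2)[OF M'(2)] sum_distrib_left)
  qed
  ultimately show ?case by blast
next
  case (add p q)
  then obtain h N g M where "\<And>j. h j \<in> hpoly j" "\<And>M x. M \<ge> N \<Longrightarrow> p x = (\<Sum>j<M. h j x)"
    "\<And>j. g j \<in> hpoly j" "\<And>K x. K \<ge> M \<Longrightarrow> q x = (\<Sum>j<K. g j x)" by blast
  then show ?case
    by (intro exI[of _ "\<lambda>j x. h j x + g j x"] exI[of _ "max N M"]) (auto intro: hpoly_add simp: sum.distrib)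
qed

text \<open>At (n+1) y_n the part of degree j is (n+1)^j times its value at y_n. Division by (n+1)^N
  leaves a negative power of n+1 on every part except the top one.\<close>

lemma hpoly_leading_term:
  assumes h: "\<And>j. h j \<in> hpoly j" and y: "y \<longlonglongrightarrow> x"
  shows "(\<lambda>n. (\<Sum>j<Suc N. h j (real (Suc n) *\<^sub>R y n)) / of_real (real (Suc n)) ^ N) \<longlonglongrightarrow> (h N x :: 'a::real_normed_field)"
proof -
  have lim: "(\<lambda>n. inverse (of_real (real (Suc n))) ^ k) \<longlonglongrightarrow> (of_bool (k = 0) :: 'a)" for k
  proof (cases k)
    case (Suc l)
    have "(\<lambda>n. of_real (inverse (real (Suc n))) ^ k) \<longlonglongrightarrow> (of_real 0 ^ k :: 'a)"
      by (intro tendsto_power tendsto_of_real LIMSEQ_inverse_real_of_nat)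
    then show ?thesis by (simp add: Suc)
  qed simp
  have "(\<lambda>n. \<Sum>j<Suc N. inverse (of_real (real (Suc n))) ^ (N - j) * h j (y n)) \<longlonglongrightarrow> (\<Sum>j<Suc N. of_bool (N - j = 0) * h j x)"
    by (intro tendsto_sum tendsto_mult lim continuous_on_tendsto_compose[OF hpoly_continuous_on[OF h, where S = UNIV] y]) auto
  also have "(\<Sum>j<Suc N. of_bool (N - j = 0) * h j x) = (\<Sum>j<Suc N. if j = N then h j x else 0)"
    by (intro sum.cong) auto
  also have "\<dots> = h N x" by simp
  also have "(\<lambda>n. \<Sum>j<Suc N. inverse (of_real (real (Suc n))) ^ (N - j) * h j (y n))
     = (\<lambda>n. (\<Sum>j<Suc N. h j (real (Suc n) *\<^sub>R y n)) / of_real (real (Suc n)) ^ N)"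
  proof
    fix n
    have "inverse (of_real (real (Suc n))) ^ (N - j) * h j (y n) = h j (real (Suc n) *\<^sub>R y n) / of_real (real (Suc n)) ^ N"
      if "j < Suc N" for j
    proof -
      have "of_real (real (Suc n)) ^ N = (of_real (real (Suc n)) ^ (N - j) * of_real (real (Suc n)) ^ j :: 'a)"
        using that by (simp flip: power_add)
      then show ?thesis unfolding hpoly_scale[OF h]
        by (simp add: field_simps power_inverse del: of_nat_Suc of_real_of_nat_eq)
    qed
    then show "(\<Sum>j<Suc N. inverse (of_real (real (Suc n))) ^ (N - j) * h j (y n))
      = (\<Sum>j<Suc N. h j (real (Suc n) *\<^sub>R y n)) / of_real (real (Suc n)) ^ N"
      unfolding sum_divide_distrib by (intro sum.cong) auto
  qed
  finally show ?thesis .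
qed

text \<open>Rescaled lattice points approximate every vector, and a fixed offset disappears in the
  limit. Hence leading terms are determined by values on the lattice.\<close>

lemma floor_approx: "\<exists>k :: nat \<Rightarrow> int^'n. (\<lambda>n. (1 / real (Suc n)) *\<^sub>R (intvec (k n) + l)) \<longlonglongrightarrow> x"
proof -
  define k where "k = (\<lambda>n. \<chi> i. \<lfloor>real (Suc n) * x $ i\<rfloor>)"
  have "(\<lambda>n. ((1 / real (Suc n)) *\<^sub>R (intvec (k n) + l)) $ i) \<longlonglongrightarrow> x $ i" for i
  proof -
  have "(\<lambda>n. (real_of_int \<lfloor>real (Suc n) * x $ i\<rfloor> - real (Suc n) * x $ i + l $ i) * inverse (real (Suc n))) \<longlonglongrightarrow> 0"
  proof (rule Lim_null_comparison[where g = "\<lambda>n. (1 + \<bar>l $ i\<bar>) * inverse (real (Suc n))"])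
    show "\<forall>\<^sub>F n in sequentially. norm ((real_of_int \<lfloor>real (Suc n) * x $ i\<rfloor> - real (Suc n) * x $ i + l $ i) * inverse (real (Suc n)))
        \<le> (1 + \<bar>l $ i\<bar>) * inverse (real (Suc n))"
    proof (intro always_eventually allI)
      fix n
      have "\<bar>real_of_int \<lfloor>a\<rfloor> - a + b\<bar> \<le> 1 + \<bar>b\<bar>" for a b :: real by linarith
      then have "\<bar>real_of_int \<lfloor>real (Suc n) * x $ i\<rfloor> - real (Suc n) * x $ i + l $ i\<bar> * inverse (real (Suc n))
        \<le> (1 + \<bar>l $ i\<bar>) * inverse (real (Suc n))" by (rule mult_right_mono) simp
      then show "norm ((real_of_int \<lfloor>real (Suc n) * x $ i\<rfloor> - real (Suc n) * x $ i + l $ i) * inverse (real (Suc n)))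
        \<le> (1 + \<bar>l $ i\<bar>) * inverse (real (Suc n))"
        by (simp only: real_norm_def abs_mult abs_inverse abs_of_nat)
    qed
    show "(\<lambda>n. (1 + \<bar>l $ i\<bar>) * inverse (real (Suc n))) \<longlonglongrightarrow> 0"
      by (intro tendsto_mult_right_zero LIMSEQ_inverse_real_of_nat)
  qed
    from tendsto_add[OF this tendsto_const[of "x $ i"]]
    have "(\<lambda>n. (real_of_int \<lfloor>real (Suc n) * x $ i\<rfloor> - real (Suc n) * x $ i + l $ i) * inverse (real (Suc n)) + x $ i) \<longlonglongrightarrow> x $ i"
      by (simp only: add_0_left)
    moreover have "(real_of_int \<lfloor>real (Suc n) * x $ i\<rfloor> - real (Suc n) * x $ i + l $ i) * inverse (real (Suc n)) + x $ i
      = ((1 / real (Suc n)) *\<^sub>R (intvec (k n) + l)) $ i" for n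
      by (simp add: k_def field_simps del: of_nat_Suc)
    ultimately show ?thesis by simp
  qed
  then have "(\<lambda>n. (1 / real (Suc n)) *\<^sub>R (intvec (k n) + l)) \<longlonglongrightarrow> x"
    by (rule vec_tendstoI)
  then show ?thesis by blast
qed

text \<open>A difference operator with nonzero coefficient sum does not annihilate the leading term.\<close>

lemma polys_eq_0_of_difference:
  fixes p :: "real^'n \<Rightarrow> 'a::real_normed_field"
  assumes "p \<in> polys" "sum \<alpha> L \<noteq> 0" "\<And>k. (\<Sum>l\<in>L. \<alpha> l * p (intvec k + v l)) = 0"
  shows "p = (\<lambda>x. 0)"
proof -
  obtain h N where h: "\<And>j. h j \<in> hpoly j" and p: "\<And>x. p x = (\<Sum>j<N. h j x)"
    using polys_decomp[OF assms(1)] by blast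
  have "p = (\<lambda>x. \<Sum>j<N. h j x)" using p by blast
  then show ?thesis
  proof (induction N)
    case (Suc N)
    have "h N x = 0" for x
    proof -
      obtain k where k: "(\<lambda>n. (1 / real (Suc n)) *\<^sub>R (intvec (k n) + 0)) \<longlonglongrightarrow> x"
        using floor_approx[of 0 x] by blast
      have "(\<lambda>n. (1 / real (Suc n)) *\<^sub>R (intvec (k n) + v l)) \<longlonglongrightarrow> x" for l
        using tendsto_add[OF k tendsto_scaleR[OF LIMSEQ_Suc[OF lim_1_over_n] tendsto_const[of "v l"]]]
        by (simp add: scaleR_add_right del: of_nat_Suc)
      from hpoly_leading_term[OF h this, where N = N]
      have "(\<lambda>n. p (intvec (k n) + v l) / of_real (real (Suc n)) ^ N) \<longlonglongrightarrow> h N x" for l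
        by (simp add: Suc.prems del: of_nat_Suc sum.lessThan_Suc)
      then have "(\<lambda>n. \<Sum>l\<in>L. \<alpha> l * (p (intvec (k n) + v l) / of_real (real (Suc n)) ^ N)) \<longlonglongrightarrow> (\<Sum>l\<in>L. \<alpha> l * h N x)"
        by (intro tendsto_intros)
      also have "(\<lambda>n. \<Sum>l\<in>L. \<alpha> l * (p (intvec (k n) + v l) / of_real (real (Suc n)) ^ N)) = (\<lambda>n. 0)"
        using assms(3) by (simp add: sum_divide_distrib[symmetric] del: of_nat_Suc)
      finally have "(\<Sum>l\<in>L. \<alpha> l * h N x) = 0" by (rule LIMSEQ_unique[OF _ tendsto_const])
      then show ?thesis using assms(2) by (simp flip: sum_distrib_right)
    qed
    with Suc show ?case by simp
  qed simp
qed

lemma polys_eq_0_on_lattice: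
  fixes p :: "real^'n \<Rightarrow> 'a::real_normed_field" and M :: "real^'n^'n"
  assumes p: "p \<in> polys" and M: "invertible M" and zero: "\<And>k. p (M *v intvec k + h) = 0"
  shows "p = (\<lambda>x. 0)"
proof -
  obtain M' where M': "M ** M' = mat 1" using M by (auto simp: invertible_def)
  have "(\<lambda>x. p (M *v x + h)) = (\<lambda>x. 0)"
    by (rule polys_eq_0_of_difference[where \<alpha> = "\<lambda>_. 1" and L = "{0::nat}" and v = "\<lambda>_. 0"])
      (simp_all add: polys_affine[OF p] zero)
  then have "p (M *v (M' *v (x - h)) + h) = 0" for x by (rule fun_cong)
  then show ?thesis by (auto simp: matrix_vector_mul_assoc M')
qed

subsection \<open>Finite-dimensional spaces of functions\<close>

definition fspan :: "('b \<Rightarrow> real) set \<Rightarrow> ('b \<Rightarrow> real) set" where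
  "fspan F = range (\<lambda>c x. \<Sum>g\<in>F. c g * g x)"

definition fsubspace :: "('b \<Rightarrow> real) set \<Rightarrow> bool" where
  "fsubspace V \<longleftrightarrow> (\<lambda>x. 0) \<in> V \<and> (\<forall>p\<in>V. \<forall>q\<in>V. (\<lambda>x. p x + q x) \<in> V) \<and> (\<forall>p\<in>V. \<forall>c. (\<lambda>x. c * p x) \<in> V)"

lemma fsubspace_add: "fsubspace V \<Longrightarrow> p \<in> V \<Longrightarrow> q \<in> V \<Longrightarrow> (\<lambda>x. p x + q x) \<in> V"
  and fsubspace_cmult: "fsubspace V \<Longrightarrow> p \<in> V \<Longrightarrow> (\<lambda>x. c * p x) \<in> V"
  by (simp_all add: fsubspace_def)

lemma fsubspace_diff: "fsubspace V \<Longrightarrow> p \<in> V \<Longrightarrow> q \<in> V \<Longrightarrow> (\<lambda>x. p x - c * q x) \<in> V"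
  using fsubspace_add[OF _ _ fsubspace_cmult[of V q "- c"], of p] by simp

lemma fsubspace_sum: "fsubspace V \<Longrightarrow> (\<And>i. i \<in> I \<Longrightarrow> p i \<in> V) \<Longrightarrow> (\<lambda>x. \<Sum>i\<in>I. p i x) \<in> V"
  by (induction I rule: infinite_finite_induct) (auto simp: fsubspace_def)

lemma fsubspace_fspan: "fsubspace (fspan F)"
  unfolding fsubspace_def
proof (intro conjI ballI allI)
  show "(\<lambda>x. 0) \<in> fspan F" by (auto simp: fspan_def intro!: image_eqI[of _ _ "\<lambda>g. 0"])
  fix p assume "p \<in> fspan F"
  then obtain c where c: "p = (\<lambda>x. \<Sum>g\<in>F. c g * g x)" by (auto simp: fspan_def)
  show "(\<lambda>x. a * p x) \<in> fspan F" for a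
    by (auto simp: fspan_def c sum_distrib_left mult_ac intro!: image_eqI[of _ _ "\<lambda>g. a * c g"])
  fix q assume "q \<in> fspan F"
  then obtain d where d: "q = (\<lambda>x. \<Sum>g\<in>F. d g * g x)" by (auto simp: fspan_def)
  show "(\<lambda>x. p x + q x) \<in> fspan F"
    by (auto simp: fspan_def c d sum.distrib distrib_right intro!: image_eqI[of _ _ "\<lambda>g. c g + d g"])
qed

lemma fspan_base:
  assumes "finite F" "g \<in> F" shows "g \<in> fspan F"
proof -
  have "(\<Sum>h\<in>F. of_bool (h = g) * h x) = (\<Sum>h\<in>F. if h = g then g x else 0)" for x
    by (intro sum.cong) auto
  then have eq: "g = (\<lambda>x. \<Sum>h\<in>F. of_bool (h = g) * h x)" using assms by auto
  show ?thesis by (subst eq) (auto simp: fspan_def)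
qed

lemma fspan_subset: "fsubspace V \<Longrightarrow> F \<subseteq> V \<Longrightarrow> fspan F \<subseteq> V"
  by (auto simp: fspan_def intro!: fsubspace_sum) (auto simp: fsubspace_def)

text \<open>Finite-dimensional spaces of functions are closed under pointwise limits. In the
  induction step a fixed \<open>v\<close> in \<open>V\<close> outside the span of \<open>F\<close>
  is used to bring each P_n, less a multiple c_n v, into that span. If the c_n are bounded, a
  subsequence converges and the induction hypothesis applies to the differences.\<close>

lemma pointwise_limit_in_fsubspace:
  assumes "finite F" "V \<subseteq> fspan F" "fsubspace V" "\<And>n. P n \<in> V" "\<And>x. (\<lambda>n. P n x) \<longlonglongrightarrow> p x"
  shows "p \<in> V"
  using assms
proof (induction F arbitrary: V P p rule: finite_induct)
  case empty
  then have "P n = (\<lambda>x. 0)" for n by (auto simp: fspan_def)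
  then have "p x = 0" for x using empty.prems(4)[of x] LIMSEQ_unique[OF tendsto_const] by fastforce
  then have "p = (\<lambda>x. 0)" ..
  then show ?case using empty.prems(2) by (simp add: fsubspace_def)
next
  case (insert g F)
  have ex: "\<exists>a. (\<lambda>x. q x - a * g x) \<in> fspan F" if "q \<in> V" for q
  proof -
    have "q \<in> fspan (insert g F)" using insert.prems(1) that by blast
    then obtain c where "q = (\<lambda>x. \<Sum>g\<in>insert g F. c g * g x)" by (auto simp: fspan_def)
    then have "(\<lambda>x. q x - c g * g x) \<in> fspan F" using insert.hyps by (auto simp: fspan_def)
    then show ?thesis by blast
  qed
  show ?case
  proof (cases "V \<subseteq> fspan F")
    case True
    then show ?thesis using insert.IH insert.prems by blast
  next
    case False
    then obtain v where v: "v \<in> V" "v \<notin> fspan F" by blast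
    obtain b where b: "(\<lambda>x. v x - b * g x) \<in> fspan F" using ex[OF v(1)] by blast
    have b0: "b \<noteq> 0" using b v(2) by auto
    have "\<exists>c. (\<lambda>x. P n x - c * v x) \<in> fspan F" for n
    proof -
      obtain a where a: "(\<lambda>x. P n x - a * g x) \<in> fspan F" using ex[OF insert.prems(3)] by blast
      from fsubspace_diff[OF fsubspace_fspan this b, of "a / b"]
      have "(\<lambda>x. P n x - (a / b) * v x) \<in> fspan F" using b0 by (simp add: right_diff_distrib)
      then show ?thesis by blast
    qed
    then obtain c where c: "\<And>n. (\<lambda>x. P n x - c n * v x) \<in> fspan F" by metis
    define V' where "V' = V \<inter> fspan F"
    have V': "fsubspace V'" "V' \<subseteq> fspan F"
      using insert.prems(2) fsubspace_fspan[of F] unfolding V'_def fsubspace_def by auto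
    have PV: "(\<lambda>x. P n x - c n * v x) \<in> V'" for n
      unfolding V'_def using c fsubspace_diff[OF insert.prems(2) insert.prems(3) v(1)] by blast
    show ?thesis
    proof (cases "bounded (range c)")
      case True
      then obtain l r where lr: "strict_mono r" "(c \<circ> r) \<longlonglongrightarrow> l"
        using bounded_imp_convergent_subsequence[of c] by blast
      have "(\<lambda>x. p x - l * v x) \<in> V'"
      proof (rule insert.IH[OF V'(2,1), where P = "\<lambda>n x. P (r n) x - c (r n) * v x"])
        show "(\<lambda>n. P (r n) x - c (r n) * v x) \<longlonglongrightarrow> p x - l * v x" for x
          using lr LIMSEQ_subseq_LIMSEQ[OF insert.prems(4) lr(1)]
          by (intro tendsto_intros) (auto simp: o_def)
      qed (rule PV)
      then have "(\<lambda>x. p x - l * v x) \<in> V" by (simp add: V'_def)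
      from fsubspace_diff[OF insert.prems(2) this v(1), of "- l"] show ?thesis by simp
    next
      case False
      \<comment> \<open>With unbounded coefficients, dividing the differences by -c_n gives
        functions in the smaller space that converge to \<open>v\<close>, because the P_n are
        pointwise bounded. This contradicts the choice of \<open>v\<close>.\<close>
      then have "\<forall>k. \<exists>n. \<bar>c n\<bar> > real (Suc k)" by (auto simp: bounded_iff not_le)
      then obtain s where s: "\<And>k. \<bar>c (s k)\<bar> > real (Suc k)" by metis
      have s0: "c (s k) \<noteq> 0" for k using s[of k] by auto
      have "v \<in> V'"
      proof (rule insert.IH[OF V'(2,1), where P = "\<lambda>k x. (- 1 / c (s k)) * (P (s k) x - c (s k) * v x)"])
        show "(\<lambda>x. (- 1 / c (s k)) * (P (s k) x - c (s k) * v x)) \<in> V'" for k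
          by (rule fsubspace_cmult[OF V'(1) PV])
        fix x
        have "Bseq (\<lambda>n. P n x)" by (rule convergent_imp_Bseq[OF convergentI[OF insert.prems(4)]])
        then obtain K where K: "\<And>n. norm (P n x) \<le> K" by (rule BseqE) blast
        have "(\<lambda>k. P (s k) x * (1 / c (s k))) \<longlonglongrightarrow> 0"
        proof (rule Lim_null_comparison[where g = "\<lambda>k. K * inverse (real (Suc k))"])
          show "\<forall>\<^sub>F k in sequentially. norm (P (s k) x * (1 / c (s k))) \<le> K * inverse (real (Suc k))"
            unfolding norm_mult
          proof (intro always_eventually allI mult_mono K)
            show "norm (1 / c (s k)) \<le> inverse (real (Suc k))" for k
              using s[of k] by (simp add: inverse_eq_divide frac_le del: of_nat_Suc)
            show "0 \<le> K" using K[of 0] norm_ge_zero order_trans by blast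
          qed simp
          show "(\<lambda>k. K * inverse (real (Suc k))) \<longlonglongrightarrow> 0"
            by (intro tendsto_mult_right_zero LIMSEQ_inverse_real_of_nat)
        qed
        then have "(\<lambda>k. v x - P (s k) x * (1 / c (s k))) \<longlonglongrightarrow> v x - 0" by (intro tendsto_intros)
        moreover have "(- 1 / c (s k)) * (P (s k) x - c (s k) * v x) = v x - P (s k) x * (1 / c (s k))" for k
          using s0[of k] by (simp add: field_simps)
        ultimately show "(\<lambda>k. (- 1 / c (s k)) * (P (s k) x - c (s k) * v x)) \<longlonglongrightarrow> v x" by simp
      qed
      then show ?thesis using v(2) by (simp add: V'_def)
    qed
  qed
qed

lemma hpoly_finite_span: "\<exists>F :: (real^'n \<Rightarrow> real) set. finite F \<and> hpoly j \<subseteq> fspan F"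
proof (induction j)
  case 0
  have "(\<lambda>x. c) \<in> fspan {\<lambda>x. 1}" for c :: real by (auto simp: fspan_def intro!: image_eqI[of _ _ "\<lambda>g. c"])
  then show ?case by (intro exI[of _ "{\<lambda>x. 1}"]) auto
next
  case (Suc j)
  then obtain F :: "(real^'n \<Rightarrow> real) set" where F: "finite F" "hpoly j \<subseteq> fspan F" by blast
  define F' where "F' = (\<lambda>(i, g) x. x $ i * g x) ` (UNIV \<times> F)"
  have F': "finite F'" using F by (simp add: F'_def)
  have "(\<lambda>x. x $ i * p x) \<in> fspan F'" if p: "p \<in> hpoly j" for p :: "real^'n \<Rightarrow> real" and i
  proof -
    obtain c where c: "p = (\<lambda>x. \<Sum>g\<in>F. c g * g x)" using F(2) p unfolding fspan_def by blast
    have "(\<lambda>x. c g * (x $ i * g x)) \<in> fspan F'" if "g \<in> F" for g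
    proof -
      have "(\<lambda>x. x $ i * g x) \<in> F'" using that by (force simp: F'_def)
      then have "(\<lambda>x. x $ i * g x) \<in> fspan F'" by (rule fspan_base[OF F'])
      then show ?thesis by (rule fsubspace_cmult[OF fsubspace_fspan])
    qed
    then have "(\<lambda>x. \<Sum>g\<in>F. c g * (x $ i * g x)) \<in> fspan F'" by (intro fsubspace_sum fsubspace_fspan)
    then show ?thesis by (simp add: c sum_distrib_left mult_ac)
  qed
  then have "hpoly (Suc j) \<subseteq> fspan F'" by (auto intro!: fsubspace_sum fsubspace_fspan)
  with F' show ?case by blast
qed

lemma hpoly_sums_finite_span:
  "\<exists>F. finite F \<and> (\<forall>h. (\<forall>j. h j \<in> hpoly j) \<longrightarrow> (\<lambda>x :: real^'n. \<Sum>j<N. h j x) \<in> fspan F)"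
proof -
  obtain F :: "nat \<Rightarrow> (real^'n \<Rightarrow> real) set"
    where F: "\<And>j. finite (F j)" "\<And>j. hpoly j \<subseteq> fspan (F j)" using hpoly_finite_span by metis
  let ?F = "\<Union>j<N. F j"
  have fin: "finite ?F" using F by simp
  have "fspan (F j) \<subseteq> fspan ?F" if "j < N" for j
    using that fspan_base[OF fin] by (intro fspan_subset fsubspace_fspan) auto
  then have "h j \<in> fspan ?F" if "\<forall>j. h j \<in> hpoly j" "j \<in> {..<N}" for h j
    using that F(2)[of j] by blast
  then have "(\<lambda>x. \<Sum>j<N. h j x) \<in> fspan ?F" if "\<forall>j. h j \<in> hpoly j" for h
    using that by (intro fsubspace_sum fsubspace_fspan)
  with fin show ?thesis by blast
qed

section \<open>Trigonometric polynomials and difference operators\<close>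

text \<open>A list of terms rather than a function: the same list is read as a trigonometric
  polynomial by \<open>teval\<close>, as a difference operator on functions by
  \<open>diff_op\<close>, and as a filter on sequences by \<open>tfilter\<close>.\<close>

type_synonym 'n trig = "(complex \<times> (int, 'n) vec) list"

definition teval :: "'n::finite trig \<Rightarrow> real^'n \<Rightarrow> complex" where
  "teval L \<zeta> = (\<Sum>(c, j)\<leftarrow>L. c * cis (- (\<zeta> \<bullet> intvec j)))"

definition diff_op :: "'n::finite trig \<Rightarrow> (real^'n \<Rightarrow> complex) \<Rightarrow> real^'n \<Rightarrow> complex" where
  "diff_op L p x = (\<Sum>(c, j)\<leftarrow>L. c * p (x - intvec j))"

definition tmul :: "'n::finite trig \<Rightarrow> 'n trig \<Rightarrow> 'n trig" where
  "tmul L M = concat (map (\<lambda>(c, j). map (\<lambda>(d, k). (c * d, j + k)) M) L)"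

text \<open>Translation of the symbol by 2 pi s, carried out on the coefficients so that the
  operator belonging to the translated symbol is available.\<close>

definition twist :: "real^'n \<Rightarrow> 'n::finite trig \<Rightarrow> 'n trig" where
  "twist s L = map (\<lambda>(c, j). (c * cis (- (2 * pi * (s \<bullet> intvec j))), j)) L"

lemma teval_simps [simp]:
  "teval [] \<zeta> = 0"
  "teval ((c, j) # L) \<zeta> = c * cis (- (\<zeta> \<bullet> intvec j)) + teval L \<zeta>"
  "teval (L @ M) \<zeta> = teval L \<zeta> + teval M \<zeta>"
  by (simp_all add: teval_def)

lemma diff_op_simps [simp]:
  "diff_op [] p x = 0"
  "diff_op ((c, j) # L) p x = c * p (x - intvec j) + diff_op L p x"
  "diff_op (L @ M) p x = diff_op L p x + diff_op M p x"
  by (simp_all add: diff_op_def)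

lemma tmul_simps [simp]:
  "tmul [] M = []"
  "tmul ((c, j) # L) M = map (\<lambda>(d, k). (c * d, j + k)) M @ tmul L M"
  by (simp_all add: tmul_def)

lemma twist_simps [simp]:
  "twist s [] = []"
  "twist s ((c, j) # L) = (c * cis (- (2 * pi * (s \<bullet> intvec j))), j) # twist s L"
  "twist s (L @ M) = twist s L @ twist s M"
  by (simp_all add: twist_def)

lemma cis_minus_add: "cis (- (a + b)) = cis (- a) * cis (- b)"
  by (simp add: cis_mult)

lemma teval_map_mult: "teval (map (\<lambda>(d, k). (c * d, j + k)) M) \<zeta> = c * cis (- (\<zeta> \<bullet> intvec j)) * teval M \<zeta>"
  by (induction M) (auto simp: intvec_add inner_add_right cis_minus_add algebra_simps simp del: minus_add_distrib)

lemma diff_op_map_mult: "diff_op (map (\<lambda>(d, k). (c * d, j + k)) M) p x = c * diff_op M p (x - intvec j)"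
  by (induction M) (auto simp: intvec_add algebra_simps)

lemma teval_tmul: "teval (tmul L M) \<zeta> = teval L \<zeta> * teval M \<zeta>"
  by (induction L) (auto simp: teval_map_mult algebra_simps)

lemma diff_op_tmul: "diff_op (tmul L M) p x = diff_op L (diff_op M p) x"
  by (induction L) (auto simp: diff_op_map_mult)

lemma diff_op_tmul': "diff_op (tmul L M) p = diff_op L (diff_op M p)"
  by (rule ext) (rule diff_op_tmul)

lemma diff_op_one [simp]: "diff_op [(1, 0)] p = p"
  by (simp add: fun_eq_iff)

lemma twist_map_mult:
  "twist s (map (\<lambda>(d, k). (c * d, j + k)) M) =
   map (\<lambda>(d, k). (c * cis (- (2 * pi * (s \<bullet> intvec j))) * d, j + k)) (twist s M)"
  by (induction M) (auto simp: intvec_add inner_add_right distrib_left cis_minus_add algebra_simps simp del: minus_add_distrib)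

lemma twist_tmul: "twist s (tmul L M) = tmul (twist s L) (twist s M)"
  by (induction L) (auto simp: twist_map_mult)

lemma teval_twist: "teval (twist s L) \<zeta> = teval L (\<zeta> + (2 * pi) *\<^sub>R s)"
  by (induction L) (auto simp: inner_add_left cis_minus_add simp del: minus_add_distrib)

lemma diff_op_add: "diff_op L (\<lambda>x. p x + q x) x = diff_op L p x + diff_op L q x"
  and diff_op_cmult: "diff_op L (\<lambda>x. c * p x) x = c * diff_op L p x"
  by (induction L) (auto simp: algebra_simps)

lemma diff_op_shift: "diff_op L (\<lambda>x. p (x - h)) x = diff_op L p (x - h)"
  by (induction L) (auto simp: algebra_simps)

lemma diff_op_commute: "diff_op L (diff_op M p) x = diff_op M (diff_op L p) x"
proof (induction L)
  case Nil
  then show ?case by (induction M) auto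
next
  case (Cons a L)
  obtain c j where a: "a = (c, j)" by (cases a)
  have eq: "diff_op (a # L) p = (\<lambda>x. c * p (x - intvec j) + diff_op L p x)" by (simp add: a fun_eq_iff)
  show ?case unfolding eq using Cons by (simp add: a diff_op_add diff_op_cmult diff_op_shift)
qed

lemma polys_diff_op: "p \<in> polys \<Longrightarrow> diff_op L p \<in> polys"
proof (induction L)
  case Nil
  have "diff_op [] p = (\<lambda>x. 0)" by (simp add: fun_eq_iff)
  then show ?case by (simp add: polys.const)
next
  case (Cons a L)
  obtain c j where a: "a = (c, j)" by (cases a)
  have eq: "diff_op (a # L) p = (\<lambda>x. c * p (x + - intvec j) + diff_op L p x)" by (simp add: a fun_eq_iff)
  show ?case unfolding eq using Cons by (intro polys.add polys_cmult polys_shift)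
qed

text \<open>The value of the symbol at 0 is the sum of the coefficients, which is the quantity in
  \<open>polys_eq_0_of_difference\<close>.\<close>

lemma diff_op_inj:
  assumes "p \<in> polys" "teval L 0 \<noteq> 0" "\<And>k. diff_op L p (intvec k) = 0"
  shows "p = (\<lambda>x. 0)"
proof (rule polys_eq_0_of_difference[OF assms(1), where L = "{..<length L}"
      and \<alpha> = "\<lambda>i. fst (L ! i)" and v = "\<lambda>i. - intvec (snd (L ! i))"])
  show "(\<Sum>i<length L. fst (L ! i)) \<noteq> 0"
    using assms(2) by (simp add: teval_def split_beta sum_list_sum_nth atLeast0LessThan)
  show "(\<Sum>i<length L. fst (L ! i) * p (intvec k + - intvec (snd (L ! i)))) = 0" for k
    using assms(3)[of k] by (simp add: diff_op_def split_beta sum_list_sum_nth atLeast0LessThan)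
qed

lemma teval_periodic: "teval L (\<zeta> + (2 * pi) *\<^sub>R intvec k) = teval L \<zeta>"
proof (induction L)
  case (Cons a L)
  obtain c j where a: "a = (c, j)" by (cases a)
  have "intvec k \<bullet> intvec j = of_int (\<Sum>i\<in>UNIV. k $ i * j $ i)" by (simp add: inner_vec_def)
  then have "2 * pi * (intvec k \<bullet> intvec j) = of_int (\<Sum>i\<in>UNIV. k $ i * j $ i) * (2 * pi)" by simp
  moreover have "cis (- (of_int n * (2 * pi))) = 1" for n
    using cis_multiple_2pi[of "of_int (- n)"] by (simp add: mult_ac)
  ultimately have "cis (- (2 * pi * (intvec k \<bullet> intvec j))) = 1" by metis
  with Cons show ?case by (simp add: a inner_add_left cis_minus_add del: minus_add_distrib)
qed simp

lemma twist_integral: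
  assumes "\<And>i. s $ i \<in> \<int>" shows "twist s L = L"
proof -
  obtain k where k: "s = intvec k" using intvec_surj assms by blast
  have "cis (- (2 * pi * (s \<bullet> intvec j))) = 1" for j
    using teval_periodic[of "[(1, j)]" 0 k] by (simp add: k)
  then show ?thesis by (induction L) auto
qed

lemma norm_teval_diff_le: "\<exists>C\<ge>0. \<forall>\<zeta>. norm (teval L \<zeta> - teval L 0) \<le> C * norm \<zeta>"
proof (induction L)
  case (Cons a L)
  then obtain C where C: "C \<ge> 0" "\<And>\<zeta>. norm (teval L \<zeta> - teval L 0) \<le> C * norm \<zeta>" by blast
  obtain c j where a: "a = (c, j)" by (cases a)
  have "norm (teval (a # L) \<zeta> - teval (a # L) 0) \<le> (norm c * norm (intvec j) + C) * norm \<zeta>" for \<zeta>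
  proof -
    have "norm (cis (- (\<zeta> \<bullet> intvec j)) - 1) \<le> \<bar>\<zeta> \<bullet> intvec j\<bar>"
      using iexp_approx1[of "- (\<zeta> \<bullet> intvec j)" 0] by (simp add: cis_conv_exp)
    also have "\<dots> \<le> norm \<zeta> * norm (intvec j)" by (rule Cauchy_Schwarz_ineq2)
    finally have "norm c * norm (cis (- (\<zeta> \<bullet> intvec j)) - 1) \<le> norm c * (norm \<zeta> * norm (intvec j))"
      by (intro mult_left_mono) auto
    moreover have "teval (a # L) \<zeta> - teval (a # L) 0 = c * (cis (- (\<zeta> \<bullet> intvec j)) - 1) + (teval L \<zeta> - teval L 0)"
      by (simp add: a algebra_simps)
    ultimately have "norm (teval (a # L) \<zeta> - teval (a # L) 0) \<le> norm c * (norm \<zeta> * norm (intvec j)) + C * norm \<zeta>"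
      using C(2)[of \<zeta>] norm_triangle_ineq[of "c * (cis (- (\<zeta> \<bullet> intvec j)) - 1)" "teval L \<zeta> - teval L 0"]
      by (simp only: norm_mult)
    then show ?thesis by (simp add: algebra_simps)
  qed
  then show ?case using C(1) by (intro exI[of _ "norm c * norm (intvec j) + C"]) auto
qed auto

lemma continuous_on_teval: "continuous_on S (teval L)"
proof (induction L)
  case (Cons a L)
  obtain c j where a: "a = (c, j)" by (cases a)
  have eq: "teval (a # L) = (\<lambda>\<zeta>. c * cis (- (\<zeta> \<bullet> intvec j)) + teval L \<zeta>)" by (simp add: a fun_eq_iff)
  show ?case unfolding eq cis_conv_exp by (intro continuous_intros Cons)
qed (simp add: teval_def[abs_def])

section \<open>Powers, products and real coefficients of symbols\<close>

primrec tpow :: "'n::finite trig \<Rightarrow> nat \<Rightarrow> 'n trig" where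
  "tpow L 0 = [(1, 0)]"
| "tpow L (Suc m) = tmul L (tpow L m)"

lemma teval_tpow: "teval (tpow L m) \<zeta> = teval L \<zeta> ^ m"
  by (induction m) (simp_all add: teval_tmul)

lemma twist_tpow: "twist s (tpow L m) = tpow (twist s L) m"
  by (induction m) (simp_all add: twist_tmul)

lemma diff_op_tpow: "diff_op (tpow L m) p = (diff_op L ^^ m) p"
  by (induction m) (simp_all add: diff_op_tmul')

lemma diff_op_tpow_tmul:
  "diff_op (tpow (tmul L M) m) p = diff_op (tpow L m) (diff_op (tpow M m) p)"
proof (induction m)
  case (Suc m)
  have "diff_op (tpow (tmul L M) (Suc m)) p = diff_op L (diff_op M (diff_op (tpow L m) (diff_op (tpow M m) p)))"
    by (simp add: diff_op_tmul' Suc)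
  also have "diff_op M (diff_op (tpow L m) (diff_op (tpow M m) p)) = diff_op (tpow L m) (diff_op M (diff_op (tpow M m) p))"
    by (rule ext) (rule diff_op_commute)
  finally show ?case by (simp add: diff_op_tmul')
qed simp

definition tprod :: "'n::finite trig list \<Rightarrow> 'n trig" where
  "tprod Ls = foldr tmul Ls [(1, 0)]"

lemma tprod_simps [simp]: "tprod [] = [(1, 0)]" "tprod (L # Ls) = tmul L (tprod Ls)"
  by (simp_all add: tprod_def)

lemma teval_tprod: "teval (tprod Ls) \<zeta> = (\<Prod>L\<leftarrow>Ls. teval L \<zeta>)"
  by (induction Ls) (simp_all add: teval_tmul)

lemma twist_tprod: "twist s (tprod Ls) = tprod (map (twist s) Ls)"
  by (induction Ls) (simp_all add: twist_tmul)

text \<open>Taking real parts of the coefficients and averaging over j and -j leaves a cosine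
  polynomial. It agrees with the real part of the given symbol averaged over \<zeta> and -\<zeta>,
  hence with \<open>T\<close>. Reproduced polynomials are combinations with real coefficients, which
  is why this form is sought.\<close>

lemma even_teval_real_coeffs:
  assumes "\<And>\<zeta>. teval L \<zeta> = of_real (T \<zeta>)" "\<And>\<zeta>. T (- \<zeta>) = T \<zeta>"
  obtains L' where "\<And>\<zeta>. teval (map (\<lambda>(c, j). (of_real c, j)) L') \<zeta> = of_real (T \<zeta>)"
proof -
  define M where "M = map (\<lambda>(c, j). (Re c / 2, j)) L @ map (\<lambda>(c, j). (Re c / 2, - j)) L"
  have "teval (map (\<lambda>(c, j). (of_real c, j)) M) \<zeta> = of_real ((Re (teval L \<zeta>) + Re (teval L (- \<zeta>))) / 2)" for \<zeta>
    unfolding M_def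
    by (induction L) (auto simp: complex_eq_iff intvec_minus field_simps)
  with assms that[of M] show ?thesis by simp
qed

text \<open>Hides the term list, so that a symbol and its operator can be built up in parallel from
  sums and products.\<close>

definition symbol_of :: "(real^'n \<Rightarrow> complex) \<Rightarrow> ((real^'n \<Rightarrow> complex) \<Rightarrow> real^'n \<Rightarrow> complex) \<Rightarrow> bool" where
  "symbol_of T D \<longleftrightarrow> (\<exists>L. teval L = T \<and> diff_op L = D)"

lemma symbol_of_shift: "symbol_of (\<lambda>\<zeta>. cis (- (\<zeta> \<bullet> intvec j))) (\<lambda>p x. p (x - intvec j))"
  unfolding symbol_of_def by (intro exI[of _ "[(1, j)]"]) (simp add: fun_eq_iff)

lemma symbol_of_add: "symbol_of T D \<Longrightarrow> symbol_of T' D' \<Longrightarrow> symbol_of (\<lambda>\<zeta>. T \<zeta> + T' \<zeta>) (\<lambda>p x. D p x + D' p x)"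
  unfolding symbol_of_def
proof (elim exE conjE, goal_cases)
  case (1 L L')
  then show ?case by (intro exI[of _ "L @ L'"]) (auto simp: fun_eq_iff)
qed

lemma symbol_of_mult: "symbol_of T D \<Longrightarrow> symbol_of T' D' \<Longrightarrow> symbol_of (\<lambda>\<zeta>. T \<zeta> * T' \<zeta>) (\<lambda>p. D (D' p))"
  unfolding symbol_of_def
proof (elim exE conjE, goal_cases)
  case (1 L L')
  then show ?case by (intro exI[of _ "tmul L L'"] conjI ext) (auto simp: teval_tmul diff_op_tmul)
qed

lemma symbol_of_const: "symbol_of (\<lambda>\<zeta>. c) (\<lambda>p x. c * p x)"
  unfolding symbol_of_def by (intro exI[of _ "[(c, 0)]"]) (simp add: fun_eq_iff)

lemma symbol_of_cmult: "symbol_of T D \<Longrightarrow> symbol_of (\<lambda>\<zeta>. c * T \<zeta>) (\<lambda>p x. c * D p x)"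
  using symbol_of_mult[OF symbol_of_const[of c], of T D] by simp

lemma symbol_of_sum:
  assumes "\<And>i. i \<in> I \<Longrightarrow> symbol_of (T i) (D i)"
  shows "symbol_of (\<lambda>\<zeta>. \<Sum>i\<in>I. T i \<zeta>) (\<lambda>p x. \<Sum>i\<in>I. D i p x)"
  using assms
proof (induction I rule: infinite_finite_induct)
  case (insert i I)
  then show ?case using symbol_of_add[of "T i" "D i"] by simp
qed (use symbol_of_const[of 0] in simp_all)

section \<open>The elliptic mask\<close>

definition unit_int :: "'n::finite \<Rightarrow> int^'n" where
  "unit_int i = (\<chi> k. if k = i then 1 else 0)"

lemma intvec_unit: "intvec (unit_int i) = axis i 1"
  by (simp add: vec_eq_iff unit_int_def axis_def)

definition second_diff :: "real^'n \<Rightarrow> (real^'n \<Rightarrow> complex) \<Rightarrow> real^'n \<Rightarrow> complex" where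
  "second_diff v p x = 2 * p x - p (x - v) - p (x + v)"

definition central_diff :: "real^'n \<Rightarrow> (real^'n \<Rightarrow> complex) \<Rightarrow> real^'n \<Rightarrow> complex" where
  "central_diff v p x = p (x + v) - p (x - v)"

text \<open>For t = 1 this is the operator with symbol G; general t is kept for the limit t
  \<rightarrow> 0. The factor -1/2 converts the symbol (2i sin \<zeta>_i)(2i sin \<zeta>_j) of two
  central differences into 2 sin \<zeta>_i sin \<zeta>_j.\<close>

definition elliptic_diff ::
    "real^('n::{finite,linorder})^('n::{finite,linorder}) \<Rightarrow> real
       \<Rightarrow> (real^('n::{finite,linorder}) \<Rightarrow> complex) \<Rightarrow> real^('n::{finite,linorder}) \<Rightarrow> complex" where
  "elliptic_diff Q t p x =
     (\<Sum>i\<in>UNIV. of_real ((Q ** Q) $ i $ i) * second_diff (axis i t) p x)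
     + (\<Sum>(i, j)\<in>{(i, j). i < j}. of_real (- (Q ** Q) $ i $ j / 2) * central_diff (axis i t) (central_diff (axis j t) p) x)"

lemma symbol_second_diff: "symbol_of (\<lambda>\<zeta>. of_real (4 * (sin (\<zeta> $ i / 2))\<^sup>2)) (second_diff (axis i 1))"
proof -
  have "symbol_of (\<lambda>\<zeta>. 2 + (- 1 * cis (- (\<zeta> \<bullet> intvec (unit_int i))) + - 1 * cis (- (\<zeta> \<bullet> intvec (- unit_int i)))))
    (\<lambda>p x. 2 * p x + (- 1 * p (x - intvec (unit_int i)) + - 1 * p (x - intvec (- unit_int i))))"
    by (intro symbol_of_add symbol_of_const symbol_of_cmult symbol_of_shift)
  moreover have "(\<lambda>\<zeta>. 2 + (- 1 * cis (- (\<zeta> \<bullet> intvec (unit_int i))) + - 1 * cis (- (\<zeta> \<bullet> intvec (- unit_int i)))))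
    = (\<lambda>\<zeta>. of_real (4 * (sin (\<zeta> $ i / 2))\<^sup>2))"
  proof
    fix \<zeta> :: "real^'a"
    show "2 + (- 1 * cis (- (\<zeta> \<bullet> intvec (unit_int i))) + - 1 * cis (- (\<zeta> \<bullet> intvec (- unit_int i))))
      = of_real (4 * (sin (\<zeta> $ i / 2))\<^sup>2)"
      using cos_double_sin[of "\<zeta> $ i / 2"] by (simp add: complex_eq_iff intvec_minus intvec_unit inner_axis)
  qed
  moreover have "(\<lambda>p x. 2 * p x + (- 1 * p (x - intvec (unit_int i)) + - 1 * p (x - intvec (- unit_int i)))) = second_diff (axis i 1)"
    by (simp add: intvec_minus intvec_unit second_diff_def fun_eq_iff)
  ultimately show ?thesis by (simp only:)
qed

lemma symbol_central_diff: "symbol_of (\<lambda>\<zeta>. 2 * \<i> * of_real (sin (\<zeta> $ i))) (central_diff (axis i 1))"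
proof -
  have "symbol_of (\<lambda>\<zeta>. cis (- (\<zeta> \<bullet> intvec (- unit_int i))) + - 1 * cis (- (\<zeta> \<bullet> intvec (unit_int i))))
    (\<lambda>p x. p (x - intvec (- unit_int i)) + - 1 * p (x - intvec (unit_int i)))"
    by (intro symbol_of_add symbol_of_const symbol_of_cmult symbol_of_shift)
  moreover have "cis (- (\<zeta> \<bullet> intvec (- unit_int i))) + - 1 * cis (- (\<zeta> \<bullet> intvec (unit_int i)))
    = 2 * \<i> * of_real (sin (\<zeta> $ i))" for \<zeta>
    by (simp add: complex_eq_iff intvec_minus intvec_unit inner_axis)
  ultimately show ?thesis
    by (simp add: intvec_minus intvec_unit central_diff_def[abs_def])
qed

lemma symbol_elliptic_G: "symbol_of (\<lambda>\<zeta>. of_real (elliptic_G Q \<zeta>)) (elliptic_diff Q 1)"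
proof -
  have eq: "complex_of_real (elliptic_G Q \<zeta>) =
     (\<Sum>i\<in>UNIV. of_real ((Q ** Q) $ i $ i) * of_real (4 * (sin (\<zeta> $ i / 2))\<^sup>2))
     + (\<Sum>p\<in>{(i, j). i < j}. of_real (- (Q ** Q) $ fst p $ snd p / 2)
         * ((2 * \<i> * of_real (sin (\<zeta> $ fst p))) * (2 * \<i> * of_real (sin (\<zeta> $ snd p)))))" for \<zeta>
    by (simp add: elliptic_G_def split_beta sum_distrib_left mult_ac)
  have "symbol_of (\<lambda>\<zeta>. complex_of_real (elliptic_G Q \<zeta>)) (\<lambda>p x.
     (\<Sum>i\<in>UNIV. of_real ((Q ** Q) $ i $ i) * second_diff (axis i 1) p x)
     + (\<Sum>r\<in>{(i, j). i < j}. of_real (- (Q ** Q) $ fst r $ snd r / 2) * central_diff (axis (fst r) 1) (central_diff (axis (snd r) 1) p) x))"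
    unfolding eq
    by (intro symbol_of_add symbol_of_sum symbol_of_cmult symbol_of_mult symbol_second_diff symbol_central_diff)
  then show ?thesis by (simp add: elliptic_diff_def[abs_def] split_beta)
qed

lemma elliptic_G_even: "elliptic_G Q (- \<zeta>) = elliptic_G Q \<zeta>"
  by (simp add: elliptic_G_def)

lemma symmetric_inner_square:
  fixes Q :: "real^'n^'n"
  assumes "transpose Q = Q"
  shows "(Q *v x) \<bullet> (Q *v y) = x \<bullet> ((Q ** Q) *v y)"
proof -
  have "Q *v x = x v* Q" using transpose_matrix_vector[of Q x] assms by simp
  then show ?thesis
    using dot_lmul_matrix[of x Q "Q *v y"] by (simp only: matrix_vector_mul_assoc)
qed

text \<open>The identity 4 sin^2(x/2) = 4 sin^4(x/2) + sin^2 x splits the diagonal terms. The sin^2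
  parts complete the mixed terms to the form W at the vector of sines, which exhibits G as a sum of
  nonnegative terms.\<close>

lemma elliptic_G_eq:
  fixes Q :: "real^('n::{finite,linorder})^('n::{finite,linorder})"
  assumes "transpose Q = Q"
  shows "elliptic_G Q \<xi> = 4 * (\<Sum>i\<in>UNIV. (Q ** Q) $ i $ i * sin (\<xi> $ i / 2) ^ 4) + (norm (Q *v (\<chi> i. sin (\<xi> $ i))))\<^sup>2"
proof -
  let ?M = "Q ** Q" and ?t = "\<chi> i. sin (\<xi> $ i)"
  let ?f = "\<lambda>(i, j). ?M $ i $ j * sin (\<xi> $ i) * sin (\<xi> $ j)"
  have sym: "?M $ i $ j = ?M $ j $ i" for i j
  proof -
    have "transpose ?M = ?M" by (simp add: matrix_transpose_mul assms)
    moreover have "transpose ?M $ i $ j = ?M $ j $ i" by (simp add: transpose_def)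
    ultimately show ?thesis by simp
  qed
  have "(norm (Q *v ?t))\<^sup>2 = ?t \<bullet> (?M *v ?t)"
    by (simp only: power2_norm_eq_inner symmetric_inner_square[OF assms])
  also have "\<dots> = (\<Sum>p\<in>UNIV. ?f p)"
    by (simp add: inner_vec_def matrix_vector_mult_def sum_distrib_left mult_ac sum.cartesian_product UNIV_Times_UNIV[symmetric]
        del: UNIV_Times_UNIV)
  also have "(UNIV :: ('n \<times> 'n) set) = {(i, j). i = j} \<union> ({(i, j). i < j} \<union> {(i, j). j < i})" by auto
  also have "sum ?f \<dots> = sum ?f {(i, j). i = j} + (sum ?f {(i, j). i < j} + sum ?f {(i, j). j < i})"
    by (subst sum.union_disjoint; (subst sum.union_disjoint)?) auto
  also have "sum ?f {(i, j). j < i} = sum ?f {(i, j). i < j}"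
    by (rule sum.reindex_bij_witness[of _ prod.swap prod.swap]) (auto simp: sym mult_ac)
  also have "sum ?f {(i, j). i = j} = (\<Sum>i\<in>UNIV. ?M $ i $ i * (sin (\<xi> $ i))\<^sup>2)"
    by (rule sum.reindex_bij_witness[of _ "\<lambda>i. (i, i)" fst]) (auto simp: power2_eq_square)
  finally have N: "(norm (Q *v ?t))\<^sup>2 = (\<Sum>i\<in>UNIV. ?M $ i $ i * (sin (\<xi> $ i))\<^sup>2) + 2 * sum ?f {(i, j). i < j}"
    by simp
  have "4 * (sin (x / 2))\<^sup>2 = 4 * sin (x / 2) ^ 4 + (sin x)\<^sup>2" for x :: real
  proof -
    have sin2: "(sin x)\<^sup>2 = 4 * (sin (x / 2))\<^sup>2 * (cos (x / 2))\<^sup>2"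
      using sin_double[of "x / 2"] by (simp add: power_mult_distrib)
    have sin4: "sin (x / 2) ^ 4 = (sin (x / 2))\<^sup>2 * (sin (x / 2))\<^sup>2" by (simp flip: power_add)
    have "4 * s = 4 * (s * s) + 4 * s * (1 - s)" for s :: real by (simp add: algebra_simps)
    then show ?thesis unfolding sin4 sin2 cos_squared_eq .
  qed
  then have "4 * (\<Sum>i\<in>UNIV. ?M $ i $ i * (sin (\<xi> $ i / 2))\<^sup>2)
    = 4 * (\<Sum>i\<in>UNIV. ?M $ i $ i * sin (\<xi> $ i / 2) ^ 4) + (\<Sum>i\<in>UNIV. ?M $ i $ i * (sin (\<xi> $ i))\<^sup>2)"
    unfolding sum_distrib_left sum.distrib[symmetric] mult.left_commute[of 4] distrib_left[symmetric] by simp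
  with N show ?thesis by (simp add: elliptic_G_def split_beta)
qed

text \<open>The diagonal entries of Q^2 are positive, so the quartic term of a non-integral
  coordinate is strictly positive while all the others are nonnegative.\<close>

lemma elliptic_G_nonzero:
  fixes Q :: "real^('n::{finite,linorder})^('n::{finite,linorder})"
  assumes Q: "sym_pos_def Q" and i: "s $ i \<notin> \<int>"
  shows "elliptic_G Q ((2 * pi) *\<^sub>R s) \<noteq> 0"
proof -
  have tr: "transpose Q = Q" using Q by (simp add: sym_pos_def_def)
  have diag: "(Q ** Q) $ k $ k > 0" for k
  proof -
    have "axis k (1::real) \<noteq> 0" by simp
    then have "axis k 1 \<bullet> (Q *v axis k 1) > 0" using Q by (simp add: sym_pos_def_def)
    then have "Q *v axis k 1 \<noteq> 0" by auto
    then have "(Q *v axis k 1) \<bullet> (Q *v axis k 1) > 0" by simp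
    also have "(Q *v axis k 1) \<bullet> (Q *v axis k 1) = axis k 1 \<bullet> ((Q ** Q) *v axis k 1)"
      by (rule symmetric_inner_square[OF tr])
    also have "\<dots> = (Q ** Q) $ k $ k"
      by (simp add: inner_axis' matrix_vector_mult_basis column_def)
    finally show ?thesis .
  qed
  let ?x = "(2 * pi) *\<^sub>R s"
  have "sin (?x $ i / 2) \<noteq> 0"
  proof
    assume "sin (?x $ i / 2) = 0"
    then obtain n where "?x $ i / 2 = real_of_int n * pi" by (auto simp: sin_zero_iff_int2)
    then show False using i by simp
  qed
  then have "(Q ** Q) $ i $ i * sin (?x $ i / 2) ^ 4 > 0"
    using diag by (intro mult_pos_pos) (simp_all add: zero_less_power_eq)
  then have "(\<Sum>k\<in>UNIV. (Q ** Q) $ k $ k * sin (?x $ k / 2) ^ 4) > 0"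
    using less_imp_le[OF diag] by (intro sum_pos2[of UNIV i]) (auto intro!: mult_nonneg_nonneg)
  then show ?thesis unfolding elliptic_G_eq[OF tr] by (smt (verit) zero_le_power2)
qed

section \<open>Isotropic dilation matrices\<close>

lemma det_map_of_real: "det (map_matrix complex_of_real A) = of_real (det A)"
  by (simp add: det_def)

lemma det_Ints:
  fixes M :: "real^'n^'n"
  assumes "\<And>i j. M $ i $ j \<in> \<int>" shows "det M \<in> \<int>"
  unfolding det_def by (intro Ints_sum Ints_mult Ints_prod assms) simp

lemma funpow_matrix_linear:
  fixes V :: "real^'n^'n"
  shows "((\<lambda>x. V *v x) ^^ n) (x + y) = ((\<lambda>x. V *v x) ^^ n) x + ((\<lambda>x. V *v x) ^^ n) y"
    and "((\<lambda>x. V *v x) ^^ n) (c *\<^sub>R x) = c *\<^sub>R ((\<lambda>x. V *v x) ^^ n) x"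
  by (induction n) (simp_all add: matrix_vector_right_distrib matrix_vector_mult_scaleR)

lemma orthogonal_matrix_norm:
  fixes V :: "real^'n^'n"
  assumes "orthogonal_matrix V" shows "norm (V *v x) = norm x"
proof -
  have "(V *v x) \<bullet> (V *v x) = (transpose V *v (V *v x)) \<bullet> x"
    by (simp add: transpose_matrix_vector dot_lmul_matrix)
  also have "transpose V *v (V *v x) = x"
    using assms by (simp add: matrix_vector_mul_assoc orthogonal_matrix_def)
  finally show ?thesis by (simp add: norm_eq)
qed

lemma norm_funpow_orthogonal:
  fixes V :: "real^'n^'n"
  assumes "orthogonal_matrix V" shows "norm (((\<lambda>x. V *v x) ^^ n) x) = norm x"
  by (induction n) (simp_all add: orthogonal_matrix_norm[OF assms])

text \<open>The powers of an orthogonal matrix form a relatively compact group, so the identity is a limit point.\<close>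

lemma orthogonal_powers_recur:
  fixes V :: "real^'n^'n"
  assumes V: "orthogonal_matrix V"
  obtains n where "\<And>k. n k \<ge> k" "\<And>x. (\<lambda>k. ((\<lambda>x. V *v x) ^^ n k) x) \<longlonglongrightarrow> x"
proof -
  let ?V = "\<lambda>n x. ((\<lambda>x. V *v x) ^^ n) x"
  \<comment> \<open>Row i records the image of the i-th basis vector; all rows are unit vectors, so
    the sequence is bounded.\<close>
  define X where "X = (\<lambda>n. (\<chi> i. ?V n (axis i 1)) :: real^'n^'n)"
  have "norm (X n) \<le> CARD('n)" for n
  proof -
    have "norm (X n) \<le> (\<Sum>i\<in>UNIV. norm (X n $ i))" by (simp add: norm_vec_def L2_set_le_sum)
    also have "\<dots> = CARD('n)" by (simp add: X_def norm_funpow_orthogonal[OF V])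
    finally show ?thesis .
  qed
  then have "bounded (range X)" by (auto simp: bounded_iff)
  then obtain l r where r: "strict_mono r" "(X \<circ> r) \<longlonglongrightarrow> l"
    using bounded_imp_convergent_subsequence by blast
  \<comment> \<open>If the powers with exponents a and a + d are close, the power with exponent d is
    close to the identity, since the a-th power is an isometry. Taking the two indices of the
    subsequence k apart makes d at least k.\<close>
  have "\<exists>d\<ge>k. \<forall>i. norm (?V d (axis i 1) - axis i 1) < inverse (real (Suc k))" for k
  proof -
    have "Cauchy (X \<circ> r)" using r(2) by (rule LIMSEQ_imp_Cauchy)
    then obtain M where M: "\<And>a b. a \<ge> M \<Longrightarrow> b \<ge> M \<Longrightarrow> dist ((X \<circ> r) a) ((X \<circ> r) b) < inverse (real (Suc k))"
      unfolding Cauchy_def by (metis inverse_positive_iff_positive of_nat_0_less_iff zero_less_Suc)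
    define a where "a = r M"
    define d where "d = r (M + k) - a"
    have "r M + k \<le> r (M + k)"
    proof (induction k)
      case (Suc k)
      have "r (M + k) < r (M + Suc k)" using r(1) by (simp add: strict_mono_def)
      with Suc show ?case by simp
    qed simp
    then have d: "d \<ge> k" "r (M + k) = a + d" by (simp_all add: d_def a_def)
    have "norm (?V d (axis i 1) - axis i 1) < inverse (real (Suc k))" for i
    proof -
      have "norm (?V d (axis i 1) - axis i 1) = norm (?V a (?V d (axis i 1) + (- 1) *\<^sub>R axis i 1))"
        by (simp add: norm_funpow_orthogonal[OF V])
      also have "\<dots> = norm (?V (a + d) (axis i 1) - ?V a (axis i 1))"
        by (simp only: funpow_matrix_linear funpow_add o_apply) simp
      also have "\<dots> = norm ((X (a + d) - X a) $ i)" by (simp add: X_def)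
      also have "\<dots> \<le> norm (X (a + d) - X a)" by (rule Finite_Cartesian_Product.norm_nth_le)
      also have "\<dots> < inverse (real (Suc k))"
        using M[of "M + k" M] d(2) by (simp add: dist_norm a_def)
      finally show ?thesis .
    qed
    with d(1) show ?thesis by blast
  qed
  then obtain n where n: "\<And>k. n k \<ge> k" "\<And>k i. norm (?V (n k) (axis i 1) - axis i 1) < inverse (real (Suc k))"
    by metis
  have ax: "(\<lambda>k. ?V (n k) (axis i 1)) \<longlonglongrightarrow> axis i 1" for i
  proof (rule LIM_zero_cancel, rule Lim_null_comparison[OF _ LIMSEQ_inverse_real_of_nat])
    show "\<forall>\<^sub>F k in sequentially. norm (?V (n k) (axis i 1) - axis i 1) \<le> inverse (real (Suc k))"
      using n(2) by (intro always_eventually allI less_imp_le)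
  qed
  have "(\<lambda>k. ?V (n k) x) \<longlonglongrightarrow> x" for x
  proof -
    have expand: "?V m x = (\<Sum>i\<in>UNIV. x $ i *\<^sub>R ?V m (axis i 1))" for m
      by (rule linear_axis_expand) (rule linearI; rule funpow_matrix_linear)
    have "(\<lambda>k. \<Sum>i\<in>UNIV. x $ i *\<^sub>R ?V (n k) (axis i 1)) \<longlonglongrightarrow> (\<Sum>i\<in>UNIV. x $ i *\<^sub>R axis i 1)"
      by (intro tendsto_intros ax)
    moreover have "(\<Sum>i\<in>UNIV. x $ i *\<^sub>R axis i 1) = x" using expand[of 0] by simp
    ultimately show ?thesis by (simp only: expand[symmetric])
  qed
  with n(1) that show ?thesis by blast
qed

text \<open>The diagonal entries of \<open>D\<close> are eigenvalues, so |det A| is a product of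
  numbers greater than 1. This gives the contraction factor below 1 and the existence of nonzero
  digits.\<close>

lemma isotropic_dilation_det:
  fixes A :: "real^'n^'n"
  assumes dil: "dilation_matrix A" and diag: "diagonalizable_complex A"
  shows "\<bar>det A\<bar> > 1"
proof -
  let ?A = "map_matrix complex_of_real A"
  obtain S D :: "complex^'n^'n" where S: "invertible S" and D': "\<forall>i j. i \<noteq> j \<longrightarrow> D $ i $ j = 0"
    and A: "?A = S ** D ** matrix_inv S"
    using diag unfolding diagonalizable_complex_def by blast
  have D: "D $ i $ j = 0" if "i \<noteq> j" for i j using D' that by blast
  have inv: "matrix_inv S ** S = mat 1" "S ** matrix_inv S = mat 1" using matrix_inv_mult[OF S] by auto
  have "norm (D $ i $ i) > 1" for i
  proof -
    have AS: "?A ** S = S ** D" by (simp add: A matrix_mul_assoc[symmetric] inv)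
    have "D *v axis i 1 = D $ i $ i *s axis i 1"
      by (auto simp: vec_eq_iff matrix_vector_mult_def axis_def D if_distrib sum.delta cong: if_cong)
    then have "?A *v (S *v axis i 1) = D $ i $ i *s (S *v axis i 1)"
      by (simp add: matrix_vector_mul_assoc AS) (simp add: matrix_vector_mul_assoc[symmetric] vector_scalar_commute)
    moreover have "S *v axis i 1 \<noteq> 0"
    proof
      assume "S *v axis i 1 = 0"
      then have "matrix_inv S *v (S *v axis i 1) = 0" by simp
      then show False by (simp add: matrix_vector_mul_assoc inv)
    qed
    ultimately have "eigenvalue_complex A (D $ i $ i)" unfolding eigenvalue_complex_def by blast
    then show ?thesis using dil by (simp add: dilation_matrix_def)
  qed
  then have "1 < (\<Prod>i\<in>UNIV. norm (D $ i $ i))"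
    by (intro less_1_prod) auto
  also have "\<dots> = norm (det ?A)"
  proof -
    have "det (matrix_inv S) * det S = 1" using inv(1) by (metis det_I det_mul)
    then have "det ?A = det D" by (simp add: A det_mul mult_ac)
    then show ?thesis by (simp add: det_diagonal[OF D] prod_norm)
  qed
  also have "\<dots> = \<bar>det A\<bar>" by (simp add: det_map_of_real)
  finally show ?thesis .
qed

definition frac_vec :: "real^'n \<Rightarrow> real^'n" where "frac_vec x = (\<chi> i. frac (x $ i))"

lemma frac_vec_diff: "\<exists>k. x = frac_vec x + intvec k"
  by (rule exI[of _ "\<chi> i. \<lfloor>x $ i\<rfloor>"]) (simp add: vec_eq_iff frac_vec_def frac_def)

section \<open>The contraction by A^(-T) and the recurrence of the powers of A^(-1)\<close>

locale elliptic =
  fixes A Q U :: "real^('n::{finite,linorder})^('n::{finite,linorder})"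
  assumes dilation: "dilation_matrix A"
    and isotropic: "isotropic A"
    and factorization: "isotropic_factorization A Q U"
begin

abbreviation B where "B \<equiv> inv_transpose A"
abbreviation digits where "digits \<equiv> digit_set (transpose A) - {0}"
abbreviation mask where "mask \<equiv> elliptic_mask A Q"

text \<open>The common absolute value of the eigenvalues of A^(-T).\<close>

definition \<rho> where "\<rho> = \<bar>det A\<bar> powr (- 1 / real CARD('n))"

lemma det_A: "\<bar>det A\<bar> > 1"
  using isotropic_dilation_det[OF dilation] isotropic by (simp add: isotropic_def)

lemma invertible_A: "invertible A"
  using det_A by (auto simp: invertible_det_nz)

lemma A_Ints: "A $ i $ j \<in> \<int>"
  using dilation by (simp add: dilation_matrix_def)

lemma \<rho>: "0 < \<rho>" "\<rho> < 1"
proof -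
  show "0 < \<rho>" using det_A by (simp add: \<rho>_def)
  have "\<bar>det A\<bar> powr (- 1 / real CARD('n)) < \<bar>det A\<bar> powr 0"
    using det_A by (intro powr_less_mono) auto
  moreover have "det A \<noteq> 0" using det_A by auto
  ultimately show "\<rho> < 1" by (simp add: \<rho>_def)
qed

lemma Q: "sym_pos_def Q" and U: "orthogonal_matrix U"
  and B_eq: "B = \<rho> *\<^sub>R (matrix_inv Q ** U ** Q)"
  using factorization by (simp_all add: isotropic_factorization_def \<rho>_def)

lemma transpose_Q: "transpose Q = Q" using Q by (simp add: sym_pos_def_def)

lemma invertible_Q: "invertible Q"
proof -
  have "inj ((*v) Q)"
  proof (rule injI)
    fix x y assume "Q *v x = Q *v y"
    then have "(x - y) \<bullet> (Q *v (x - y)) = 0" by (simp add: matrix_vector_mult_diff_distrib)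
    then have "x - y = 0" using Q unfolding sym_pos_def_def by (metis less_irrefl)
    then show "x = y" by simp
  qed
  then have "\<exists>M. M ** Q = mat 1" by (simp add: matrix_left_invertible_injective inj_def)
  then show ?thesis using invertible_left_inverse by blast
qed

lemma AB: "transpose A ** B = mat 1" "B ** transpose A = mat 1"
  by (rule transpose_inv_transpose[OF invertible_A])+

lemma transpose_A_Ints: "(\<And>i. x $ i \<in> \<int>) \<Longrightarrow> (transpose A *v x) $ i \<in> \<int>"
  by (auto simp: matrix_vector_mult_def transpose_def intro!: Ints_sum Ints_mult A_Ints)

lemma A_intvec: "\<exists>k'. A *v intvec k = intvec k'"
  by (rule intvec_surj) (auto simp: matrix_vector_mult_def intro!: Ints_sum Ints_mult A_Ints)

lemma funpow_B: "((\<lambda>\<eta>. B *v \<eta>) ^^ n) \<zeta> = \<rho> ^ n *\<^sub>R (matrix_inv Q *v ((\<lambda>\<eta>. U *v \<eta>) ^^ n) (Q *v \<zeta>))"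
proof (induction n)
  case 0
  then show ?case by (simp add: matrix_vector_mul_assoc matrix_inv_mult[OF invertible_Q])
next
  case (Suc n)
  have B_mult: "B *v z = \<rho> *\<^sub>R (matrix_inv Q *v (U *v (Q *v z)))" for z
    by (simp add: B_eq scaleR_matrix_vector_assoc[symmetric] matrix_vector_mul_assoc matrix_mul_assoc)
  have "Q *v (matrix_inv Q *v y) = y" for y
    by (simp add: matrix_vector_mul_assoc matrix_inv_mult[OF invertible_Q])
  then have "B *v (\<rho> ^ n *\<^sub>R (matrix_inv Q *v y)) = \<rho> ^ Suc n *\<^sub>R (matrix_inv Q *v (U *v y))" for y
    by (simp only: matrix_vector_mult_scaleR B_mult) simp
  with Suc show ?case by simp
qed

text \<open>\<open>B\<close> is \<rho> times a conjugate of an isometry. The conjugations telescope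
  in a power, so their cost is one constant independent of n.\<close>

lemma norm_funpow_B: "\<exists>K\<ge>0. \<forall>n \<zeta>. norm (((\<lambda>\<eta>. B *v \<eta>) ^^ n) \<zeta>) \<le> K * \<rho> ^ n * norm \<zeta>"
proof -
  obtain K1 where K1: "K1 > 0" "\<And>x. norm (matrix_inv Q *v x) \<le> norm x * K1"
    using bounded_linear.pos_bounded[OF matrix_vector_mul_bounded_linear[of "matrix_inv Q"]] by auto
  obtain K2 where K2: "K2 > 0" "\<And>x. norm (Q *v x) \<le> norm x * K2"
    using bounded_linear.pos_bounded[OF matrix_vector_mul_bounded_linear[of Q]] by auto
  have "norm (((\<lambda>\<eta>. B *v \<eta>) ^^ n) \<zeta>) \<le> (K1 * K2) * \<rho> ^ n * norm \<zeta>" for n \<zeta>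
  proof -
    have "norm (((\<lambda>\<eta>. B *v \<eta>) ^^ n) \<zeta>) \<le> \<rho> ^ n * (norm (((\<lambda>\<eta>. U *v \<eta>) ^^ n) (Q *v \<zeta>)) * K1)"
      using \<rho> K1 by (simp add: funpow_B)
    also have "\<dots> \<le> \<rho> ^ n * (norm \<zeta> * K2 * K1)"
      using \<rho> K1 K2(2)[of \<zeta>] by (simp add: norm_funpow_orthogonal[OF U])
    finally show ?thesis by (simp add: mult_ac)
  qed
  then show ?thesis using K1 K2 by (intro exI[of _ "K1 * K2"]) auto
qed

text \<open>Transposing the factorization gives A^(-1) = \<rho> Q U^T Q^(-1), so the normalised
  powers are conjugate to those of U^T and recur with them. The bound \<open>n k \<ge> k\<close>
  sends the exponents to infinity.\<close>

lemma inverse_A_powers: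
  obtains A' n where "A ** A' = mat 1" "A' ** A = mat 1" "\<And>k. n k \<ge> k"
    "\<And>x. (\<lambda>k. (1 / \<rho> ^ n k) *\<^sub>R (((\<lambda>x. A' *v x) ^^ n k) x)) \<longlonglongrightarrow> x"
proof -
  define A' where "A' = transpose B"
  have AA': "A ** A' = mat 1" "A' ** A = mat 1"
    using AB[THEN arg_cong[where f = transpose]] by (simp_all add: matrix_transpose_mul A'_def)
  define R where "R = transpose (matrix_inv Q)"
  have RQ: "R ** Q = mat 1" "Q ** R = mat 1"
    using matrix_inv_mult[OF invertible_Q, THEN arg_cong[where f = transpose]]
    by (simp_all add: matrix_transpose_mul R_def transpose_Q)
  have A'_eq: "A' *v x = \<rho> *\<^sub>R (Q *v (transpose U *v (R *v x)))" for x
  proof -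
    have "A' = \<rho> *\<^sub>R (Q ** (transpose U ** R))"
      by (simp add: A'_def B_eq transpose_scalar matrix_transpose_mul transpose_Q R_def)
    then show ?thesis by (simp add: scaleR_matrix_vector_assoc[symmetric] matrix_vector_mul_assoc)
  qed
  have pow: "((\<lambda>x. A' *v x) ^^ n) x = \<rho> ^ n *\<^sub>R (Q *v ((\<lambda>x. transpose U *v x) ^^ n) (R *v x))" for n x
  proof (induction n)
    case 0
    then show ?case by (simp add: matrix_vector_mul_assoc RQ)
  next
    case (Suc n)
    have "A' *v (\<rho> ^ n *\<^sub>R (Q *v y)) = \<rho> ^ Suc n *\<^sub>R (Q *v (transpose U *v y))" for y
      by (simp add: A'_eq matrix_vector_mult_scaleR) (simp add: matrix_vector_mul_assoc RQ)
    with Suc show ?case by simp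
  qed
  have "orthogonal_matrix (transpose U)" using U by (simp add: orthogonal_matrix_transpose)
  then obtain n where n: "\<And>k. n k \<ge> k" "\<And>x. (\<lambda>k. ((\<lambda>x. transpose U *v x) ^^ n k) x) \<longlonglongrightarrow> x"
    using orthogonal_powers_recur by blast
  have "(\<lambda>k. (1 / \<rho> ^ n k) *\<^sub>R (((\<lambda>x. A' *v x) ^^ n k) x)) \<longlonglongrightarrow> x" for x
  proof -
    have "(\<lambda>k. Q *v ((\<lambda>x. transpose U *v x) ^^ n k) (R *v x)) \<longlonglongrightarrow> Q *v (R *v x)"
      by (rule continuous_on_tendsto_compose[OF matrix_vector_mult_linear_continuous_on[of UNIV] n(2)]) auto
    then show ?thesis using \<rho> by (simp add: pow matrix_vector_mul_assoc RQ)
  qed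
  with AA' n(1) that show ?thesis by blast
qed

subsection \<open>Digits\<close>

lemma digit_nonint: "s \<in> digits \<Longrightarrow> \<exists>i. s $ i \<notin> \<int>"
proof (rule ccontr)
  assume s: "s \<in> digits" "\<nexists>i. s $ i \<notin> \<int>"
  have "s $ i = 0" for i
  proof -
    obtain n where "s $ i = of_int n" using s(2) by (auto elim: Ints_cases)
    moreover have "0 \<le> s $ i" "s $ i < 1" using s(1) by (auto simp: digit_set_def)
    ultimately show ?thesis by auto
  qed
  then show False using s(1) by (auto simp: vec_eq_iff)
qed

lemma frac_vec_digit:
  assumes "\<And>i. (transpose A *v x) $ i \<in> \<int>"
  shows "frac_vec x \<in> digit_set (transpose A)"
proof -
  obtain k where k: "x = frac_vec x + intvec k" using frac_vec_diff by blast
  have "transpose A *v frac_vec x = transpose A *v x - transpose A *v intvec k"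
    using arg_cong[OF k, of "\<lambda>x. transpose A *v x"] by (simp add: matrix_vector_right_distrib)
  moreover have "(transpose A *v intvec k) $ i \<in> \<int>" for i by (rule transpose_A_Ints) simp
  ultimately show ?thesis using assms by (auto simp: digit_set_def frac_vec_def frac_ge_0 frac_lt_1)
qed

lemma frac_vec_id: "s \<in> digit_set (transpose A) \<Longrightarrow> frac_vec s = s"
  by (auto simp: digit_set_def frac_vec_def vec_eq_iff frac_eq)

lemma frac_vec_minus_digit: "s \<in> digits \<Longrightarrow> frac_vec (- s) \<in> digits"
proof -
  assume s: "s \<in> digits"
  have "(transpose A *v (- s)) $ i \<in> \<int>" for i
    using s vec.neg[of "transpose A" s] by (auto simp: digit_set_def)
  moreover have "frac_vec (- s) \<noteq> 0"
  proof
    assume "frac_vec (- s) = 0"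
    then obtain k where "- s = intvec k" using frac_vec_diff[of "- s"] by auto
    then have "s $ i \<in> \<int>" for i
      by (metis Ints_minus Ints_of_int intvec_nth minus_minus vector_uminus_component)
    then show False using digit_nonint[OF s] by blast
  qed
  ultimately show ?thesis using frac_vec_digit[of "- s"] by simp
qed

text \<open>The digit congruent to -t is the only one whose sum with \<open>t\<close> is integral.
  It selects the single factor of the mask that turns into G under a twist.\<close>

lemma digits_sum_int:
  assumes "s \<in> digits" "t \<in> digits"
  shows "(\<forall>i. (s + t) $ i \<in> \<int>) \<longleftrightarrow> s = frac_vec (- t)"
proof
  assume int: "\<forall>i. (s + t) $ i \<in> \<int>"
  have "frac (s $ i) = frac (- t $ i)" for i
  proof -
    obtain n where "(s + t) $ i = of_int n" using int by (auto elim: Ints_cases)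
    then have "s $ i = of_int n + (- t $ i)" by simp
    moreover have "frac (of_int n + y) = frac y" for y :: real by (simp add: frac_def)
    ultimately show ?thesis by metis
  qed
  then have "frac_vec s = frac_vec (- t)" by (simp add: frac_vec_def vec_eq_iff)
  then show "s = frac_vec (- t)" using frac_vec_id assms(1) by auto
next
  assume s: "s = frac_vec (- t)"
  obtain k where k: "- t = frac_vec (- t) + intvec k" using frac_vec_diff by blast
  have "- t - intvec k = s" unfolding s by (subst k) simp
  then have "s + t = intvec (- k)" by (auto simp: intvec_minus)
  then show "\<forall>i. (s + t) $ i \<in> \<int>" by simp
qed

lemma frac_vec_minus_minus: "s \<in> digits \<Longrightarrow> frac_vec (- frac_vec (- s)) = s"
  using digits_sum_int[of s "frac_vec (- s)"] digits_sum_int[of "frac_vec (- s)" s] frac_vec_minus_digit[of s]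
  by (simp add: add.commute)

text \<open>A^T maps the digits injectively to lattice points of bounded norm.\<close>

lemma finite_digits: "finite digits"
proof -
  let ?f = "\<lambda>k. B *v intvec k"
  obtain K where K: "K > 0" "\<And>x. norm (transpose A *v x) \<le> norm x * K"
    using bounded_linear.pos_bounded[OF matrix_vector_mul_bounded_linear[of "transpose A"]] by auto
  have "digit_set (transpose A) \<subseteq> ?f ` {k. norm (intvec k) \<le> real CARD('n) * K}"
  proof
    fix s assume s: "s \<in> digit_set (transpose A)"
    then obtain k where k: "transpose A *v s = intvec k" using intvec_surj unfolding digit_set_def by blast
    then have "s = B *v intvec k" by (metis AB(2) matrix_vector_mul_assoc matrix_vector_mul_lid)
    moreover have "norm (intvec k) \<le> real CARD('n) * K"
    proof -
      have "norm s \<le> (\<Sum>i\<in>UNIV. \<bar>s $ i\<bar>)" by (rule norm_le_l1_cart)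
      also have "\<dots> \<le> (\<Sum>i\<in>(UNIV::'n set). 1)" using s by (intro sum_mono) (auto simp: digit_set_def abs_le_iff intro: less_imp_le order_trans)
      finally have "norm s * K \<le> real CARD('n) * K" using K(1) by simp
      then show ?thesis using K(2)[of s] unfolding k by linarith
    qed
    ultimately show "s \<in> ?f ` {k. norm (intvec k) \<le> real CARD('n) * K}" by blast
  qed
  then show ?thesis using finite_intvec_bounded finite_subset by (metis finite_Diff finite_imageI)
qed

text \<open>If 0 were the only digit, then x would be integral whenever A^T x is, so A^(-T) would be
  an integer matrix. Two integer determinants with product 1 would then contradict |det A| >
  1.\<close>

lemma digits_nonempty: "digits \<noteq> {}"
proof
  assume empty: "digits = {}"
  have "B $ i $ j \<in> \<int>" for i j
  proof -
    have "transpose A *v (B *v axis j 1) = axis j 1" by (simp add: matrix_vector_mul_assoc AB)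
    then have "frac_vec (B *v axis j 1) \<in> digit_set (transpose A)"
      by (intro frac_vec_digit) (simp add: axis_def)
    then have "frac_vec (B *v axis j 1) = 0" using empty by blast
    then have "frac ((B *v axis j 1) $ i) = 0" by (simp add: frac_vec_def vec_eq_iff)
    then show ?thesis by (simp add: matrix_vector_mult_basis column_def)
  qed
  then have "det B \<in> \<int>" by (rule det_Ints)
  then obtain b where b: "det B = of_int b" by (elim Ints_cases)
  have "det A \<in> \<int>" by (rule det_Ints) (rule A_Ints)
  then obtain a where a: "det A = of_int a" by (elim Ints_cases)
  have "det A * det B = 1" using arg_cong[OF AB(1), of det] by (simp add: det_mul)
  then have "a * b = 1" unfolding a b by (metis of_int_eq_1_iff of_int_mult)
  then have "\<bar>a\<bar> = 1" using zmult_eq_1_iff by auto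
  then have "\<bar>det A\<bar> = 1" unfolding a by (metis of_int_1 of_int_abs)
  then show False using det_A by simp
qed

subsection \<open>The infinite product\<close>

definition G_trig :: "('n::{finite,linorder}) trig" where
  "G_trig = (SOME L. teval L = (\<lambda>\<zeta>. of_real (elliptic_G Q \<zeta>)) \<and> diff_op L = elliptic_diff Q 1)"

lemma G_trig: "teval G_trig \<zeta> = of_real (elliptic_G Q \<zeta>)" "diff_op G_trig = elliptic_diff Q 1"
  using someI_ex[OF symbol_elliptic_G[of Q, unfolded symbol_of_def]] by (auto simp: G_trig_def)

lemma elliptic_G_periodic: "elliptic_G Q (\<zeta> + (2 * pi) *\<^sub>R intvec k) = elliptic_G Q \<zeta>"
  using teval_periodic[of G_trig \<zeta> k] by (simp add: G_trig)

lemma elliptic_G_digit_shift: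
  assumes "s \<in> digits" shows "elliptic_G Q ((2 * pi) *\<^sub>R s) \<noteq> 0"
  using elliptic_G_nonzero[OF Q] digit_nonint[OF assms] by blast

definition mask_denom where "mask_denom = (\<Prod>s\<in>digits. elliptic_G Q ((2 * pi) *\<^sub>R s))"

lemma mask_denom_nonzero: "mask_denom \<noteq> 0"
  using finite_digits elliptic_G_digit_shift by (simp add: mask_denom_def)

lemma mask_eq: "mask \<zeta> = (\<Prod>s\<in>digits. elliptic_G Q (\<zeta> + (2 * pi) *\<^sub>R s)) / mask_denom"
  by (simp add: elliptic_mask_def mask_denom_def)

text \<open>The digits are given as a list so that the order of the factors can be chosen; the
  annihilation argument puts one distinguished digit first.\<close>

definition mask_trig :: "(real^('n::{finite,linorder})) list \<Rightarrow> ('n::{finite,linorder}) trig" where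
  "mask_trig ss = tmul [(of_real (1 / mask_denom), 0)] (tprod (map (\<lambda>s. twist s G_trig) ss))"

lemma teval_mask_trig:
  assumes "distinct ss" "set ss = digits"
  shows "teval (mask_trig ss) \<zeta> = of_real (mask \<zeta>)"
proof -
  have "(\<Prod>s\<leftarrow>ss. teval (twist s G_trig) \<zeta>) = (\<Prod>s\<in>digits. of_real (elliptic_G Q (\<zeta> + (2 * pi) *\<^sub>R s)))"
    using prod.distinct_set_conv_list[OF assms(1), of "\<lambda>s. teval (twist s G_trig) \<zeta>"] assms(2)
    by (simp add: teval_twist G_trig)
  then show ?thesis by (simp add: mask_trig_def teval_tmul teval_tprod o_def mask_eq del: tmul_simps)
qed

text \<open>G is even and periodic, and negation modulo Z^d permutes the nonzero digits.\<close>

lemma mask_even: "mask (- \<zeta>) = mask \<zeta>"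
proof -
  have "(\<Prod>s\<in>digits. elliptic_G Q (- \<zeta> + (2 * pi) *\<^sub>R s)) = (\<Prod>s\<in>digits. elliptic_G Q (\<zeta> + (2 * pi) *\<^sub>R s))"
  proof (rule prod.reindex_bij_witness[of _ "\<lambda>s. frac_vec (- s)" "\<lambda>s. frac_vec (- s)"])
    fix s assume s: "s \<in> digits"
    obtain k where k: "- s = frac_vec (- s) + intvec k" using frac_vec_diff by blast
    have "elliptic_G Q (- \<zeta> + (2 * pi) *\<^sub>R s) = elliptic_G Q (\<zeta> + (2 * pi) *\<^sub>R (- s))"
      using elliptic_G_even[of Q "\<zeta> + (2 * pi) *\<^sub>R (- s)"] by simp
    also have "\<dots> = elliptic_G Q (\<zeta> + (2 * pi) *\<^sub>R frac_vec (- s))"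
      using elliptic_G_periodic[of "\<zeta> + (2 * pi) *\<^sub>R frac_vec (- s)" k] k
      by (metis add.assoc scaleR_add_right)
    finally show "elliptic_G Q (\<zeta> + (2 * pi) *\<^sub>R frac_vec (- s)) = elliptic_G Q (- \<zeta> + (2 * pi) *\<^sub>R s)" by simp
  qed (use frac_vec_minus_digit frac_vec_minus_minus in auto)
  then show ?thesis by (simp add: mask_eq)
qed

lemma mask_0: "mask 0 = 1"
  using mask_denom_nonzero by (simp add: mask_eq flip: mask_denom_def)

lemma mask_lipschitz: "\<exists>C\<ge>0. \<forall>\<zeta>. \<bar>mask \<zeta> - 1\<bar> \<le> C * norm \<zeta>" and continuous_on_mask: "continuous_on S mask"
proof -
  obtain ss where ss: "distinct ss" "set ss = digits" using finite_distinct_list[OF finite_digits] by blast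
  note T = teval_mask_trig[OF ss]
  obtain C where "C \<ge> 0" "\<And>\<zeta>. norm (teval (mask_trig ss) \<zeta> - teval (mask_trig ss) 0) \<le> C * norm \<zeta>"
    using norm_teval_diff_le by blast
  then show "\<exists>C\<ge>0. \<forall>\<zeta>. \<bar>mask \<zeta> - 1\<bar> \<le> C * norm \<zeta>"
    unfolding T mask_0 of_real_diff[symmetric] norm_of_real by blast
  have "mask = (\<lambda>\<zeta>. Re (teval (mask_trig ss) \<zeta>))" by (simp add: T)
  then show "continuous_on S mask" by (simp add: continuous_on_Re continuous_on_teval)
qed

text \<open>The index 0 is included although \<open>mask_product\<close> starts at 1; this extra
  factor is the one that the refinement equation splits off.\<close>

definition mask_factor :: "nat \<Rightarrow> real^('n::{finite,linorder}) \<Rightarrow> real" where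
  "mask_factor j \<xi> = mask (((\<lambda>\<eta>. B *v \<eta>) ^^ j) \<xi>)"

lemma mask_factor_bound: "\<exists>C\<ge>0. \<forall>j \<xi>. \<bar>mask_factor j \<xi> - 1\<bar> \<le> C * \<rho> ^ j * norm \<xi>"
proof -
  obtain C where C: "C \<ge> 0" "\<And>\<zeta>. \<bar>mask \<zeta> - 1\<bar> \<le> C * norm \<zeta>" using mask_lipschitz by blast
  obtain K where K: "K \<ge> 0" "\<And>n \<zeta>. norm (((\<lambda>\<eta>. B *v \<eta>) ^^ n) \<zeta>) \<le> K * \<rho> ^ n * norm \<zeta>" using norm_funpow_B by blast
  have "\<bar>mask_factor j \<xi> - 1\<bar> \<le> (C * K) * \<rho> ^ j * norm \<xi>" for j \<xi>
  proof -
    have "\<bar>mask_factor j \<xi> - 1\<bar> \<le> C * norm (((\<lambda>\<eta>. B *v \<eta>) ^^ j) \<xi>)" unfolding mask_factor_def by (rule C)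
    also have "\<dots> \<le> C * (K * \<rho> ^ j * norm \<xi>)" by (intro mult_left_mono K C)
    finally show ?thesis by (simp add: mult_ac)
  qed
  then show ?thesis using C(1) K(1) by (intro exI[of _ "C * K"]) auto
qed

lemma convergent_mask_factor: "convergent_prod (\<lambda>j. mask_factor j \<xi>)"
proof -
  obtain C where C: "C \<ge> 0" "\<And>j \<xi>. \<bar>mask_factor j \<xi> - 1\<bar> \<le> C * \<rho> ^ j * norm \<xi>" using mask_factor_bound by blast
  have "summable (\<lambda>j. norm (mask_factor j \<xi> - 1))"
  proof (rule summable_comparison_test'[where g = "\<lambda>j. (C * norm \<xi>) * \<rho> ^ j" and N = 0])
    show "summable (\<lambda>j. (C * norm \<xi>) * \<rho> ^ j)" using \<rho> by (intro summable_mult summable_geometric) simp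
    show "norm (norm (mask_factor j \<xi> - 1)) \<le> (C * norm \<xi>) * \<rho> ^ j" for j
      using C(2)[of j \<xi>] by (simp add: mult_ac)
  qed
  then show ?thesis by (intro abs_convergent_prod_imp_convergent_prod summable_imp_abs_convergent_prod)
qed

lemma convergent_mask_factor_Suc: "convergent_prod (\<lambda>j. mask_factor (Suc j) \<xi>)"
  using convergent_mask_factor convergent_prod_Suc_iff[of "\<lambda>j. mask_factor j \<xi>"] by blast

lemma mask_product_eq: "mask_product A mask \<xi> = prodinf (\<lambda>j. mask_factor (Suc j) \<xi>)"
  by (simp add: mask_product_def mask_factor_def)

lemma mask_product_refine: "mask_product A mask (transpose A *v \<zeta>) = mask \<zeta> * mask_product A mask \<zeta>"
proof -
  have "mask_factor (Suc j) (transpose A *v \<zeta>) = mask_factor j \<zeta>" for j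
    by (simp only: mask_factor_def funpow_Suc_right o_apply matrix_vector_mul_assoc AB matrix_vector_mul_lid)
  then have "mask_product A mask (transpose A *v \<zeta>) = prodinf (\<lambda>j. mask_factor j \<zeta>)"
    by (simp add: mask_product_eq)
  also have "\<dots> = (\<Prod>k<1. mask_factor k \<zeta>) * prodinf (\<lambda>k. mask_factor (k + 1) \<zeta>)"
    by (rule has_prod_unique[symmetric]) (rule has_prod_ignore_initial_segment'[OF convergent_mask_factor])
  also have "\<dots> = mask \<zeta> * mask_product A mask \<zeta>"
    by (simp add: mask_product_eq) (simp add: mask_factor_def)
  finally show ?thesis .
qed

text \<open>On a ball around \<open>p\<close> the deviations of the factors from 1 are dominated by
  one geometric series, so the partial products converge uniformly there. Continuity gives the value
  of the transform at a single point a meaning in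
  \<open>fourier_eq_0_of_twisted_sum\<close>.\<close>

lemma isCont_mask_product: "isCont (mask_product A mask) p"
proof -
  let ?K = "cball p 1"
  have cont: "continuous_on ?K (mask_factor j)" for j
  proof -
    have "continuous_on ?K (\<lambda>\<xi>. ((\<lambda>\<eta>. B *v \<eta>) ^^ j) \<xi>)"
    proof (induction j)
      case (Suc j)
      then show ?case
        by (auto intro!: continuous_on_compose2[OF matrix_vector_mult_linear_continuous_on[of UNIV]])
    qed (simp add: continuous_on_id)
    then show ?thesis unfolding mask_factor_def
      by (rule continuous_on_compose2[OF continuous_on_mask[of UNIV]]) auto
  qed
  obtain C where C: "C \<ge> 0" "\<And>j \<xi>. \<bar>mask_factor j \<xi> - 1\<bar> \<le> C * \<rho> ^ j * norm \<xi>" using mask_factor_bound by blast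
  have "uniformly_convergent_on ?K (\<lambda>N \<xi>. \<Sum>j<N. norm (mask_factor (Suc j) \<xi> - 1))"
  proof (rule Weierstrass_m_test'[where M = "\<lambda>j. (C * (norm p + 1)) * \<rho> ^ j"])
    show "summable (\<lambda>j. (C * (norm p + 1)) * \<rho> ^ j)" using \<rho> by (intro summable_mult summable_geometric) simp
    fix j \<xi> assume "\<xi> \<in> ?K"
    then have n: "norm \<xi> \<le> norm p + 1"
      using norm_triangle_ineq2[of \<xi> p] by (simp add: dist_norm norm_minus_commute)
    have "\<bar>mask_factor (Suc j) \<xi> - 1\<bar> \<le> C * \<rho> ^ Suc j * norm \<xi>" by (rule C)
    also have "\<dots> \<le> C * \<rho> ^ j * (norm p + 1)"
      using C \<rho> n by (intro mult_mono mult_left_mono power_decreasing) auto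
    finally show "norm (norm (mask_factor (Suc j) \<xi> - 1)) \<le> (C * (norm p + 1)) * \<rho> ^ j" by (simp add: mult_ac)
  qed
  then have "uniformly_convergent_on ?K (\<lambda>N \<xi>. \<Prod>j<N. mask_factor (Suc j) \<xi>)"
    using cont by (intro uniformly_convergent_on_prod') auto
  then obtain l where l: "uniform_limit ?K (\<lambda>N \<xi>. \<Prod>j<N. mask_factor (Suc j) \<xi>) l sequentially"
    by (auto simp: uniformly_convergent_on_def)
  have "l \<xi> = mask_product A mask \<xi>" if "\<xi> \<in> ?K" for \<xi>
  proof -
    have "(\<lambda>N. \<Prod>j\<le>N. mask_factor (Suc j) \<xi>) \<longlonglongrightarrow> mask_product A mask \<xi>"
      unfolding mask_product_eq by (rule convergent_prod_LIMSEQ[OF convergent_mask_factor_Suc])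
    moreover have "(\<lambda>N. \<Prod>j<Suc N. mask_factor (Suc j) \<xi>) \<longlonglongrightarrow> l \<xi>"
      using tendsto_uniform_limitI[OF l that] by (rule LIMSEQ_Suc)
    ultimately show ?thesis by (simp only: lessThan_Suc_atMost) (rule LIMSEQ_unique)
  qed
  moreover have "continuous_on ?K l"
  proof (rule uniform_limit_theorem[OF _ l])
    show "\<forall>\<^sub>F N in sequentially. continuous_on ?K (\<lambda>\<xi>. \<Prod>j<N. mask_factor (Suc j) \<xi>)"
      by (intro always_eventually allI continuous_on_prod cont)
  qed simp
  ultimately have "continuous_on ?K (mask_product A mask)"
    using continuous_on_cong[of ?K ?K l "mask_product A mask"] by blast
  then show ?thesis by (rule continuous_on_interior) simp
qed

text \<open>The iterates of a nonzero digit under A^(-T) are never integral, because A^T preserves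
  integrality. For the same reason an iterate plus another digit is not integral, so no G in any
  factor vanishes; a convergent product of nonzero factors is nonzero.\<close>

lemma mask_product_digit_nonzero:
  assumes s: "s \<in> digits"
  shows "mask_product A mask ((2 * pi) *\<^sub>R s) \<noteq> 0"
proof -
  have nonint: "\<exists>i. (((\<lambda>\<eta>. B *v \<eta>) ^^ j) s) $ i \<notin> \<int>" for j
  proof (induction j)
    case 0
    then show ?case using digit_nonint[OF s] by simp
  next
    case (Suc j)
    let ?x = "((\<lambda>\<eta>. B *v \<eta>) ^^ j) s"
    have "transpose A *v (B *v ?x) = ?x" by (simp add: matrix_vector_mul_assoc AB)
    then show ?case using transpose_A_Ints[of "B *v ?x"] Suc by auto
  qed
  have "mask_factor (Suc j) ((2 * pi) *\<^sub>R s) \<noteq> 0" for j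
  proof -
    let ?x = "((\<lambda>\<eta>. B *v \<eta>) ^^ j) s"
    have "elliptic_G Q ((2 * pi) *\<^sub>R (B *v ?x) + (2 * pi) *\<^sub>R t) \<noteq> 0" if t: "t \<in> digits" for t
    proof -
      have "\<exists>i. (B *v ?x + t) $ i \<notin> \<int>"
      proof (rule ccontr)
        assume "\<nexists>i. (B *v ?x + t) $ i \<notin> \<int>"
        then have int: "(transpose A *v (B *v ?x + t)) $ i \<in> \<int>" for i by (intro transpose_A_Ints) auto
        have "transpose A *v (B *v ?x + t) = ?x + transpose A *v t"
          by (simp add: matrix_vector_right_distrib matrix_vector_mul_assoc AB)
        moreover have "(transpose A *v t) $ i \<in> \<int>" for i using t by (simp add: digit_set_def)
        ultimately have "?x $ i \<in> \<int>" for i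
          using int[of i] by (metis Ints_diff add_diff_cancel_right' vector_add_component)
        then show False using nonint by blast
      qed
      then show ?thesis using elliptic_G_nonzero[OF Q, of "B *v ?x + t"] by (auto simp: scaleR_add_right)
    qed
    then have "mask ((2 * pi) *\<^sub>R (B *v ?x)) \<noteq> 0"
      using finite_digits mask_denom_nonzero by (simp add: mask_eq)
    moreover have "((\<lambda>\<eta>. B *v \<eta>) ^^ Suc j) ((2 * pi) *\<^sub>R s) = (2 * pi) *\<^sub>R (B *v ?x)"
      by (simp only: funpow_matrix_linear) simp
    ultimately show ?thesis by (simp add: mask_factor_def)
  qed
  then show ?thesis
    unfolding mask_product_eq by (rule prodinf_nonzero[OF convergent_mask_factor_Suc])
qed

end

section \<open>Differential operators as limits of difference operators\<close>

definition dird :: "real^'n \<Rightarrow> (real^'n \<Rightarrow> complex) \<Rightarrow> real^'n \<Rightarrow> complex" where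
  "dird v p y = frechet_derivative p (at y) v"

lemma pderiv_at_eq_dird: "pderiv_at i p = dird (axis i 1) p"
  by (simp add: fun_eq_iff pderiv_at_def dird_def)

lemma dird_eq: "(p has_derivative D) (at y) \<Longrightarrow> dird v p y = D v"
  unfolding dird_def by (metis frechet_derivative_at)

lemma polys_has_derivative: "p \<in> polys \<Longrightarrow> (p has_derivative (\<lambda>v. dird v p y)) (at y)"
proof -
  assume "p \<in> polys"
  then have "p differentiable (at y)"
  proof (induction rule: polys.induct)
    case (coord p i)
    have "(\<lambda>x. complex_of_real (x $ i)) differentiable (at y)"
      using has_derivative_coord by (rule differentiableI)
    with coord show ?case by (intro derivative_intros)
  qed (auto intro!: derivative_intros)
  then show ?thesis unfolding dird_def by (simp flip: frechet_derivative_works)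
qed

lemma dird_const: "dird v (\<lambda>x. c) = (\<lambda>x. 0)"
  by (rule ext) (rule dird_eq[OF has_derivative_const])

lemma dird_add: "p \<in> polys \<Longrightarrow> q \<in> polys \<Longrightarrow> dird v (\<lambda>x. p x + q x) = (\<lambda>x. dird v p x + dird v q x)"
  by (rule ext) (rule dird_eq[OF has_derivative_add[OF polys_has_derivative polys_has_derivative]])

lemma dird_coord: "p \<in> polys \<Longrightarrow>
    dird v (\<lambda>x. of_real (x $ i) * p x) = (\<lambda>x. of_real (x $ i) * dird v p x + of_real (v $ i) * p x)"
  by (rule ext) (rule dird_eq[OF has_derivative_mult[OF has_derivative_coord polys_has_derivative]])

lemma dird_cmult: "p \<in> polys \<Longrightarrow> dird v (\<lambda>x. c * p x) = (\<lambda>x. c * dird v p x)"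
  by (rule ext) (rule dird_eq[OF has_derivative_mult_right[OF polys_has_derivative]])

lemma dird_scaled_direction: "p \<in> polys \<Longrightarrow> dird (c *\<^sub>R v) p x = of_real c * dird v p x"
  using linear_scale[OF has_derivative_linear[OF polys_has_derivative[of p x]], of c v]
  by (simp add: scaleR_conv_of_real)

lemma polys_dird: "p \<in> polys \<Longrightarrow> dird v p \<in> polys"
proof (induction rule: polys.induct)
  case (coord p i)
  then show ?case by (simp add: dird_coord polys.add polys.coord polys_cmult)
qed (auto simp: dird_const dird_add intro: polys.intros)

lemma dird_commute: "p \<in> polys \<Longrightarrow> dird u (dird v p) = dird v (dird u p)"
proof (induction rule: polys.induct)
  case (coord p i)
  have eq: "dird u (dird v (\<lambda>x. of_real (x $ i) * p x)) =
      (\<lambda>x. of_real (x $ i) * dird u (dird v p) x + of_real (u $ i) * dird v p x + of_real (v $ i) * dird u p x)" for u v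
    using coord(1) by (simp add: dird_coord dird_add dird_cmult polys_dird polys.coord polys_cmult)
  show ?case unfolding eq by (simp add: coord.IH add_ac)
qed (auto simp: dird_const dird_add polys_dird)

text \<open>Polynomials in \<open>y\<close> whose coefficients are polynomials in the step size \<open>t\<close>.\<close>

inductive_set pfam :: "(real \<Rightarrow> real^'n \<Rightarrow> complex) set" where
  base: "p \<in> polys \<Longrightarrow> (\<lambda>t. p) \<in> pfam"
| step: "K \<in> pfam \<Longrightarrow> (\<lambda>t y. of_real t * K t y) \<in> pfam"
| add: "K \<in> pfam \<Longrightarrow> L \<in> pfam \<Longrightarrow> (\<lambda>t y. K t y + L t y) \<in> pfam"

lemma pfam_cmult: "K \<in> pfam \<Longrightarrow> (\<lambda>t y. c * K t y) \<in> pfam"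
proof (induction rule: pfam.induct)
  case (base p)
  then show ?case using pfam.base[OF polys_cmult[of p c]] by simp
next
  case (step K)
  then show ?case using pfam.step[of "\<lambda>t y. c * K t y"] by (simp add: mult_ac)
qed (auto simp: distrib_left intro: pfam.intros)

lemma pfam_coord: "K \<in> pfam \<Longrightarrow> (\<lambda>t y. of_real (y $ i) * K t y) \<in> pfam"
proof (induction rule: pfam.induct)
  case (base p)
  then show ?case using pfam.base[OF polys.coord[of p i]] by simp
next
  case (step K)
  then show ?case using pfam.step[of "\<lambda>t y. of_real (y $ i) * K t y"] by (simp add: mult_ac)
qed (auto simp: distrib_left intro: pfam.intros)

lemma pfam_isCont: "K \<in> pfam \<Longrightarrow> isCont (\<lambda>t. K t y) 0"
  by (induction rule: pfam.induct) (auto intro!: continuous_intros)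

text \<open>Taylor expansion with the remainder kept as an exact polynomial in the step size, not
  merely estimated, so that operators can later be applied to the remainder.\<close>

lemma polys_expansion:
  assumes "p \<in> polys"
  shows "\<exists>K\<in>pfam. \<forall>t y. p (y + t *\<^sub>R v) = p y + of_real t * (dird v p y + of_real t * K t y)"
  using assms
proof (induction rule: polys.induct)
  case (const c)
  then show ?case
    by (intro bexI[OF _ pfam.base[OF polys.const[of 0]]]) (simp add: dird_const)
next
  case (coord p i)
  then obtain K where K: "K \<in> pfam" "\<And>t y. p (y + t *\<^sub>R v) = p y + of_real t * (dird v p y + of_real t * K t y)"
    by blast
  \<comment> \<open>What remains of order t^2 and higher in (y_i + t v_i) times the expansion of
    \<open>p\<close>.\<close>
  let ?K = "\<lambda>t y. of_real (y $ i) * K t y + of_real (v $ i) * (dird v p y + of_real t * K t y)"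
  have mem: "?K \<in> pfam"
    using K(1) coord(1) by (intro pfam.add pfam_coord pfam_cmult pfam.step pfam.base[OF polys_dird])
  have eq: "of_real ((y + t *\<^sub>R v) $ i) * p (y + t *\<^sub>R v) = of_real (y $ i) * p y
     + of_real t * (dird v (\<lambda>x. of_real (x $ i) * p x) y + of_real t * ?K t y)" for t y
    unfolding K(2) dird_coord[OF coord(1)] by (simp add: algebra_simps)
  show ?case by (rule bexI[OF _ mem]) (intro allI eq)
next
  case (add p q)
  then obtain K L where K: "K \<in> pfam" "\<And>t y. p (y + t *\<^sub>R v) = p y + of_real t * (dird v p y + of_real t * K t y)"
    and L: "L \<in> pfam" "\<And>t y. q (y + t *\<^sub>R v) = q y + of_real t * (dird v q y + of_real t * L t y)"
    by blast
  then show ?case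
    by (intro bexI[OF _ pfam.add[OF K(1) L(1)]]) (simp add: dird_add[OF add(1,2)] algebra_simps)
qed

text \<open>T_t = D + t K_t on polynomials, with K_t polynomial in t. Pointwise convergence of T_t
  to D would not by itself pass to compositions, whereas this relation does and hence survives m-th
  powers. The case t = 0 is left out because difference quotients divide by t.\<close>

definition approximates ::
    "(real \<Rightarrow> (real^'n \<Rightarrow> complex) \<Rightarrow> real^'n \<Rightarrow> complex) \<Rightarrow> ((real^'n \<Rightarrow> complex) \<Rightarrow> real^'n \<Rightarrow> complex) \<Rightarrow> bool" where
  "approximates T D \<longleftrightarrow>
     (\<forall>t p q. T t (\<lambda>y. p y + q y) = (\<lambda>y. T t p y + T t q y)) \<and>
     (\<forall>t c p. T t (\<lambda>y. c * p y) = (\<lambda>y. c * T t p y)) \<and>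
     (\<forall>p\<in>polys. D p \<in> polys \<and> (\<exists>K\<in>pfam. \<forall>t. t \<noteq> 0 \<longrightarrow> T t p = (\<lambda>y. D p y + of_real t * K t y)))"

lemma approximatesI:
  assumes "\<And>t p q. T t (\<lambda>y. p y + q y) = (\<lambda>y. T t p y + T t q y)"
    and "\<And>t c p. T t (\<lambda>y. c * p y) = (\<lambda>y. c * T t p y)"
    and "\<And>p. p \<in> polys \<Longrightarrow> D p \<in> polys"
    and "\<And>p. p \<in> polys \<Longrightarrow> \<exists>K\<in>pfam. \<forall>t. t \<noteq> 0 \<longrightarrow> T t p = (\<lambda>y. D p y + of_real t * K t y)"
  shows "approximates T D"
  using assms by (simp add: approximates_def)

text \<open>In a composition the outer operator meets a remainder that depends on t itself;
  linearity at fixed t pulls the powers of t out.\<close>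

lemma approximates_pfam:
  assumes T: "approximates T D" and "K \<in> pfam"
  shows "\<exists>L\<in>pfam. \<forall>t. t \<noteq> 0 \<longrightarrow> T t (K t) = L t"
  using assms(2)
proof (induction rule: pfam.induct)
  case (base p)
  then obtain K where K: "K \<in> pfam" "\<And>t. t \<noteq> 0 \<Longrightarrow> T t p = (\<lambda>y. D p y + of_real t * K t y)" "D p \<in> polys"
    using T by (auto simp: approximates_def)
  then show ?case by (intro bexI[of _ "\<lambda>t y. D p y + of_real t * K t y"]) (auto intro: pfam.intros)
next
  case (step K)
  then obtain L where "L \<in> pfam" "\<And>t. t \<noteq> 0 \<Longrightarrow> T t (K t) = L t" by blast
  then show ?case using T by (intro bexI[of _ "\<lambda>t y. of_real t * L t y"]) (auto simp: approximates_def intro: pfam.intros)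
next
  case (add K1 K2)
  then obtain L1 L2 where "L1 \<in> pfam" "\<And>t. t \<noteq> 0 \<Longrightarrow> T t (K1 t) = L1 t"
    "L2 \<in> pfam" "\<And>t. t \<noteq> 0 \<Longrightarrow> T t (K2 t) = L2 t" by blast
  then show ?case using T by (intro bexI[of _ "\<lambda>t y. L1 t y + L2 t y"]) (auto simp: approximates_def intro: pfam.intros)
qed

lemma approximates_comp:
  assumes T: "approximates T D" and S: "approximates S E"
  shows "approximates (\<lambda>t p. T t (S t p)) (\<lambda>p. D (E p))"
proof (rule approximatesI)
  show "T t (S t (\<lambda>y. p y + q y)) = (\<lambda>y. T t (S t p) y + T t (S t q) y)" for t p q
    using T S by (simp add: approximates_def)
  show "T t (S t (\<lambda>y. c * p y)) = (\<lambda>y. c * T t (S t p) y)" for t c p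
    using T S by (simp add: approximates_def)
  fix p :: "real^'a \<Rightarrow> complex" assume p: "p \<in> polys"
  then have E: "E p \<in> polys" using S by (simp add: approximates_def)
  then show "D (E p) \<in> polys" using T by (simp add: approximates_def)
  obtain K where K: "K \<in> pfam" "\<And>t. t \<noteq> 0 \<Longrightarrow> S t p = (\<lambda>y. E p y + of_real t * K t y)"
    using S p by (auto simp: approximates_def)
  obtain K' where K': "K' \<in> pfam" "\<And>t. t \<noteq> 0 \<Longrightarrow> T t (E p) = (\<lambda>y. D (E p) y + of_real t * K' t y)"
    using T E by (auto simp: approximates_def)
  obtain L where L: "L \<in> pfam" "\<And>t. t \<noteq> 0 \<Longrightarrow> T t (K t) = L t"
    using approximates_pfam[OF T K(1)] by blast
  have "T t (S t p) = (\<lambda>y. D (E p) y + of_real t * (K' t y + L t y))" if "t \<noteq> 0" for t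
  proof -
    have "T t (S t p) = (\<lambda>y. T t (E p) y + of_real t * T t (K t) y)"
      using T by (simp add: K(2)[OF that] approximates_def)
    then show ?thesis by (simp add: K'(2)[OF that] L(2)[OF that] algebra_simps)
  qed
  then show "\<exists>K\<in>pfam. \<forall>t. t \<noteq> 0 \<longrightarrow> T t (S t p) = (\<lambda>y. D (E p) y + of_real t * K t y)"
    by (intro bexI[OF _ pfam.add[OF K'(1) L(1)]]) simp
qed

lemma approximates_add:
  assumes T: "approximates T D" and S: "approximates S E"
  shows "approximates (\<lambda>t p y. T t p y + S t p y) (\<lambda>p y. D p y + E p y)"
proof (rule approximatesI)
  fix p :: "real^'a \<Rightarrow> complex" assume p: "p \<in> polys"
  then show "(\<lambda>y. D p y + E p y) \<in> polys" using T S by (auto simp: approximates_def intro: polys.add)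
  obtain K where K: "K \<in> pfam" "\<And>t. t \<noteq> 0 \<Longrightarrow> T t p = (\<lambda>y. D p y + of_real t * K t y)"
    using T p by (auto simp: approximates_def)
  obtain L where L: "L \<in> pfam" "\<And>t. t \<noteq> 0 \<Longrightarrow> S t p = (\<lambda>y. E p y + of_real t * L t y)"
    using S p by (auto simp: approximates_def)
  show "\<exists>K\<in>pfam. \<forall>t. t \<noteq> 0 \<longrightarrow> (\<lambda>y. T t p y + S t p y) = (\<lambda>y. D p y + E p y + of_real t * K t y)"
    by (intro bexI[OF _ pfam.add[OF K(1) L(1)]]) (simp add: K(2) L(2) algebra_simps)
qed (use T S in \<open>simp_all add: approximates_def algebra_simps\<close>)

lemma approximates_cmult:
  assumes T: "approximates T D"
  shows "approximates (\<lambda>t p y. c * T t p y) (\<lambda>p y. c * D p y)"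
proof (rule approximatesI)
  fix p :: "real^'a \<Rightarrow> complex" assume p: "p \<in> polys"
  then show "(\<lambda>y. c * D p y) \<in> polys" using T by (auto simp: approximates_def intro: polys_cmult)
  obtain K where K: "K \<in> pfam" "\<And>t. t \<noteq> 0 \<Longrightarrow> T t p = (\<lambda>y. D p y + of_real t * K t y)"
    using T p by (auto simp: approximates_def)
  show "\<exists>K\<in>pfam. \<forall>t. t \<noteq> 0 \<longrightarrow> (\<lambda>y. c * T t p y) = (\<lambda>y. c * D p y + of_real t * K t y)"
    by (intro bexI[OF _ pfam_cmult[OF K(1), of c]]) (simp add: K(2) algebra_simps)
qed (use T in \<open>simp_all add: approximates_def algebra_simps\<close>)

lemma approximates_zero: "approximates (\<lambda>t p y. 0) (\<lambda>p y. 0)"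
  by (rule approximatesI) (auto intro: polys.const intro!: bexI[OF _ pfam.base[OF polys.const[of 0]]])

lemma approximates_sum:
  assumes "\<And>i. i \<in> I \<Longrightarrow> approximates (T i) (D i)"
  shows "approximates (\<lambda>t p y. \<Sum>i\<in>I. T i t p y) (\<lambda>p y. \<Sum>i\<in>I. D i p y)"
  using assms
proof (induction I rule: infinite_finite_induct)
  case (insert i I)
  then show ?case using approximates_add[of "T i" "D i"] by simp
qed (simp_all add: approximates_zero)

lemma approximates_funpow:
  assumes "approximates T D" shows "approximates (\<lambda>t. T t ^^ m) (D ^^ m)"
proof (induction m)
  case 0
  show ?case
    by (rule approximatesI) (auto intro!: bexI[OF _ pfam.base[OF polys.const[of 0]]])
next
  case (Suc m)
  then show ?case using approximates_comp[OF assms Suc] by (simp add: o_def)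
qed

lemma approximates_limit:
  assumes T: "approximates T D" and p: "p \<in> polys" and zero: "\<And>t. t \<noteq> 0 \<Longrightarrow> T t p = (\<lambda>y. 0)"
  shows "D p = (\<lambda>y. 0)"
proof
  fix y
  obtain K where K: "K \<in> pfam" "\<And>t. t \<noteq> 0 \<Longrightarrow> T t p = (\<lambda>y. D p y + of_real t * K t y)"
    using T p by (auto simp: approximates_def)
  have "D p y + of_real t * K t y = 0" if "t \<noteq> 0" for t
    using zero[OF that] K(2)[OF that] by (metis (mono_tags, lifting))
  then have "((\<lambda>t. D p y + of_real t * K t y) \<longlongrightarrow> 0) (at 0)"
    by (intro tendsto_eventually) (auto simp: eventually_at_filter)
  moreover have "isCont (\<lambda>t. D p y + of_real t * K t y) 0"
    by (intro continuous_intros pfam_isCont[OF K(1)])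
  then have "((\<lambda>t. D p y + of_real t * K t y) \<longlongrightarrow> D p y) (at 0)" by (simp add: isCont_def)
  ultimately show "D p y = 0" using tendsto_unique by (metis trivial_limit_at)
qed

section \<open>Difference quotients and their limit W(-iD)\<close>

definition forward_quotient :: "real^'n \<Rightarrow> real \<Rightarrow> (real^'n \<Rightarrow> complex) \<Rightarrow> real^'n \<Rightarrow> complex" where
  "forward_quotient v t p y = (p (y + t *\<^sub>R v) - p y) / of_real t"

lemma approximates_forward_quotient: "approximates (forward_quotient v) (dird v)"
proof (rule approximatesI)
  fix p :: "real^'a \<Rightarrow> complex" assume p: "p \<in> polys"
  obtain K where K: "K \<in> pfam" "\<And>t y. p (y + t *\<^sub>R v) = p y + of_real t * (dird v p y + of_real t * K t y)"
    using polys_expansion[OF p] by blast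
  show "\<exists>K\<in>pfam. \<forall>t. t \<noteq> 0 \<longrightarrow> forward_quotient v t p = (\<lambda>y. dird v p y + of_real t * K t y)"
    by (intro bexI[OF _ K(1)]) (simp add: fun_eq_iff forward_quotient_def K(2))
qed (auto simp: fun_eq_iff forward_quotient_def polys_dird add_divide_distrib diff_divide_distrib right_diff_distrib)

text \<open>Both kinds of differences reduce to forward quotients. The opposite direction in the
  inner quotient accounts for the limit minus the second derivative.\<close>

lemma second_diff_eq:
  "t \<noteq> 0 \<Longrightarrow> second_diff (t *\<^sub>R v) p y / of_real t ^ 2 = forward_quotient v t (forward_quotient (- v) t p) y"
  by (simp add: second_diff_def forward_quotient_def diff_divide_distrib[symmetric] power2_eq_square)

lemma central_diff_eq:
  "central_diff (t *\<^sub>R v) p y / of_real t = forward_quotient v t p y - forward_quotient (- v) t p y"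
  by (simp add: central_diff_def forward_quotient_def diff_divide_distrib[symmetric])

lemma quadratic_form_operator_polys:
  assumes "p \<in> polys"
  shows "quadratic_form_operator M p = (\<lambda>y. - (\<Sum>i\<in>UNIV. \<Sum>j\<in>UNIV. of_real (M $ i $ j) * dird (axis i 1) (dird (axis j 1) p) y))"
  unfolding fun_eq_iff quadratic_form_operator_def Let_def pderiv_at_eq_dird dird_cmult[OF polys_dird[OF assms]]
  by (simp add: sum_negf)

text \<open>After division by t^2 the second differences tend to -D_i^2. Two central differences
  give 4 D_i D_j, with coefficient -q_ij/2. By symmetry of Q^2 the sum over i < j covers both
  orders, and the total is minus the sum of q_ij D_i D_j, which is W(-iD).\<close>

lemma approximates_elliptic_diff:
  fixes Q :: "real^('n::{finite,linorder})^('n::{finite,linorder})"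
  assumes sym: "transpose Q = Q"
  shows "approximates (\<lambda>t p y. elliptic_diff Q t p y / of_real t ^ 2) (quadratic_form_operator (Q ** Q))"
proof -
  let ?M = "Q ** Q" and ?e = "\<lambda>i::'n. axis i (1::real)"
  let ?d = "\<lambda>i. dird (axis i 1)"
  let ?c = "\<lambda>i t p y. forward_quotient (?e i) t p y + - 1 * forward_quotient (- ?e i) t p y"
  let ?T = "\<lambda>t p y. (\<Sum>i\<in>UNIV. of_real (?M $ i $ i) * forward_quotient (?e i) t (forward_quotient (- ?e i) t p) y)
      + (\<Sum>r\<in>{(i, j). i < j}. of_real (- ?M $ fst r $ snd r / 2) * ?c (fst r) t (?c (snd r) t p) y)"
  let ?D = "\<lambda>p y. (\<Sum>i\<in>UNIV. of_real (?M $ i $ i) * dird (?e i) (dird (- ?e i) p) y)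
      + (\<Sum>r\<in>{(i, j). i < j}. of_real (- ?M $ fst r $ snd r / 2) *
         (\<lambda>p y. dird (?e (fst r)) p y + - 1 * dird (- ?e (fst r)) p y)
         ((\<lambda>p y. dird (?e (snd r)) p y + - 1 * dird (- ?e (snd r)) p y) p) y)"
  have approx: "approximates ?T ?D"
  proof -
    have second: "approximates (\<lambda>t p. forward_quotient (?e i) t (forward_quotient (- ?e i) t p))
        (\<lambda>p. dird (?e i) (dird (- ?e i) p))" for i
      by (rule approximates_comp[OF approximates_forward_quotient approximates_forward_quotient])
    have "approximates (?c i) (\<lambda>p y. dird (?e i) p y + - 1 * dird (- ?e i) p y)" for i
      by (rule approximates_add[OF approximates_forward_quotient approximates_cmult[OF approximates_forward_quotient]])
    from approximates_comp[OF this this]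
    have mixed: "approximates (\<lambda>t p. ?c i t (?c j t p))
        (\<lambda>p. (\<lambda>p y. dird (?e i) p y + - 1 * dird (- ?e i) p y) (\<lambda>y. dird (?e j) p y + - 1 * dird (- ?e j) p y))" for i j .
    have 1: "approximates (\<lambda>t p y. \<Sum>i\<in>UNIV. of_real (?M $ i $ i) * forward_quotient (?e i) t (forward_quotient (- ?e i) t p) y)
        (\<lambda>p y. \<Sum>i\<in>UNIV. of_real (?M $ i $ i) * dird (?e i) (dird (- ?e i) p) y)"
      by (rule approximates_sum, rule approximates_cmult, rule second)
    have 2: "approximates (\<lambda>t p y. \<Sum>r\<in>{(i, j). i < j}. of_real (- ?M $ fst r $ snd r / 2) * ?c (fst r) t (?c (snd r) t p) y)
        (\<lambda>p y. \<Sum>r\<in>{(i, j). i < j}. of_real (- ?M $ fst r $ snd r / 2) *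
         (\<lambda>p y. dird (?e (fst r)) p y + - 1 * dird (- ?e (fst r)) p y)
         (\<lambda>y. dird (?e (snd r)) p y + - 1 * dird (- ?e (snd r)) p y) y)"
      by (rule approximates_sum, rule approximates_cmult, rule mixed)
    show ?thesis by (rule approximates_add[OF 1 2])
  qed
  have neg: "dird (- v) p = (\<lambda>y. - dird v p y)" if "p \<in> polys" for v p
    using dird_scaled_direction[OF that, of "- 1" v] by (simp add: fun_eq_iff)
  have M_sym: "?M $ i $ j = ?M $ j $ i" for i j
  proof -
    have "transpose ?M = ?M" by (simp add: matrix_transpose_mul sym)
    moreover have "transpose ?M $ i $ j = ?M $ j $ i" by (simp add: transpose_def)
    ultimately show ?thesis by simp
  qed
  have D: "?D p = quadratic_form_operator ?M p" if p: "p \<in> polys" for p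
  proof
    fix y
    let ?f = "\<lambda>(i, j). complex_of_real (?M $ i $ j) * ?d i (?d j p) y"
    have "(\<Sum>i\<in>UNIV. \<Sum>j\<in>UNIV. of_real (?M $ i $ j) * ?d i (?d j p) y) = (\<Sum>r\<in>UNIV. ?f r)"
      by (simp add: sum.cartesian_product UNIV_Times_UNIV[symmetric] del: UNIV_Times_UNIV)
    also have "(UNIV :: ('n \<times> 'n) set) = {(i, j). i = j} \<union> ({(i, j). i < j} \<union> {(i, j). j < i})" by auto
    also have "sum ?f \<dots> = sum ?f {(i, j). i = j} + (sum ?f {(i, j). i < j} + sum ?f {(i, j). j < i})"
      by (subst sum.union_disjoint; (subst sum.union_disjoint)?) auto
    also have "sum ?f {(i, j). j < i} = sum ?f {(i, j). i < j}"
      by (rule sum.reindex_bij_witness[of _ prod.swap prod.swap])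
        (auto simp: dird_commute[OF p] M_sym)
    also have "sum ?f {(i, j). i = j} = (\<Sum>i\<in>UNIV. of_real (?M $ i $ i) * ?d i (?d i p) y)"
      by (rule sum.reindex_bij_witness[of _ "\<lambda>i. (i, i)" fst]) auto
    finally have "quadratic_form_operator ?M p y =
       - ((\<Sum>i\<in>UNIV. of_real (?M $ i $ i) * ?d i (?d i p) y) + 2 * sum ?f {(i, j). i < j})"
      by (simp add: quadratic_form_operator_polys[OF p])
    moreover have "?D p y = - (\<Sum>i\<in>UNIV. of_real (?M $ i $ i) * ?d i (?d i p) y) - 2 * sum ?f {(i, j). i < j}"
    proof -
      have 1: "dird (?e i) (dird (- ?e i) p) y = - ?d i (?d i p) y" for i
        using dird_cmult[OF polys_dird[OF p], of "?e i" "- 1" "?e i"] by (simp add: neg[OF p])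
      have 2: "(\<lambda>y. dird (?e j) p y + - 1 * dird (- ?e j) p y) = (\<lambda>y. 2 * ?d j p y)" for j
        by (simp add: neg[OF p])
      have pj: "(\<lambda>y. 2 * ?d j p y) \<in> polys" for j by (intro polys_cmult polys_dird p)
      show ?thesis
        unfolding 1 2 by (simp add: neg[OF pj] neg[OF polys_dird[OF p]] dird_cmult[OF polys_dird[OF p]] sum_negf sum_distrib_left split_beta mult_ac
            flip: sum_negf)
    qed
    ultimately show "?D p y = quadratic_form_operator ?M p y" by simp
  qed
  have eq: "elliptic_diff Q t p y / of_real t ^ 2 = ?T t p y" if "t \<noteq> 0" for t p y
  proof -
    have ax: "axis i t = t *\<^sub>R ?e i" for i by (simp add: vec_eq_iff axis_def)
    have c: "(\<lambda>y. ?c j t p y) = (\<lambda>y. (1 / of_real t) * central_diff (t *\<^sub>R ?e j) p y)" for j p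
      by (rule ext) (simp flip: central_diff_eq)
    have cl: "central_diff v (\<lambda>y. a * p y) y = a * central_diff v p y" for v a p y
      by (simp add: central_diff_def algebra_simps)
    have "?c i t (?c j t p) y = central_diff (t *\<^sub>R ?e i) (central_diff (t *\<^sub>R ?e j) p) y / of_real t ^ 2" for i j
      unfolding c using fun_cong[OF c[of i "\<lambda>y. (1 / of_real t) * central_diff (t *\<^sub>R ?e j) p y"], of y]
      by (simp only: cl) (simp add: power2_eq_square)
    then show ?thesis
      unfolding elliptic_diff_def ax second_diff_eq[OF that, symmetric] split_beta
      by (simp only: add_divide_distrib sum_divide_distrib) (simp add: mult_ac)
  qed
  show ?thesis
  proof (rule approximatesI)
    show "quadratic_form_operator ?M p \<in> polys" if "p \<in> polys" for p
      using approx D[OF that] that by (auto simp: approximates_def)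
    show "\<exists>K\<in>pfam. \<forall>t. t \<noteq> 0 \<longrightarrow> (\<lambda>y. elliptic_diff Q t p y / of_real t ^ 2) = (\<lambda>y. quadratic_form_operator ?M p y + of_real t * K t y)"
      if p: "p \<in> polys" for p
    proof -
      obtain K where K: "K \<in> pfam" "\<And>t. t \<noteq> 0 \<Longrightarrow> ?T t p = (\<lambda>y. ?D p y + of_real t * K t y)"
        using approx p unfolding approximates_def by blast
      show ?thesis
      proof (intro bexI[OF _ K(1)] allI impI ext)
        fix t :: real and y assume t: "t \<noteq> 0"
        show "elliptic_diff Q t p y / of_real t ^ 2 = quadratic_form_operator ?M p y + of_real t * K t y"
          unfolding eq[OF t] D[OF p, symmetric] by (rule fun_cong[OF K(2)[OF t]])
      qed
    qed
    have add: "elliptic_diff Q t (\<lambda>y. p y + q y) y = elliptic_diff Q t p y + elliptic_diff Q t q y" for t p q y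
      by (simp add: elliptic_diff_def second_diff_def central_diff_def sum.distrib[symmetric] split_beta algebra_simps)
    show "(\<lambda>y. elliptic_diff Q t (\<lambda>y. p y + q y) y / of_real t ^ 2) =
        (\<lambda>y. elliptic_diff Q t p y / of_real t ^ 2 + elliptic_diff Q t q y / of_real t ^ 2)" for t p q
      by (simp add: add add_divide_distrib)
    have mult: "elliptic_diff Q t (\<lambda>y. c * p y) y = c * elliptic_diff Q t p y" for t c p y
      by (simp add: elliptic_diff_def second_diff_def central_diff_def sum_distrib_left split_beta algebra_simps)
    show "(\<lambda>y. elliptic_diff Q t (\<lambda>y. c * p y) y / of_real t ^ 2) = (\<lambda>y. c * (elliptic_diff Q t p y / of_real t ^ 2))" for t c p
      by (simp add: mult)
  qed
qed

text \<open>The unit-step operator applied to p(t .) is the operator of step t applied to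
  \<open>p\<close>, evaluated at t x. Annihilation of all dilates thus gives annihilation of
  \<open>p\<close> for all nonzero step sizes, and the limit can be taken.\<close>

lemma kernel_of_elliptic_diff:
  fixes Q :: "real^('n::{finite,linorder})^('n::{finite,linorder})"
  assumes sym: "transpose Q = Q" and p: "p \<in> polys"
    and zero: "\<And>t. t \<noteq> 0 \<Longrightarrow> (elliptic_diff Q 1 ^^ m) (\<lambda>x. p (t *\<^sub>R x)) = (\<lambda>x. 0)"
  shows "(quadratic_form_operator (Q ** Q) ^^ m) p = (\<lambda>x. 0)"
proof (rule approximates_limit[OF approximates_funpow[OF approximates_elliptic_diff[OF sym]] p])
  fix t :: real assume t: "t \<noteq> 0"
  let ?T = "\<lambda>p y. elliptic_diff Q t p y / of_real t ^ 2"
  have scale: "elliptic_diff Q 1 (\<lambda>x. q (t *\<^sub>R x)) x = elliptic_diff Q t q (t *\<^sub>R x)" for q x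
  proof -
    have "axis i t = t *\<^sub>R axis i 1" for i :: 'n by (simp add: vec_eq_iff axis_def)
    then show ?thesis
      by (simp add: elliptic_diff_def second_diff_def central_diff_def algebra_simps split_beta)
  qed
  have cmult: "elliptic_diff Q s (\<lambda>x. c * q x) = (\<lambda>x. c * elliptic_diff Q s q x)" for s c q
    by (rule ext) (simp add: elliptic_diff_def second_diff_def central_diff_def sum_distrib_left split_beta algebra_simps)
  have pow: "(?T ^^ k) p (t *\<^sub>R x) = (1 / of_real t ^ 2) ^ k * (elliptic_diff Q 1 ^^ k) (\<lambda>x. p (t *\<^sub>R x)) x" for k x
  proof (induction k arbitrary: x)
    case (Suc k)
    have "(?T ^^ Suc k) p (t *\<^sub>R x) = (1 / of_real t ^ 2) * elliptic_diff Q 1 (\<lambda>x. (?T ^^ k) p (t *\<^sub>R x)) x"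
      by (simp add: scale)
    also have "\<dots> = (1 / of_real t ^ 2) * elliptic_diff Q 1 (\<lambda>x. (1 / of_real t ^ 2) ^ k * (elliptic_diff Q 1 ^^ k) (\<lambda>x. p (t *\<^sub>R x)) x) x"
      by (simp only: Suc)
    finally show ?case by (simp add: cmult)
  qed simp
  show "(?T ^^ m) p = (\<lambda>y. 0)"
  proof
    fix y
    have "(?T ^^ m) p (t *\<^sub>R ((1 / t) *\<^sub>R y)) = 0" unfolding pow zero[OF t] by simp
    then show "(?T ^^ m) p y = 0" using t by simp
  qed
qed

section \<open>Averages of polynomials\<close>

text \<open>Sums of products p(x) q(y). In this form p(x + y) integrated in x against a test
  function is visibly a polynomial in y.\<close>

inductive_set tensors :: "(real^'n \<Rightarrow> real^'n \<Rightarrow> complex) set" where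
  prod: "p \<in> polys \<Longrightarrow> q \<in> polys \<Longrightarrow> (\<lambda>x y. p x * q y) \<in> tensors"
| add: "K \<in> tensors \<Longrightarrow> L \<in> tensors \<Longrightarrow> (\<lambda>x y. K x y + L x y) \<in> tensors"

lemma tensors_coord:
  "K \<in> tensors \<Longrightarrow> (\<lambda>x y. of_real (x $ i) * K x y) \<in> tensors"
  "K \<in> tensors \<Longrightarrow> (\<lambda>x y. of_real (y $ i) * K x y) \<in> tensors"
proof (induction rule: tensors.induct)
  case (prod p q)
  {
    case 1
    then show ?case using tensors.prod[OF polys.coord[of p i], of q] prod by (simp add: mult_ac)
  next
    case 2
    then show ?case using tensors.prod[of p, OF _ polys.coord[of q i]] prod by (simp add: mult_ac)
  }
qed (auto simp: distrib_left intro: tensors.add)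

lemma polys_tensor: "p \<in> polys \<Longrightarrow> (\<lambda>x y. p (x + y)) \<in> tensors"
proof (induction rule: polys.induct)
  case (const c)
  then show ?case using tensors.prod[OF polys.const[of c] polys.const[of 1]] by simp
next
  case (coord p i)
  then show ?case
    using tensors.add[OF tensors_coord(1)[of "\<lambda>x y. p (x + y)" i] tensors_coord(2)[of "\<lambda>x y. p (x + y)" i]]
    by (simp add: algebra_simps)
qed (auto intro: tensors.add)

lemma polys_average:
  fixes p :: "real^'n \<Rightarrow> complex"
  assumes p: "p \<in> polys" and f: "test_function f"
  shows "(\<lambda>y. LINT x|lborel. p (x + y) * f x) \<in> polys"
proof -
  have "(\<lambda>y. LINT x|lborel. K x y * f x) \<in> polys \<and> (\<forall>y. integrable lborel (\<lambda>x. K x y * f x))"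
    if "K \<in> tensors" for K
    using that
  proof (induction rule: tensors.induct)
    case (prod p q)
    have int: "integrable lborel (\<lambda>x. p x * f x)" by (intro integrable_mult_test polys_continuous_on prod f)
    have eq: "p x * q y * f x = q y * (p x * f x)" for x y by simp
    show ?case
      unfolding eq integral_mult_right_zero
      using int polys_cmult[OF prod(2), of "LINT x|lborel. p x * f x"] by (simp add: mult.commute)
  next
    case (add K L)
    then show ?case by (simp add: distrib_right polys.add)
  qed
  from this[OF polys_tensor[OF p]] show ?thesis by blast
qed

section \<open>Pairing of coefficient sequences with finitely supported samples\<close>

definition fsupp :: "('a \<Rightarrow> complex) \<Rightarrow> bool" where
  "fsupp b \<longleftrightarrow> finite {n. b n \<noteq> 0}"

text \<open>Here \<open>d\<close> plays an arbitrary coefficient sequence and \<open>b\<close> the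
  finitely supported samples of a test function, so the sum is finite whatever the growth of
  \<open>d\<close>.\<close>

definition pairing :: "('a \<Rightarrow> complex) \<Rightarrow> ('a \<Rightarrow> complex) \<Rightarrow> complex" where
  "pairing d b = Sum_any (\<lambda>n. d n * b n)"

definition conv :: "('a::ab_group_add \<Rightarrow> complex) \<Rightarrow> ('a \<Rightarrow> complex) \<Rightarrow> 'a \<Rightarrow> complex" where
  "conv u v t = Sum_any (\<lambda>m. u m * v (t - m))"

text \<open>The shifts are opposite to those of \<open>diff_op\<close>: filtering the samples is
  adjoint to the difference operator acting on the coefficients.\<close>

definition tfilter :: "'n::finite trig \<Rightarrow> (int^'n \<Rightarrow> complex) \<Rightarrow> int^'n \<Rightarrow> complex" where
  "tfilter L b n = (\<Sum>(a, j)\<leftarrow>L. a * b (n + j))"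

lemma tfilter_simps [simp]:
  "tfilter [] b n = 0"
  "tfilter ((a, j) # L) b n = a * b (n + j) + tfilter L b n"
  by (simp_all add: tfilter_def)

lemma pairing_expand:
  assumes "finite A" "{n. b n \<noteq> 0} \<subseteq> A"
  shows "pairing d b = (\<Sum>n\<in>A. d n * b n)"
  unfolding pairing_def by (rule Sum_any.expand_superset) (use assms in auto)

lemma fsupp_mult: "fsupp b \<Longrightarrow> fsupp (\<lambda>n. d n * b n)"
  unfolding fsupp_def by (rule finite_subset[of _ "{n. b n \<noteq> 0}"]) auto

lemma fsupp_add: "fsupp b \<Longrightarrow> fsupp c \<Longrightarrow> fsupp (\<lambda>n. b n + c n)"
  unfolding fsupp_def by (rule finite_subset[of _ "{n. b n \<noteq> 0} \<union> {n. c n \<noteq> 0}"]) auto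

lemma fsupp_inj:
  assumes "fsupp b" "inj g" shows "fsupp (\<lambda>n. b (g n))"
  using finite_vimageI[OF assms(1)[unfolded fsupp_def] assms(2)] by (simp add: fsupp_def vimage_def)

lemma fsupp_tfilter: "fsupp b \<Longrightarrow> fsupp (tfilter L b)"
proof (induction L)
  case Nil
  then show ?case by (simp add: fsupp_def)
next
  case (Cons aj L)
  obtain a j where aj: "aj = (a, j)" by (cases aj)
  have eq: "tfilter (aj # L) b = (\<lambda>n. a * b (n + j) + tfilter L b n)" by (simp add: aj fun_eq_iff)
  show ?case unfolding eq
    by (intro fsupp_add fsupp_mult fsupp_inj[OF Cons.prems, of "\<lambda>n. n + j"] Cons) (simp add: inj_def)
qed

lemma pairing_add_right: "fsupp b \<Longrightarrow> fsupp c \<Longrightarrow> pairing d (\<lambda>n. b n + c n) = pairing d b + pairing d c"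
  unfolding pairing_def distrib_left
  by (rule Sum_any.distrib) (simp_all add: fsupp_mult[unfolded fsupp_def] fsupp_def del: mult_eq_0_iff)

lemma pairing_add_left: "fsupp b \<Longrightarrow> pairing (\<lambda>n. d n + e n) b = pairing d b + pairing e b"
  unfolding pairing_def distrib_right
  by (rule Sum_any.distrib) (simp_all add: fsupp_mult[unfolded fsupp_def] fsupp_def del: mult_eq_0_iff)

lemma pairing_cmult: "fsupp b \<Longrightarrow> pairing (\<lambda>n. c * d n) b = c * pairing d b"
  and pairing_cmult_right: "fsupp b \<Longrightarrow> pairing d (\<lambda>n. c * b n) = c * pairing d b"
  using Sum_any_right_distrib[of "\<lambda>n. d n * b n" c] fsupp_mult[of b d]
  by (simp_all add: pairing_def fsupp_def mult_ac)

lemma pairing_sum: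
  assumes "finite M" "\<And>m. m \<in> M \<Longrightarrow> fsupp (b m)"
  shows "pairing d (\<lambda>n. \<Sum>m\<in>M. b m n) = (\<Sum>m\<in>M. pairing d (b m))"
proof -
  let ?A = "\<Union>m\<in>M. {n. b m n \<noteq> 0}"
  have fin: "finite ?A" using assms by (simp add: fsupp_def)
  have "pairing d (\<lambda>n. \<Sum>m\<in>M. b m n) = (\<Sum>n\<in>?A. d n * (\<Sum>m\<in>M. b m n))"
    by (rule pairing_expand[OF fin]) (auto elim: sum.not_neutral_contains_not_neutral)
  also have "\<dots> = (\<Sum>m\<in>M. \<Sum>n\<in>?A. d n * b m n)"
    unfolding sum_distrib_left by (rule sum.swap)
  also have "\<dots> = (\<Sum>m\<in>M. pairing d (b m))"
    by (intro sum.cong refl pairing_expand[OF fin, symmetric]) auto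
  finally show ?thesis .
qed

lemma pairing_shift: "pairing d (\<lambda>n. b (n + j)) = pairing (\<lambda>n. d (n - j)) b" for j :: "'a::ab_group_add"
  unfolding pairing_def
  by (rule Sum_any.reindex_cong[symmetric, of "\<lambda>n. n + j"])
    (auto simp: o_def intro!: bij_betw_byWitness[where f' = "\<lambda>n. n - j"])

lemma pairing_tfilter:
  assumes "fsupp b"
  shows "pairing d (tfilter L b) = pairing (\<lambda>n. \<Sum>(a, j)\<leftarrow>L. a * d (n - j)) b"
proof (induction L)
  case Nil
  have "pairing d (tfilter [] b) = 0" by (simp add: pairing_def)
  then show ?case by (simp add: pairing_def)
next
  case (Cons aj L)
  obtain a j where aj: "aj = (a, j)" by (cases aj)
  have b: "fsupp (\<lambda>n. b (n + j))" by (rule fsupp_inj[OF assms, of "\<lambda>n. n + j"]) (simp add: inj_def)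
  have eq: "tfilter (aj # L) b = (\<lambda>n. a * b (n + j) + tfilter L b n)" by (simp add: aj fun_eq_iff)
  have "pairing d (tfilter (aj # L) b) = a * pairing d (\<lambda>n. b (n + j)) + pairing d (tfilter L b)"
    unfolding eq by (simp add: pairing_add_right fsupp_mult b fsupp_tfilter assms pairing_cmult_right)
  also have "\<dots> = pairing (\<lambda>n. a * d (n - j) + (\<Sum>(a, j)\<leftarrow>L. a * d (n - j))) b"
    by (simp add: pairing_add_left[OF assms] pairing_cmult[OF assms] pairing_shift Cons)
  finally show ?case unfolding aj by (simp del: tfilter_simps)
qed

text \<open>With \<open>g\<close> the multiplication by A, the coefficients are moved to the
  sublattice A Z^d and extended by 0. The support on this sublattice is what makes the character
  invisible to them.\<close>

definition upsample :: "('a \<Rightarrow> 'a) \<Rightarrow> ('a \<Rightarrow> 'b::zero) \<Rightarrow> 'a \<Rightarrow> 'b" where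
  "upsample g c n = (if n \<in> range g then c (inv g n) else 0)"

lemma pairing_upsample:
  assumes "inj g" "fsupp b"
  shows "pairing c (\<lambda>k. b (g k)) = pairing (upsample g c) b"
proof -
  let ?A = "{n. b n \<noteq> 0}"
  have fin: "finite ?A" "finite (g -` ?A)" using finite_vimageI[OF assms(2)[unfolded fsupp_def] assms(1)] assms(2) by (simp_all add: fsupp_def)
  have "pairing c (\<lambda>k. b (g k)) = (\<Sum>k\<in>g -` ?A. c k * b (g k))"
    by (rule pairing_expand[OF fin(2)]) auto
  also have "\<dots> = (\<Sum>k\<in>g -` ?A. upsample g c (g k) * b (g k))"
    by (intro sum.cong) (auto simp: upsample_def inv_f_f[OF assms(1)])
  also have "\<dots> = (\<Sum>n\<in>g ` (g -` ?A). upsample g c n * b n)"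
    using assms(1) by (subst sum.reindex) (auto simp: inj_on_def inj_def)
  also have "\<dots> = (\<Sum>n\<in>?A. upsample g c n * b n)"
    using fin by (intro sum.mono_neutral_left) (auto simp: upsample_def)
  also have "\<dots> = pairing (upsample g c) b"
    by (rule pairing_expand[OF fin(1), symmetric]) auto
  finally show ?thesis .
qed

text \<open>Collects a weighted sum of shifted pairings into one pairing with a convolution, where a
  character can be moved between the factors.\<close>

lemma sum_pairing_conv:
  fixes u v :: "'a::ab_group_add \<Rightarrow> complex"
  assumes u: "fsupp u" and v: "fsupp v"
  shows "Sum_any (\<lambda>m. u m * pairing d (\<lambda>k. v (k - n - m))) = pairing d (\<lambda>k. conv u v (k - n))"
proof -
  let ?M = "{m. u m \<noteq> 0}"
  have fin: "finite ?M" using u by (simp add: fsupp_def)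
  have c: "conv u v t = (\<Sum>m\<in>?M. u m * v (t - m))" for t
    unfolding conv_def by (rule Sum_any.expand_superset[OF fin]) auto
  have v': "fsupp (\<lambda>k. v (k - n - m))" for m
    by (rule fsupp_inj[OF v, of "\<lambda>k. k - n - m"]) (simp add: inj_def)
  have "Sum_any (\<lambda>m. u m * pairing d (\<lambda>k. v (k - n - m))) = (\<Sum>m\<in>?M. u m * pairing d (\<lambda>k. v (k - n - m)))"
    by (rule Sum_any.expand_superset[OF fin]) auto
  also have "\<dots> = (\<Sum>m\<in>?M. pairing d (\<lambda>k. u m * v (k - n - m)))"
    by (simp add: pairing_cmult_right[OF v'])
  also have "\<dots> = pairing d (\<lambda>k. conv u v (k - n))"
    unfolding c by (rule pairing_sum[symmetric]) (auto intro: fin fsupp_mult v')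
  finally show "Sum_any (\<lambda>m. u m * pairing d (\<lambda>k. v (k - n - m))) = pairing d (\<lambda>k. conv u v (k - n))" .
qed

text \<open>Substituting t - m for m and splitting the character at t - m exchanges the factors, at
  the price of the character at t.\<close>

lemma conv_character:
  fixes \<psi> :: "'a::ab_group_add \<Rightarrow> complex"
  assumes \<psi>: "\<And>m n. \<psi> (m + n) = \<psi> m * \<psi> n" and v: "fsupp v"
  shows "conv (\<lambda>m. \<psi> m * u m) v t = \<psi> t * conv (\<lambda>m. \<psi> (- m) * v m) u t"
proof -
  have "conv (\<lambda>m. \<psi> m * u m) v t = Sum_any (\<lambda>m. \<psi> (t - m) * u (t - m) * v m)"
    unfolding conv_def
    by (rule Sum_any.reindex_cong[symmetric, of "\<lambda>m. t - m", symmetric])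
      (auto simp: o_def intro!: bij_betw_byWitness[where f' = "\<lambda>m. t - m"])
  also have "\<dots> = Sum_any (\<lambda>m. \<psi> t * (\<psi> (- m) * v m * u (t - m)))"
    using \<psi>[of t "- m" for m] by (simp add: mult_ac)
  also have "\<dots> = \<psi> t * conv (\<lambda>m. \<psi> (- m) * v m) u t"
    unfolding conv_def
    by (rule Sum_any_right_distrib[symmetric], rule finite_subset[OF _ v[unfolded fsupp_def]]) auto
  finally show ?thesis .
qed

section \<open>Polynomials reproduced by elliptic scaling functions\<close>

locale elliptic_scaling = elliptic A Q U
  for A Q U :: "real^('n::{finite,linorder})^('n::{finite,linorder})" +
  fixes m :: nat and \<phi> :: "('n::{finite,linorder}) distr"
  assumes scaling: "scaling_function_of_order m A (elliptic_mask A Q) \<phi>"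
begin

definition F where "F \<xi> = complex_of_real (mask_product A mask \<xi>) ^ m"

lemma ft: "has_fourier_transform \<phi> F" and cs: "compactly_supported \<phi>"
  using scaling by (simp_all add: scaling_function_of_order_def F_def[abs_def])

lemma isCont_F: "isCont F p"
  unfolding F_def by (intro continuous_intros isCont_mask_product)

lemma F_refine: "F (transpose A *v \<zeta>) = of_real (mask \<zeta>) ^ m * F \<zeta>"
  unfolding F_def mask_product_refine by (simp add: power_mult_distrib)

definition sample where "sample f k = \<phi> (\<lambda>x. f (x + intvec k))"

lemma fsupp_sample: "test_function f \<Longrightarrow> fsupp (sample f)"
  using finite_shift_support[OF cs] by (simp add: fsupp_def sample_def)

lemma sample_shift: "sample (\<lambda>x. f (x + intvec j)) k = sample f (k + j)"
  by (simp add: sample_def intvec_add add_ac)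

definition span_coeffs where
  "span_coeffs c P \<longleftrightarrow> (\<forall>f. test_function f \<longrightarrow>
     pairing (\<lambda>k. complex_of_real (c k)) (sample f) = (LINT x|lborel. of_real (P x) * f x))"

lemma has_sum_iff_Sum_any:
  fixes g :: "'a \<Rightarrow> complex"
  assumes "finite {k. g k \<noteq> 0}"
  shows "(g has_sum s) UNIV \<longleftrightarrow> Sum_any g = s"
proof -
  let ?S = "{k. g k \<noteq> 0}"
  have "(g has_sum s) UNIV \<longleftrightarrow> (g has_sum s) ?S"
    by (rule has_sum_cong_neutral) auto
  also have "\<dots> \<longleftrightarrow> sum g ?S = s"
    using has_sum_finite[OF assms] has_sum_unique by metis
  also have "sum g ?S = Sum_any g"
    by (rule Sum_any.expand_superset[symmetric]) (use assms in auto)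
  finally show ?thesis .
qed

lemma reproduced_iff: "P \<in> reproduced_polynomials \<phi> \<longleftrightarrow> P \<in> polys \<and> (\<exists>c. span_coeffs c P)"
proof -
  have "((\<lambda>k. of_real (c k) * \<phi> (\<lambda>x. f (x + (\<chi> i. real_of_int (k $ i))))) has_sum s) UNIV
      \<longleftrightarrow> pairing (\<lambda>k. of_real (c k)) (sample f) = s" if "test_function f" for c f s
    unfolding pairing_def sample_def intvec_def[symmetric]
    by (rule has_sum_iff_Sum_any)
      (use fsupp_mult[OF fsupp_sample[OF that], of "\<lambda>k. of_real (c k)"] in \<open>simp add: fsupp_def sample_def\<close>)
  then show ?thesis
    by (simp add: reproduced_polynomials_def real_polynomial_function_iff_polys in_shift_span_def span_coeffs_def)
qed

abbreviation V where "V \<equiv> reproduced_polynomials \<phi>"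

lemma integrable_poly_test:
  assumes "P \<in> polys" "test_function f"
  shows "integrable lborel (\<lambda>x. complex_of_real (P x) * f x)"
  by (intro integrable_mult_test polys_continuous_on polys_of_real assms)

lemma fsubspace_V: "fsubspace V"
  unfolding fsubspace_def
proof (intro conjI ballI allI)
  have "span_coeffs (\<lambda>k. 0) (\<lambda>x. 0)" by (simp add: span_coeffs_def pairing_def)
  then show "(\<lambda>x. 0) \<in> V" by (auto simp: reproduced_iff intro: polys.const)
  fix P assume "P \<in> V"
  then obtain c where P: "P \<in> polys" and c: "span_coeffs c P" by (auto simp: reproduced_iff)
  have "span_coeffs (\<lambda>k. a * c k) (\<lambda>x. a * P x)" for a
    using c by (simp add: span_coeffs_def pairing_cmult fsupp_sample mult.assoc)
  then show "(\<lambda>x. a * P x) \<in> V" for a using P by (auto simp: reproduced_iff intro: polys_cmult)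
  fix R assume "R \<in> V"
  then obtain d where R: "R \<in> polys" and d: "span_coeffs d R" by (auto simp: reproduced_iff)
  have "span_coeffs (\<lambda>k. c k + d k) (\<lambda>x. P x + R x)"
    using c d by (simp add: span_coeffs_def pairing_add_left fsupp_sample distrib_right integrable_poly_test P R)
  then show "(\<lambda>x. P x + R x) \<in> V" using P R by (auto simp: reproduced_iff intro: polys.add)
qed

lemma V_int_shift:
  assumes "P \<in> V" shows "(\<lambda>x. P (x + intvec n)) \<in> V"
proof -
  obtain c where P: "P \<in> polys" and c: "span_coeffs c P" using assms by (auto simp: reproduced_iff)
  have "span_coeffs (\<lambda>k. c (k + n)) (\<lambda>x. P (x + intvec n))"
    unfolding span_coeffs_def
  proof (intro allI impI)
    fix f :: "real^('n::{finite,linorder}) \<Rightarrow> complex" assume f: "test_function f"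
    have "(LINT x|lborel. of_real (P (x + intvec n)) * f x) = (LINT x|lborel. of_real (P (x + intvec n)) * f (x + intvec n + intvec (- n)))"
      by (simp add: intvec_minus)
    also have "\<dots> = (LINT x|lborel. of_real (P x) * f (x + intvec (- n)))"
      by (rule lborel_integral_shift[of "\<lambda>x. of_real (P x) * f (x + intvec (- n))"])
    also have "\<dots> = pairing (\<lambda>k. of_real (c k)) (\<lambda>k. sample f (k + - n))"
    proof -
      have "sample (\<lambda>x. f (x + intvec (- n))) = (\<lambda>k. sample f (k + - n))" by (rule ext) (rule sample_shift)
      then show ?thesis
        using c test_function_shift[OF f, of "intvec (- n)"] unfolding span_coeffs_def by metis
    qed
    also have "\<dots> = pairing (\<lambda>k. of_real (c (k - - n))) (sample f)" by (rule pairing_shift)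
    finally show "pairing (\<lambda>k. of_real (c (k + n))) (sample f) = (LINT x|lborel. of_real (P (x + intvec n)) * f x)"
      by simp
  qed
  then show ?thesis using P by (auto simp: reproduced_iff intro: polys_shift)
qed

text \<open>The equation F(A^T \<zeta>) = m_0(\<zeta>)^m F(\<zeta>) in terms of test functions, with
  the Jacobians collected in \<open>\<kappa>\<close>. The constant is chosen before the term list:
  dilation invariance uses a list with real coefficients, the annihilation argument one that
  displays the factors of the mask.\<close>

lemma refinement:
  obtains \<kappa> :: real where "\<kappa> > 0"
    "\<And>L f. (\<And>\<zeta>. teval L \<zeta> = of_real (mask \<zeta>) ^ m) \<Longrightarrow> test_function f \<Longrightarrow>
       \<phi> (\<lambda>x. f (A *v x)) = of_real \<kappa> * tfilter L (sample f) 0"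
proof -
  obtain \<kappa>1 where \<kappa>1: "\<kappa>1 > 0"
    "\<And>f \<xi>. inv_fourier (\<lambda>x. f (A *v x)) \<xi> = of_real \<kappa>1 * inv_fourier f (B *v \<xi>)"
    using inv_fourier_linear[OF invertible_A] by blast
  obtain \<kappa>2 where \<kappa>2: "\<kappa>2 > 0"
    "\<And>g. (LINT x|lborel. g (transpose A *v x)) = \<kappa>2 *\<^sub>R (LINT x|lborel. g x :: complex)"
    using linear_substitution[OF invertible_transpose'[OF invertible_A], where 'b = complex] by metis
  show ?thesis
  proof (rule that[of "\<kappa>1 / \<kappa>2"])
    show "\<kappa>1 / \<kappa>2 > 0" using \<kappa>1 \<kappa>2 by simp
    fix L and f :: "real^('n::{finite,linorder}) \<Rightarrow> complex"
    assume L: "\<And>\<zeta>. teval L \<zeta> = of_real (mask \<zeta>) ^ m" and f: "test_function f"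
    \<comment> \<open>Under the integral against F, the character of the term with shift j
      translates the test function by j, so a symbol becomes a filter of samples. Integrability is
      carried along for additivity.\<close>
    have filter: "(LINT \<zeta>|lborel. teval M \<zeta> * (F \<zeta> * inv_fourier f \<zeta>)) = tfilter M (sample f) 0
      \<and> integrable lborel (\<lambda>\<zeta>. teval M \<zeta> * (F \<zeta> * inv_fourier f \<zeta>))" for M
    proof (induction M)
      case (Cons aj M)
      obtain a j where aj: "aj = (a, j)" by (cases aj)
      note d = distr_test_function[OF ft test_function_shift[OF f, of "intvec j"], unfolded inv_fourier_shift]
      have eq: "teval (aj # M) \<zeta> * (F \<zeta> * inv_fourier f \<zeta>)
        = a * (F \<zeta> * (cis (- (\<zeta> \<bullet> intvec j)) * inv_fourier f \<zeta>)) + teval M \<zeta> * (F \<zeta> * inv_fourier f \<zeta>)" for \<zeta>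
        by (simp add: aj algebra_simps)
      show ?case unfolding eq using Cons d by (simp add: aj sample_def)
    qed simp
    have "\<phi> (\<lambda>x. f (A *v x)) = (LINT \<xi>|lborel. F \<xi> * inv_fourier (\<lambda>x. f (A *v x)) \<xi>)"
      by (rule distr_test_function(2)[OF ft test_function_linear[OF f invertible_A]])
    also have "\<dots> = of_real \<kappa>1 * (LINT \<xi>|lborel. F \<xi> * inv_fourier f (B *v \<xi>))"
      unfolding \<kappa>1(2) integral_mult_right_zero[symmetric] by (simp add: mult_ac)
    also have "(LINT \<xi>|lborel. F \<xi> * inv_fourier f (B *v \<xi>))
      = (1 / \<kappa>2) *\<^sub>R (LINT \<zeta>|lborel. F (transpose A *v \<zeta>) * inv_fourier f (B *v (transpose A *v \<zeta>)))"
      using \<kappa>2(1) by (subst \<kappa>2(2)[of "\<lambda>\<xi>. F \<xi> * inv_fourier f (B *v \<xi>)"]) simp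
    also have "(LINT \<zeta>|lborel. F (transpose A *v \<zeta>) * inv_fourier f (B *v (transpose A *v \<zeta>)))
      = (LINT \<zeta>|lborel. teval L \<zeta> * (F \<zeta> * inv_fourier f \<zeta>))"
      by (simp only: F_refine matrix_vector_mul_assoc AB matrix_vector_mul_lid L mult.assoc)
    also have "\<dots> = tfilter L (sample f) 0" using filter by blast
    finally show "\<phi> (\<lambda>x. f (A *v x)) = of_real (\<kappa>1 / \<kappa>2) * tfilter L (sample f) 0"
      by (simp add: scaleR_conv_of_real)
  qed
qed

section \<open>Dilations of reproduced polynomials\<close>

definition iA where "iA k = (SOME k'. A *v intvec k = intvec k')"

lemma iA: "A *v intvec k = intvec (iA k)"
  unfolding iA_def by (rule someI_ex[OF A_intvec])

lemma inj_iA: "inj iA"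
proof (rule injI)
  fix k l assume "iA k = iA l"
  then have "A *v intvec k = A *v intvec l" by (simp add: iA)
  then have "matrix_inv A *v (A *v intvec k) = matrix_inv A *v (A *v intvec l)" by simp
  then show "k = l" by (simp add: matrix_vector_mul_assoc matrix_inv_mult[OF invertible_A])
qed

definition A' where "A' = matrix_inv A"

lemma AA': "A ** A' = mat 1" "A' ** A = mat 1"
  using matrix_inv_mult[OF invertible_A] by (simp_all add: A'_def)

text \<open>Expanding each shift of the dilated distribution by the refinement equation represents P
  o A^(-1) with coefficients living on A Z^d, followed by a filter. The constant is uniform, since
  the annihilation argument compares the identity for two test functions.\<close>

lemma integral_refined:
  "\<exists>K :: real. K > 0 \<and> (\<forall>L c P f. (\<forall>\<zeta>. teval L \<zeta> = of_real (mask \<zeta>) ^ m) \<longrightarrow> span_coeffs c P \<longrightarrow> test_function f \<longrightarrow>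
      (LINT x|lborel. of_real (P (A' *v x)) * f x)
        = of_real K * pairing (upsample iA (\<lambda>k. of_real (c k))) (tfilter L (sample f)))"
proof -
  obtain \<kappa> :: real where \<kappa>: "\<kappa> > 0"
    "\<And>L f. (\<And>\<zeta>. teval L \<zeta> = of_real (mask \<zeta>) ^ m) \<Longrightarrow> test_function f \<Longrightarrow>
       \<phi> (\<lambda>x. f (A *v x)) = of_real \<kappa> * tfilter L (sample f) 0"
    using refinement by blast
  obtain \<mu> where \<mu>: "\<mu> > 0"
    "\<And>g. (LINT x|lborel. g (A *v x)) = \<mu> *\<^sub>R (LINT x|lborel. g x :: complex)"
    using linear_substitution[OF invertible_A, where 'b = complex] by metis
  show ?thesis
  proof (intro exI[of _ "\<kappa> / \<mu>"] conjI allI impI)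
    show "\<kappa> / \<mu> > 0" using \<kappa> \<mu> by simp
    fix L c P and f :: "real^('n::{finite,linorder}) \<Rightarrow> complex"
    assume L: "\<forall>\<zeta>. teval L \<zeta> = of_real (mask \<zeta>) ^ m" and c: "span_coeffs c P" and f: "test_function f"
    let ?fA = "\<lambda>x. f (A *v x)"
    have fA: "test_function ?fA" by (rule test_function_linear[OF f invertible_A])
    have sample: "sample ?fA k = of_real \<kappa> * tfilter L (sample f) (iA k)" for k
    proof -
      have "sample ?fA k = \<phi> (\<lambda>x. (\<lambda>y. f (y + intvec (iA k))) (A *v x))"
        by (simp add: sample_def matrix_vector_right_distrib iA)
      also have "\<dots> = of_real \<kappa> * tfilter L (sample (\<lambda>y. f (y + intvec (iA k)))) 0"
        by (rule \<kappa>(2)[OF spec[OF L] test_function_shift[OF f]])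
      finally show ?thesis by (simp add: tfilter_def sample_shift add.commute)
    qed
    have "(LINT x|lborel. of_real (P (A' *v x)) * f x)
      = (1 / \<mu>) *\<^sub>R (LINT x|lborel. of_real (P (A' *v (A *v x))) * f (A *v x))"
      using \<mu>(1) by (subst \<mu>(2)[of "\<lambda>x. of_real (P (A' *v x)) * f x"]) simp
    also have "(LINT x|lborel. of_real (P (A' *v (A *v x))) * f (A *v x)) = (LINT x|lborel. of_real (P x) * ?fA x)"
      by (simp add: matrix_vector_mul_assoc AA')
    also have "\<dots> = pairing (\<lambda>k. of_real (c k)) (sample ?fA)" using c fA by (simp add: span_coeffs_def)
    also have "\<dots> = pairing (\<lambda>k. of_real (c k)) (\<lambda>k. of_real \<kappa> * tfilter L (sample f) (iA k))"
      by (simp add: sample[abs_def])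
    also have "\<dots> = of_real \<kappa> * pairing (\<lambda>k. of_real (c k)) (\<lambda>k. tfilter L (sample f) (iA k))"
      by (rule pairing_cmult_right) (rule fsupp_inj[OF fsupp_tfilter[OF fsupp_sample[OF f]] inj_iA])
    also have "pairing (\<lambda>k. of_real (c k)) (\<lambda>k. tfilter L (sample f) (iA k))
      = pairing (upsample iA (\<lambda>k. of_real (c k))) (tfilter L (sample f))"
      by (rule pairing_upsample[OF inj_iA fsupp_tfilter[OF fsupp_sample[OF f]]])
    finally show "(LINT x|lborel. of_real (P (A' *v x)) * f x)
        = of_real (\<kappa> / \<mu>) * pairing (upsample iA (\<lambda>k. of_real (c k))) (tfilter L (sample f))"
      by (simp add: scaleR_conv_of_real)
  qed
qed

text \<open>The filter passes to the upsampled coefficients by adjointness. They stay real because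
  the term list comes from \<open>even_teval_real_coeffs\<close>.\<close>

lemma V_dilate:
  assumes "P \<in> V" shows "(\<lambda>x. P (A' *v x)) \<in> V"
proof -
  obtain c where P: "P \<in> polys" and c: "span_coeffs c P" using assms by (auto simp: reproduced_iff)
  obtain ss where ss: "distinct ss" "set ss = digits" using finite_distinct_list[OF finite_digits] by blast
  have T: "teval (tpow (mask_trig ss) m) \<zeta> = of_real (mask \<zeta> ^ m)" for \<zeta>
    by (simp add: teval_tpow teval_mask_trig[OF ss])
  have T_even: "mask (- \<zeta>) ^ m = mask \<zeta> ^ m" for \<zeta> by (simp only: mask_even)
  obtain L where L: "\<And>\<zeta>. teval (map (\<lambda>(a, j). (of_real a, j)) L) \<zeta> = of_real (mask \<zeta> ^ m)"
    using even_teval_real_coeffs[OF T T_even] by blast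
  let ?L = "map (\<lambda>(a, j). (complex_of_real a, j)) L"
  obtain K :: real where "K > 0" and K:
    "\<forall>L c P f. (\<forall>\<zeta>. teval L \<zeta> = of_real (mask \<zeta>) ^ m) \<longrightarrow> span_coeffs c P \<longrightarrow> test_function f \<longrightarrow>
      (LINT x|lborel. of_real (P (A' *v x)) * f x)
        = of_real K * pairing (upsample iA (\<lambda>k. of_real (c k))) (tfilter L (sample f))"
    using integral_refined by blast
  define d where "d n = K * (\<Sum>(a, j)\<leftarrow>L. a * upsample iA c (n - j))" for n
  have up: "upsample iA (\<lambda>k. complex_of_real (c k)) n = of_real (upsample iA c n)" for n
    by (simp add: upsample_def)
  have d: "complex_of_real (d n) = of_real K * (\<Sum>(a, j)\<leftarrow>?L. a * upsample iA (\<lambda>k. of_real (c k)) (n - j))" for n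
    unfolding d_def up of_real_mult by (induction L) auto
  have "span_coeffs d (\<lambda>x. P (A' *v x))"
    unfolding span_coeffs_def
  proof (intro allI impI)
    fix f :: "real^('n::{finite,linorder}) \<Rightarrow> complex" assume f: "test_function f"
    have "(LINT x|lborel. of_real (P (A' *v x)) * f x)
        = of_real K * pairing (upsample iA (\<lambda>k. of_real (c k))) (tfilter ?L (sample f))"
      by (rule K[rule_format, OF _ c f]) (simp add: L)
    then show "pairing (\<lambda>k. complex_of_real (d k)) (sample f) = (LINT x|lborel. of_real (P (A' *v x)) * f x)"
      by (simp only: d pairing_cmult[OF fsupp_sample[OF f]] pairing_tfilter[OF fsupp_sample[OF f]])
  qed
  then show ?thesis using P by (auto simp: reproduced_iff intro: polys_linear)
qed

section \<open>Homogeneous parts, scalings and real shifts\<close>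

lemma V_dilate_power: "P \<in> V \<Longrightarrow> (\<lambda>x. P (((\<lambda>x. A' *v x) ^^ n) x)) \<in> V"
proof (induction n arbitrary: P)
  case (Suc n)
  have "(\<lambda>x. (\<lambda>y. P (A' *v y)) (((\<lambda>x. A' *v x) ^^ n) x)) \<in> V" by (rule Suc.IH[OF V_dilate[OF Suc.prems]])
  then show ?case by simp
qed simp

lemma funpow_A'_matrix: "\<exists>M. \<forall>x. ((\<lambda>x. A' *v x) ^^ n) x = M *v x"
proof (induction n)
  case 0
  show ?case by (intro exI[of _ "mat 1"]) simp
next
  case (Suc n)
  then obtain M where "\<forall>x. ((\<lambda>x. A' *v x) ^^ n) x = M *v x" by blast
  then show ?case by (intro exI[of _ "A' ** M"]) (simp add: matrix_vector_mul_assoc)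
qed

text \<open>
  The rescaled powers of \<open>A'\<close> accumulate at the identity, so the lowest homogeneous part of an
  element of \<open>V\<close> is a limit of its dilates; stopping one power earlier yields its composition with \<open>A\<close>.
\<close>

lemma V_lowest_part:
  assumes h: "\<And>i. h i \<in> hpoly i" and R: "(\<lambda>x. \<Sum>i\<in>{j..<N}. h i x) \<in> V" and j: "j < N"
  shows "h j \<in> V" "(\<lambda>x. h j (A *v x)) \<in> V"
proof -
  define R where "R = (\<lambda>x. \<Sum>i\<in>{j..<N}. h i x)"
  \<comment> \<open>The elements of \<open>V\<close> of degree below \<open>N\<close>: a
    finite-dimensional space containing all dilates of \<open>R\<close> in question, so their
    pointwise limits stay in it.\<close>
  define W where "W = {P \<in> V. \<exists>g. (\<forall>i. g i \<in> hpoly i) \<and> P = (\<lambda>x. \<Sum>i<N. g i x)}"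
  obtain F :: "(real^('n::{finite,linorder}) \<Rightarrow> real) set" where F: "finite F" "\<And>g. (\<forall>i. g i \<in> hpoly i) \<Longrightarrow> (\<lambda>x. \<Sum>i<N. g i x) \<in> fspan F"
    using hpoly_sums_finite_span by blast
  have WF: "W \<subseteq> fspan F" unfolding W_def using F(2) by blast
  have WI: "P \<in> W" if "P \<in> V" "\<And>i. g i \<in> hpoly i" "P = (\<lambda>x. \<Sum>i<N. g i x)" for P g
    unfolding W_def using that by (intro CollectI conjI exI[of _ g]) auto
  have Wsub: "fsubspace W"
    unfolding fsubspace_def
  proof (intro conjI ballI allI)
    show "(\<lambda>x. 0) \<in> W"
      using fsubspace_V by (intro WI[where g = "\<lambda>i x. 0"]) (simp_all add: fsubspace_def hpoly_0)
    fix p assume "p \<in> W"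
    then obtain g where p: "p \<in> V" and g: "\<And>i. g i \<in> hpoly i" "p = (\<lambda>x. \<Sum>i<N. g i x)" by (auto simp: W_def)
    show "(\<lambda>x. a * p x) \<in> W" for a
    proof (rule WI[where g = "\<lambda>i x. a * g i x"])
      show "(\<lambda>x. a * p x) \<in> V" by (rule fsubspace_cmult[OF fsubspace_V p])
      show "(\<lambda>x. a * g i x) \<in> hpoly i" for i by (rule hpoly_cmult[OF g(1)])
    qed (simp add: g(2) sum_distrib_left)
    fix q assume "q \<in> W"
    then obtain g' where q: "q \<in> V" and g': "\<And>i. g' i \<in> hpoly i" "q = (\<lambda>x. \<Sum>i<N. g' i x)" by (auto simp: W_def)
    show "(\<lambda>x. p x + q x) \<in> W"
    proof (rule WI[where g = "\<lambda>i x. g i x + g' i x"])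
      show "(\<lambda>x. p x + q x) \<in> V" by (rule fsubspace_add[OF fsubspace_V p q])
      show "(\<lambda>x. g i x + g' i x) \<in> hpoly i" for i by (rule hpoly_add[OF g(1) g'(1)])
    qed (simp add: g(2) g'(2) sum.distrib)
  qed
  have dil: "(\<lambda>x. a * R (((\<lambda>x. A' *v x) ^^ n) x)) \<in> W" for a n
  proof -
    obtain M where M: "\<And>x. ((\<lambda>x. A' *v x) ^^ n) x = M *v x" using funpow_A'_matrix by blast
    have "(\<lambda>x. R (((\<lambda>x. A' *v x) ^^ n) x)) \<in> V" using V_dilate_power R unfolding R_def by blast
    then have R_V: "(\<lambda>x. a * R (((\<lambda>x. A' *v x) ^^ n) x)) \<in> V" by (rule fsubspace_cmult[OF fsubspace_V])
    define g where "g = (\<lambda>i x. if j \<le> i then a * h i (M *v x) else 0)"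
    have g: "g i \<in> hpoly i" for i
      by (cases "j \<le> i") (simp_all add: g_def hpoly_0 hpoly_cmult hpoly_linear h)
    have sum: "(\<lambda>x. a * R (((\<lambda>x. A' *v x) ^^ n) x)) = (\<lambda>x. \<Sum>i<N. g i x)"
    proof
      fix x
      have "(\<Sum>i<N. g i x) = (\<Sum>i\<in>{j..<N}. g i x)"
        by (rule sum.mono_neutral_right) (auto simp: g_def)
      then show "a * R (((\<lambda>x. A' *v x) ^^ n) x) = (\<Sum>i<N. g i x)"
        by (simp add: R_def M g_def sum_distrib_left)
    qed
    show ?thesis by (rule WI[OF R_V g sum])
  qed
  obtain A'' n where A'': "A ** A'' = mat 1" "A'' ** A = mat 1" and n: "\<And>k. n k \<ge> k"
    and lim: "\<And>x. (\<lambda>k. (1 / \<rho> ^ n k) *\<^sub>R (((\<lambda>x. A'' *v x) ^^ n k) x)) \<longlonglongrightarrow> x"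
    using inverse_A_powers by blast
  have "A'' = A' ** (A ** A'')" by (simp add: matrix_mul_assoc AA')
  then have "A'' = A'" by (simp add: A'')
  note lim = lim[unfolded this]
  have conv: "(\<lambda>k. (1 / \<rho> ^ n k) ^ j * R (((\<lambda>x. A' *v x) ^^ n k) x)) \<longlonglongrightarrow> h j x" for x
  proof -
    let ?y = "\<lambda>k. (1 / \<rho> ^ n k) *\<^sub>R (((\<lambda>x. A' *v x) ^^ n k) x)"
    have \<rho>0: "\<rho> ^ n k \<noteq> 0" for k using \<rho> by simp
    \<comment> \<open>After normalisation for degree j, the part of degree i carries the factor
      \<rho>^(n k) to the power i - j. It tends to 0 unless i = j, since lower parts are
      absent.\<close>
    have scaled: "(1 / \<rho> ^ n k) ^ j * h i (((\<lambda>x. A' *v x) ^^ n k) x) = (\<rho> ^ n k) ^ (i - j) * h i (?y k)" if "j \<le> i" for i k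
    proof -
      have "h i (((\<lambda>x. A' *v x) ^^ n k) x) = h i (\<rho> ^ n k *\<^sub>R ?y k)" using \<rho> by simp
      also have "\<dots> = (\<rho> ^ n k) ^ i * h i (?y k)" using hpoly_scale[OF h, of i "\<rho> ^ n k" "?y k"] by simp
      also have "(\<rho> ^ n k) ^ i = (\<rho> ^ n k) ^ j * (\<rho> ^ n k) ^ (i - j)" using that by (simp flip: power_add)
      finally show ?thesis using \<rho> by (simp add: power_divide)
    qed
    have "(\<lambda>k. \<rho> ^ n k) \<longlonglongrightarrow> 0"
    proof (rule Lim_null_comparison)
      show "\<forall>\<^sub>F k in sequentially. norm (\<rho> ^ n k) \<le> \<rho> ^ k"
        using \<rho> n by (intro always_eventually allI) (simp add: power_decreasing)
      show "(\<lambda>k. \<rho> ^ k) \<longlonglongrightarrow> 0" using \<rho> by (intro LIMSEQ_power_zero) simp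
    qed
    then have pw: "(\<lambda>k. (\<rho> ^ n k) ^ (i - j)) \<longlonglongrightarrow> (if i = j then 1 else 0)" if "j \<le> i" for i
      using tendsto_power[of "\<lambda>k. \<rho> ^ n k" 0 sequentially "i - j"] that by (cases "i = j") auto
    have "(\<lambda>k. \<Sum>i\<in>{j..<N}. (\<rho> ^ n k) ^ (i - j) * h i (?y k)) \<longlonglongrightarrow> (\<Sum>i\<in>{j..<N}. (if i = j then 1 else 0) * h i x)"
      by (intro tendsto_sum tendsto_mult pw continuous_on_tendsto_compose[OF hpoly_continuous_on[OF h, where S = UNIV] lim]) auto
    also have "(\<Sum>i\<in>{j..<N}. (if i = j then 1 else 0) * h i x) = h j x"
      using j by (simp add: if_distrib if_distribR sum.delta' sum.delta cong: if_cong)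
    also have "(\<lambda>k. \<Sum>i\<in>{j..<N}. (\<rho> ^ n k) ^ (i - j) * h i (?y k)) = (\<lambda>k. (1 / \<rho> ^ n k) ^ j * R (((\<lambda>x. A' *v x) ^^ n k) x))"
      unfolding R_def sum_distrib_left by (intro ext sum.cong refl scaled[symmetric]) auto
    finally show ?thesis .
  qed
  have "h j \<in> W"
    by (rule pointwise_limit_in_fsubspace[OF F(1) WF Wsub dil conv])
  then show "h j \<in> V" by (simp add: W_def)
  have "(\<lambda>x. h j (A *v x)) \<in> W"
  proof (rule pointwise_limit_in_fsubspace[OF F(1) WF Wsub dil])
    fix x
    \<comment> \<open>The index \<open>Suc k\<close> makes the exponent at least 1, so that one
      factor \<open>A'\<close> cancels against \<open>A\<close>.\<close>
    have "(\<lambda>k. (1 / \<rho> ^ n (Suc k)) ^ j * R (((\<lambda>x. A' *v x) ^^ n (Suc k)) (A *v x))) \<longlonglongrightarrow> h j (A *v x)"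
      by (rule LIMSEQ_Suc[OF conv])
    moreover have "((\<lambda>x. A' *v x) ^^ n (Suc k)) (A *v x) = ((\<lambda>x. A' *v x) ^^ (n (Suc k) - 1)) x" for k
    proof -
      obtain l where "n (Suc k) = Suc l" using n[of "Suc k"] by (cases "n (Suc k)") auto
      then show ?thesis
        by (simp only: funpow_Suc_right o_apply matrix_vector_mul_assoc AA' matrix_vector_mul_lid diff_Suc_1)
    qed
    ultimately show "(\<lambda>k. (1 / \<rho> ^ n (Suc k)) ^ j * R (((\<lambda>x. A' *v x) ^^ (n (Suc k) - 1)) x)) \<longlonglongrightarrow> h j (A *v x)"
      by simp
  qed
  then show "(\<lambda>x. h j (A *v x)) \<in> V" by (simp add: W_def)
qed

text \<open>The lowest part lies in \<open>V\<close>; subtracting it leaves a tail in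
  \<open>V\<close> whose lowest part is the next one.\<close>

lemma V_homogeneous:
  assumes "P \<in> V"
  obtains h N where "\<And>j. h j \<in> hpoly j" "P = (\<lambda>x. \<Sum>j<N. h j x)"
    "\<And>j. j < N \<Longrightarrow> h j \<in> V" "\<And>j. j < N \<Longrightarrow> (\<lambda>x. h j (A *v x)) \<in> V"
proof -
  obtain h N where h: "\<And>j. h j \<in> hpoly j" and P: "\<And>x. P x = (\<Sum>j<N. h j x)"
    using polys_decomp assms by (metis order_refl reproduced_iff)
  have tail: "(\<lambda>x. \<Sum>i\<in>{j..<N}. h i x) \<in> V" if "j \<le> N" for j
    using that
  proof (induction j)
    case 0
    have "(\<lambda>x. \<Sum>i\<in>{0..<N}. h i x) = P" by (simp add: fun_eq_iff P atLeast0LessThan)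
    then show ?case using assms by simp
  next
    case (Suc j)
    then have R: "(\<lambda>x. \<Sum>i\<in>{j..<N}. h i x) \<in> V" and j: "j < N" by auto
    have "h j \<in> V" by (rule V_lowest_part(1)[OF h R j])
    from fsubspace_diff[OF fsubspace_V R this, of 1]
    show ?case using j by (simp add: sum.atLeast_Suc_lessThan)
  qed
  have "P = (\<lambda>x. \<Sum>j<N. h j x)" by (simp add: fun_eq_iff P)
  moreover have "h j \<in> V" "(\<lambda>x. h j (A *v x)) \<in> V" if "j < N" for j
    using V_lowest_part[OF h tail that] that by auto
  ultimately show ?thesis using that h by blast
qed

lemma V_scale:
  assumes "P \<in> V" shows "(\<lambda>x. P (t *\<^sub>R x)) \<in> V"
proof -
  obtain h N where h: "\<And>j. h j \<in> hpoly j" "P = (\<lambda>x. \<Sum>j<N. h j x)" "\<And>j. j < N \<Longrightarrow> h j \<in> V"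
    using V_homogeneous[OF assms] by metis
  have "(\<lambda>x. \<Sum>j<N. t ^ j * h j x) \<in> V"
    using h(3) by (intro fsubspace_sum[OF fsubspace_V] fsubspace_cmult[OF fsubspace_V]) auto
  also have "(\<lambda>x. \<Sum>j<N. t ^ j * h j x) = (\<lambda>x. P (t *\<^sub>R x))"
    using hpoly_scale[OF h(1)] by (simp add: h(2))
  finally show ?thesis .
qed

text \<open>The inverse direction of \<open>V_dilate\<close>. It shows that every element of
  \<open>V\<close> has the form P o A^(-1) with P in \<open>V\<close>, the form in which
  annihilation is first proved.\<close>

lemma V_contract:
  assumes "P \<in> V" shows "(\<lambda>x. P (A *v x)) \<in> V"
proof -
  obtain h and N :: nat where h: "P = (\<lambda>x. \<Sum>j<N. h j x)" "\<And>j. j < N \<Longrightarrow> (\<lambda>x. h j (A *v x)) \<in> V"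
    using V_homogeneous[OF assms] by metis
  have "(\<lambda>x. \<Sum>j<N. h j (A *v x)) \<in> V" using h(2) by (intro fsubspace_sum[OF fsubspace_V]) auto
  then show ?thesis by (simp add: h(1))
qed

text \<open>Conjugation by a scaling moves an integer vector only along its own line, so a real
  shift is composed of shifts along the coordinate axes.\<close>

lemma V_shift:
  assumes "P \<in> V" shows "(\<lambda>x. P (x + v)) \<in> V"
proof -
  have axis_shift: "(\<lambda>x. P (x + axis i t)) \<in> V" if P: "P \<in> V" for P i t
  proof (cases "t = 0")
    case True
    then have zero: "axis i t = 0" by (simp add: vec_eq_iff axis_def)
    show ?thesis unfolding zero using P by simp
  next
    case False
    have "(\<lambda>x. P (t *\<^sub>R ((1 / t) *\<^sub>R x + intvec (unit_int i)))) \<in> V"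
      using V_scale[OF V_int_shift[OF V_scale[OF P, of t], of "unit_int i"], of "1 / t"] by simp
    moreover have "t *\<^sub>R ((1 / t) *\<^sub>R x + intvec (unit_int i)) = x + axis i t" for x
      using False by (simp add: vec_eq_iff intvec_unit axis_def scaleR_add_right)
    ultimately show ?thesis by simp
  qed
  have "(\<lambda>x. P (x + (\<Sum>i\<in>I. axis i (v $ i)))) \<in> V" for I
    using assms
  proof (induction I arbitrary: P rule: infinite_finite_induct)
    case (insert i I)
    have "(\<lambda>x. (\<lambda>x. P (x + axis i (v $ i))) (x + (\<Sum>i\<in>I. axis i (v $ i)))) \<in> V"
      by (rule insert.IH[OF axis_shift[OF insert.prems]])
    then show ?case using insert.hyps by (simp add: add_ac)
  qed simp_all
  moreover have "(\<Sum>i\<in>UNIV. axis i (v $ i)) = v"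
    by (simp add: vec_eq_iff axis_def sum.delta)
  ultimately show ?thesis by metis
qed

lemma V_affinely_invariant: "affinely_invariant V"
  unfolding affinely_invariant_def using V_shift V_scale by blast

subsection \<open>The annihilating difference operator\<close>

text \<open>The contrapositive of the Poisson argument, at a frequency where no factor of the
  product vanishes.\<close>

lemma twisted_sum_nonzero:
  assumes "s \<in> digits"
  obtains \<theta> where "test_function \<theta>"
    "Sum_any (\<lambda>l. cis (((2 * pi) *\<^sub>R s) \<bullet> intvec l) * sample \<theta> l) \<noteq> 0"
proof -
  have "F ((2 * pi) *\<^sub>R s) \<noteq> 0"
    using mask_product_digit_nonzero[OF assms] by (simp add: F_def)
  then show ?thesis
    using that fourier_eq_0_of_twisted_sum[OF ft cs isCont_F, of "(2 * pi) *\<^sub>R s"]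
    unfolding sample_def by blast
qed

text \<open>For a fixed \<open>\<theta>\<close> detecting the frequency 2 pi s, the polynomial
  \<open>lhs\<close>, an average of \<open>q f\<close> with weights \<psi> times the filtered
  samples of \<open>\<theta>\<close>, equals on Z^d a nontrivial character times a polynomial, hence
  is 0. Rewritten, it is an operator with nonzero coefficient sum applied to the twisted difference
  of \<open>q f\<close>, so the latter is 0 too.\<close>

lemma twisted_diff_op_annihilates:
  assumes s: "s \<in> digits" and L: "\<And>\<zeta>. teval L \<zeta> = of_real (mask \<zeta>) ^ m" and P: "P \<in> V"
  shows "diff_op (twist s L) (\<lambda>x. complex_of_real (P (A' *v x))) = (\<lambda>x. 0)"
proof -
  define \<psi> where "\<psi> k = cis (((2 * pi) *\<^sub>R s) \<bullet> intvec k)" for k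
  have \<psi>_add: "\<psi> (k + l) = \<psi> k * \<psi> l" for k l
    by (simp add: \<psi>_def intvec_add inner_add_right cis_mult distrib_left)
  have \<psi>_minus: "\<psi> (- k) = cis (- (2 * pi * (s \<bullet> intvec k)))" for k
    by (simp add: \<psi>_def intvec_minus)
  \<comment> \<open>The inner product of s with A k is that of A^T s with k, an integer because s is
    a digit.\<close>
  have \<psi>_iA: "\<psi> (iA k) = 1" for k
  proof -
    obtain l where l: "transpose A *v s = intvec l"
      using s intvec_surj unfolding digit_set_def by blast
    have "s \<bullet> intvec (iA k) = intvec l \<bullet> intvec k"
      using dot_lmul_matrix[of s A "intvec k"] l by (simp add: transpose_matrix_vector iA)
    then have "\<psi> (iA k) = cis (2 * pi * (intvec l \<bullet> intvec k))" by (simp add: \<psi>_def)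
    also have "\<dots> = teval [(1, - k)] (0 + (2 * pi) *\<^sub>R intvec l)" by (simp add: intvec_minus)
    also have "\<dots> = 1" unfolding teval_periodic by simp
    finally show ?thesis .
  qed
  obtain c where c: "span_coeffs c P" and Pp: "P \<in> polys" using P by (auto simp: reproduced_iff)
  obtain K :: real where K: "K > 0"
    "\<forall>L c P f. (\<forall>\<zeta>. teval L \<zeta> = of_real (mask \<zeta>) ^ m) \<longrightarrow> span_coeffs c P \<longrightarrow> test_function f \<longrightarrow>
      (LINT x|lborel. of_real (P (A' *v x)) * f x)
        = of_real K * pairing (upsample iA (\<lambda>k. of_real (c k))) (tfilter L (sample f))"
    using integral_refined by blast
  define R where "R x = complex_of_real (P (A' *v x))" for x
  define d where "d = upsample iA (\<lambda>k. complex_of_real (c k))"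
  define v where "v f = tfilter L (sample f)" for f
  \<comment> \<open>The span property speaks of integrals against test functions only, so averages
    take the place of point values of \<open>R\<close>.\<close>
  define q where "q f y = (LINT x|lborel. R (x + y) * f x)" for f y
  have R: "R \<in> polys" unfolding R_def[abs_def] by (intro polys_of_real polys_linear Pp)
  have q_polys: "q f \<in> polys" if "test_function f" for f
    unfolding q_def[abs_def] by (rule polys_average[OF R that])
  have v_fsupp: "fsupp (v f)" if "test_function f" for f
    unfolding v_def by (rule fsupp_tfilter[OF fsupp_sample[OF that]])
  have q_int: "q f (intvec n) = of_real K * pairing d (\<lambda>k. v f (k - n))" if f: "test_function f" for f n
  proof -
    have "q f (intvec n) = (LINT x|lborel. R (x + intvec n) * f (x + intvec n + intvec (- n)))"
      by (simp add: q_def intvec_minus)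
    also have "\<dots> = (LINT x|lborel. R x * f (x + intvec (- n)))"
      by (rule lborel_integral_shift[of "\<lambda>x. R x * f (x + intvec (- n))"])
    also have "\<dots> = of_real K * pairing d (tfilter L (sample (\<lambda>x. f (x + intvec (- n)))))"
      unfolding R_def d_def by (rule K(2)[rule_format, OF L c test_function_shift[OF f]])
    also have "tfilter L (sample (\<lambda>x. f (x + intvec (- n)))) = (\<lambda>k. v f (k - n))"
      by (rule ext) (simp add: v_def tfilter_def sample_shift algebra_simps)
    finally show ?thesis .
  qed
  \<comment> \<open>Both sides pair \<open>d\<close> with a convolution of the two filtered sample
    sequences. Moving the character from one factor to the other costs its value at k - n, and on
    the support of \<open>d\<close>, contained in A Z^d, this is its value at -n.\<close>
  have twist_sum: "Sum_any (\<lambda>k. \<psi> k * v \<theta> k * q f (intvec (n + k)))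
      = \<psi> (- n) * Sum_any (\<lambda>k. \<psi> (- k) * v f k * q \<theta> (intvec (n + k)))"
    if f: "test_function f" and \<theta>: "test_function \<theta>" for f \<theta> n
  proof -
    let ?u = "\<lambda>k. \<psi> k * v \<theta> k" and ?w = "\<lambda>k. \<psi> (- k) * v f k"
    have u: "fsupp ?u" and w: "fsupp ?w" by (intro fsupp_mult v_fsupp f \<theta>)+
    have sum: "Sum_any (\<lambda>k. a k * q g (intvec (n + k))) = of_real K * pairing d (\<lambda>k. conv a (v g) (k - n))"
      if a: "fsupp a" and g: "test_function g" for a g
    proof -
      have "Sum_any (\<lambda>k. a k * q g (intvec (n + k)))
        = Sum_any (\<lambda>k. of_real K * (a k * pairing d (\<lambda>l. v g (l - n - k))))"
        by (rule Sum_any.cong) (simp add: q_int[OF g] diff_diff_eq mult_ac)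
      also have "\<dots> = of_real K * Sum_any (\<lambda>k. a k * pairing d (\<lambda>l. v g (l - n - k)))"
        by (rule Sum_any_right_distrib[symmetric], rule finite_subset[OF _ a[unfolded fsupp_def]]) auto
      finally show ?thesis by (simp only: sum_pairing_conv[OF a v_fsupp[OF g]])
    qed
    have "pairing d (\<lambda>k. conv ?u (v f) (k - n)) = pairing (\<lambda>k. \<psi> (- n) * d k) (\<lambda>k. conv ?w (v \<theta>) (k - n))"
      unfolding pairing_def
    proof (rule Sum_any.cong)
      fix k
      have "conv ?u (v f) (k - n) = \<psi> (k - n) * conv ?w (v \<theta>) (k - n)"
        by (rule conv_character[OF \<psi>_add v_fsupp[OF f]])
      moreover have "\<psi> (k - n) = \<psi> (- n)" if "k \<in> range iA"
        using that \<psi>_add[of k "- n"] \<psi>_iA by auto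
      ultimately show "d k * conv ?u (v f) (k - n) = \<psi> (- n) * d k * conv ?w (v \<theta>) (k - n)"
        by (cases "k \<in> range iA") (auto simp: d_def upsample_def)
    qed
    also have "\<dots> = \<psi> (- n) * pairing d (\<lambda>k. conv ?w (v \<theta>) (k - n))"
    proof (rule pairing_cmult)
      have "fsupp (conv ?w (v \<theta>))"
      proof -
        have "conv ?w (v \<theta>) t = (\<Sum>k\<in>{k. ?w k \<noteq> 0}. ?w k * v \<theta> (t - k))" for t
          unfolding conv_def by (rule Sum_any.expand_superset[OF w[unfolded fsupp_def]]) auto
        then have sub: "{t. conv ?w (v \<theta>) t \<noteq> 0} \<subseteq> (\<Union>k\<in>{k. ?w k \<noteq> 0}. {t. v \<theta> (t - k) \<noteq> 0})"
          by (auto elim!: sum.not_neutral_contains_not_neutral)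
        have "finite {t. v \<theta> (t - k) \<noteq> 0}" for k
          using fsupp_inj[OF v_fsupp[OF \<theta>], of "\<lambda>t. t - k"] by (simp add: fsupp_def inj_def)
        then have "finite (\<Union>k\<in>{k. ?w k \<noteq> 0}. {t. v \<theta> (t - k) \<noteq> 0})"
          using w by (intro finite_UN_I) (auto simp: fsupp_def)
        then show ?thesis unfolding fsupp_def by (rule finite_subset[OF sub])
      qed
      then show "fsupp (\<lambda>k. conv ?w (v \<theta>) (k - n))"
        by (rule fsupp_inj) (simp add: inj_def)
    qed
    finally show ?thesis by (simp add: sum[OF u f] sum[OF w \<theta>])
  qed
  obtain \<theta> where \<theta>: "test_function \<theta>" and \<theta>_sum: "Sum_any (\<lambda>l. \<psi> l * sample \<theta> l) \<noteq> 0"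
    using twisted_sum_nonzero[OF s] unfolding \<psi>_def by blast
  have annihilate: "diff_op (twist s L) (q f) = (\<lambda>x. 0)" if f: "test_function f" for f
  proof -
    define M where "M = {k. v \<theta> k \<noteq> 0} \<union> {k. v f k \<noteq> 0}"
    have M: "finite M" using v_fsupp[OF f] v_fsupp[OF \<theta>] by (simp add: M_def fsupp_def)
    define lhs where "lhs y = (\<Sum>k\<in>M. \<psi> k * v \<theta> k * q f (y + intvec k))" for y
    define r where "r y = (\<Sum>k\<in>M. \<psi> (- k) * v f k * q \<theta> (y + intvec k))" for y
    have lhs_polys: "lhs \<in> polys" and r_polys: "r \<in> polys"
      unfolding lhs_def[abs_def] r_def[abs_def] by (intro polys_sum polys_cmult polys_shift q_polys f \<theta>)+
    have lhs_r: "lhs (intvec n) = \<psi> (- n) * r (intvec n)" for n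
    proof -
      have "lhs (intvec n) = Sum_any (\<lambda>k. \<psi> k * v \<theta> k * q f (intvec (n + k)))"
        unfolding lhs_def intvec_add by (rule Sum_any.expand_superset[OF M, symmetric]) (auto simp: M_def)
      moreover have "r (intvec n) = Sum_any (\<lambda>k. \<psi> (- k) * v f k * q \<theta> (intvec (n + k)))"
        unfolding r_def intvec_add by (rule Sum_any.expand_superset[OF M, symmetric]) (auto simp: M_def)
      ultimately show ?thesis using twist_sum[OF f \<theta>] by simp
    qed
    \<comment> \<open>On A Z^d the character is 1, so the two polynomials agree there and are
      therefore equal.\<close>
    have "\<psi> (- iA k) = 1" for k using \<psi>_add[of "iA k" "- iA k"] \<psi>_iA by (simp add: \<psi>_def)
    then have "lhs (A *v intvec k + 0) - r (A *v intvec k + 0) = 0" for k by (simp add: iA lhs_r)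
    from polys_eq_0_on_lattice[OF polys_diff[OF lhs_polys r_polys] invertible_A this]
    have eq: "lhs = r" by (simp add: fun_eq_iff)
    obtain i where i: "s $ i \<notin> \<int>" using digit_nonint[OF s] by blast
    have \<psi>_i: "\<psi> (- unit_int i) \<noteq> 1"
    proof
      assume "\<psi> (- unit_int i) = 1"
      then have "cos (2 * pi * (s $ i)) = 1"
        by (simp add: \<psi>_minus intvec_unit inner_axis complex_eq_iff)
      then obtain n where "2 * pi * (s $ i) = real_of_int n * (2 * pi)" by (auto simp: cos_one_2pi_int)
      then show False using i by simp
    qed
    \<comment> \<open>On the coset of a unit vector along which \<open>s\<close> is not integral,
      the character is a constant different from 1, so a polynomial equal to this multiple of itself
      vanishes there.\<close>
    have "lhs (A *v intvec k + intvec (unit_int i)) = 0" for k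
    proof -
      have "\<psi> (- (iA k + unit_int i)) = \<psi> (- unit_int i)"
        using \<psi>_add[of "- iA k" "- unit_int i"] \<open>\<And>k. \<psi> (- iA k) = 1\<close> by (simp add: add.commute)
      then have "lhs (intvec (iA k + unit_int i)) = \<psi> (- unit_int i) * lhs (intvec (iA k + unit_int i))"
        using lhs_r[of "iA k + unit_int i"] by (simp add: eq)
      then show ?thesis using \<psi>_i by (simp add: iA intvec_add)
    qed
    from polys_eq_0_on_lattice[OF lhs_polys invertible_A this] have lhs_0: "lhs = (\<lambda>x. 0)" .
    let ?S = "{l. sample \<theta> l \<noteq> 0}"
    have S: "finite ?S" using fsupp_sample[OF \<theta>] by (simp add: fsupp_def)
    \<comment> \<open>Moving a filter off the samples of \<open>\<theta>\<close> turns it into a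
      difference operator on \<open>q f\<close>; the character splits at l - j and leaves the
      twisting factor on the coefficient.\<close>
    have factor: "Sum_any (\<lambda>k. \<psi> k * tfilter N (sample \<theta>) k * q f (y + intvec k))
       = (\<Sum>l\<in>?S. \<psi> l * sample \<theta> l * diff_op (twist s N) (q f) (y + intvec l))" for N y
    proof (induction N)
      case (Cons aj N)
      obtain a j where aj: "aj = (a, j)" by (cases aj)
      have fin1: "finite {k. \<psi> k * (a * sample \<theta> (k + j)) * q f (y + intvec k) \<noteq> 0}"
        by (rule finite_subset[OF _ fsupp_inj[OF fsupp_sample[OF \<theta>], of "\<lambda>k. k + j", unfolded fsupp_def]]) (auto simp: inj_def)
      have fin2: "finite {k. \<psi> k * tfilter N (sample \<theta>) k * q f (y + intvec k) \<noteq> 0}"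
        by (rule finite_subset[OF _ fsupp_tfilter[OF fsupp_sample[OF \<theta>], unfolded fsupp_def]]) auto
      have "Sum_any (\<lambda>k. \<psi> k * (a * sample \<theta> (k + j)) * q f (y + intvec k))
        = Sum_any (\<lambda>l. \<psi> (l - j) * (a * sample \<theta> l) * q f (y + intvec (l - j)))"
        by (rule Sum_any.reindex_cong[of "\<lambda>l. l - j"])
          (auto simp: o_def intro!: bij_betw_byWitness[where f' = "\<lambda>l. l + j"])
      also have "\<dots> = (\<Sum>l\<in>?S. \<psi> (l - j) * (a * sample \<theta> l) * q f (y + intvec (l - j)))"
        by (rule Sum_any.expand_superset[OF S]) auto
      finally have 1: "Sum_any (\<lambda>k. \<psi> k * (a * sample \<theta> (k + j)) * q f (y + intvec k))
        = (\<Sum>l\<in>?S. \<psi> (l - j) * (a * sample \<theta> l) * q f (y + intvec (l - j)))" .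
      have "Sum_any (\<lambda>k. \<psi> k * tfilter (aj # N) (sample \<theta>) k * q f (y + intvec k))
        = Sum_any (\<lambda>k. \<psi> k * (a * sample \<theta> (k + j)) * q f (y + intvec k)) +
          Sum_any (\<lambda>k. \<psi> k * tfilter N (sample \<theta>) k * q f (y + intvec k))"
        by (subst Sum_any.distrib[OF fin1 fin2, symmetric]) (simp add: aj algebra_simps)
      also have "\<dots> = (\<Sum>l\<in>?S. \<psi> l * sample \<theta> l * diff_op (twist s (aj # N)) (q f) (y + intvec l))"
        unfolding 1 Cons sum.distrib[symmetric]
      proof (rule sum.cong[OF refl])
        fix l
        have "\<psi> (l - j) = \<psi> l * cis (- (2 * pi * (s \<bullet> intvec j)))"
          using \<psi>_add[of l "- j"] by (simp add: \<psi>_minus)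
        then show "\<psi> (l - j) * (a * sample \<theta> l) * q f (y + intvec (l - j)) +
            \<psi> l * sample \<theta> l * diff_op (twist s N) (q f) (y + intvec l)
          = \<psi> l * sample \<theta> l * diff_op (twist s (aj # N)) (q f) (y + intvec l)"
          by (simp add: aj intvec_diff algebra_simps)
      qed
      finally show ?case .
    qed simp
    show ?thesis
    \<comment> \<open>The coefficient sum of the outer operator is the twisted sum of
      \<open>\<theta>\<close>, nonzero by the choice of \<open>\<theta>\<close>.\<close>
    proof (rule polys_eq_0_of_difference[where L = ?S and \<alpha> = "\<lambda>l. \<psi> l * sample \<theta> l" and v = intvec])
      show "diff_op (twist s L) (q f) \<in> polys" by (rule polys_diff_op[OF q_polys[OF f]])
      have "(\<Sum>l\<in>?S. \<psi> l * sample \<theta> l) = Sum_any (\<lambda>l. \<psi> l * sample \<theta> l)"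
        by (rule Sum_any.expand_superset[OF S, symmetric]) auto
      then show "(\<Sum>l\<in>?S. \<psi> l * sample \<theta> l) \<noteq> 0" using \<theta>_sum by simp
      fix k
      have "Sum_any (\<lambda>l. \<psi> l * v \<theta> l * q f (intvec k + intvec l)) = lhs (intvec k)"
        unfolding lhs_def by (rule Sum_any.expand_superset[OF M]) (auto simp: M_def)
      then show "(\<Sum>l\<in>?S. \<psi> l * sample \<theta> l * diff_op (twist s L) (q f) (intvec k + intvec l)) = 0"
        unfolding factor[symmetric] v_def[symmetric] lhs_0 .
    qed
  qed
  \<comment> \<open>The averages at 0 determine the continuous function by the fundamental
    lemma.\<close>
  have "diff_op (twist s L) R x = 0" for x
  proof (rule continuous_eq_0I)
    show "continuous_on UNIV (diff_op (twist s L) R)" by (intro polys_continuous_on polys_diff_op R)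
    fix f :: "real^('n::{finite,linorder}) \<Rightarrow> complex" assume f: "test_function f"
    have int: "integrable lborel (\<lambda>x. g x * f x)" if "g \<in> polys" for g
      by (intro integrable_mult_test polys_continuous_on that f)
    have "(LINT x|lborel. diff_op N R x * f x) = diff_op N (q f) 0" for N
    proof (induction N)
      case (Cons aj N)
      obtain a j where aj: "aj = (a, j)" by (cases aj)
      have int1: "integrable lborel (\<lambda>x. R (x + - intvec j) * f x)" by (rule int[OF polys_shift[OF R]])
      have int2: "integrable lborel (\<lambda>x. diff_op N R x * f x)" by (rule int[OF polys_diff_op[OF R]])
      have "(LINT x|lborel. diff_op (aj # N) R x * f x) = (LINT x|lborel. a * (R (x + - intvec j) * f x) + diff_op N R x * f x)"
        by (simp add: aj distrib_right mult.assoc)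
      also have "\<dots> = a * (LINT x|lborel. R (x + - intvec j) * f x) + (LINT x|lborel. diff_op N R x * f x)"
        using int1 int2 by simp
      finally show ?case by (simp add: aj Cons q_def)
    qed simp
    then show "(LINT x|lborel. diff_op (twist s L) R x * f x) = 0" using annihilate[OF f] by simp
  qed
  then show ?thesis unfolding R_def by blast
qed

lemma twist_twist: "twist s (twist t L) = twist (s + t) L"
  by (induction L) (auto simp: inner_add_left distrib_left cis_mult add_ac)

text \<open>Let t be the digit congruent to -s. Twisting by s turns the mask factor of t into G by
  periodicity. The other factors of the twisted mask are nonzero at 0, so the operator they form is
  injective on polynomials and can be cancelled.\<close>

lemma elliptic_diff_annihilates:
  assumes R: "R \<in> V"
  shows "(elliptic_diff Q 1 ^^ m) (\<lambda>x. complex_of_real (R x)) = (\<lambda>x. 0)"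
proof -
  obtain s where s: "s \<in> digits" using digits_nonempty by blast
  define t where "t = frac_vec (- s)"
  have t: "t \<in> digits" unfolding t_def by (rule frac_vec_minus_digit[OF s])
  obtain rest where rest: "set rest = digits - {t}" "distinct rest"
    using finite_distinct_list[of "digits - {t}"] finite_digits by auto
  have ss: "distinct (t # rest)" "set (t # rest) = digits" using rest t by auto
  let ?p = "\<lambda>x. complex_of_real (R x)"
  have p: "?p \<in> polys" using R by (auto simp: reproduced_iff intro: polys_of_real)
  \<comment> \<open>The preceding result is applied to R o A, which lies in \<open>V\<close>, so
    that its composition with A^(-1) is \<open>R\<close> itself.\<close>
  have "diff_op (twist s (tpow (mask_trig (t # rest)) m)) (\<lambda>x. complex_of_real ((\<lambda>y. R (A *v y)) (A' *v x))) = (\<lambda>x. 0)"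
    by (rule twisted_diff_op_annihilates[OF s _ V_contract[OF R]]) (simp add: teval_tpow teval_mask_trig[OF ss])
  then have zero: "(diff_op (twist s (mask_trig (t # rest))) ^^ m) ?p = (\<lambda>x. 0)"
    by (simp add: twist_tpow diff_op_tpow matrix_vector_mul_assoc AA')
  \<comment> \<open>The factors of the twisted mask other than G, together with the normalising
    constant.\<close>
  define N where "N = tmul [(of_real (1 / mask_denom), 0)] (tprod (map (\<lambda>r. twist (s + r) G_trig) rest))"
  have "diff_op (twist s (mask_trig (t # rest))) = diff_op (tmul N G_trig)"
  proof
    fix g :: "real^('n::{finite,linorder}) \<Rightarrow> complex"
    have "twist (s + t) G_trig = G_trig"
    proof (rule twist_integral)
      show "(s + t) $ i \<in> \<int>" for i using digits_sum_int[OF t s] by (simp add: t_def add.commute)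
    qed
    then have "twist s (mask_trig (t # rest)) = tmul [(of_real (1 / mask_denom), 0)]
        (tmul G_trig (tprod (map (\<lambda>r. twist (s + r) G_trig) rest)))"
      by (simp add: mask_trig_def twist_tmul twist_tprod twist_twist o_def del: tmul_simps)
    then have "diff_op (twist s (mask_trig (t # rest))) g = diff_op [(of_real (1 / mask_denom), 0)]
        (diff_op G_trig (diff_op (tprod (map (\<lambda>r. twist (s + r) G_trig) rest)) g))"
      by (simp only: diff_op_tmul')
    also have "diff_op G_trig (diff_op (tprod (map (\<lambda>r. twist (s + r) G_trig) rest)) g)
        = diff_op (tprod (map (\<lambda>r. twist (s + r) G_trig) rest)) (diff_op G_trig g)"
      by (rule ext) (rule diff_op_commute)
    finally show "diff_op (twist s (mask_trig (t # rest))) g = diff_op (tmul N G_trig) g"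
      by (simp only: N_def diff_op_tmul')
  qed
  then have "diff_op (tpow N m) (diff_op (tpow G_trig m) ?p) = (\<lambda>x. 0)"
    using zero diff_op_tpow_tmul[of N G_trig m ?p] by (simp only: diff_op_tpow)
  moreover have "teval (tpow N m) 0 \<noteq> 0"
  proof -
    \<comment> \<open>Only the digit t makes s + r integral, and G vanishes at none of the remaining
      points.\<close>
    have "elliptic_G Q ((2 * pi) *\<^sub>R (s + r)) \<noteq> 0" if r: "r \<in> set rest" for r
    proof -
      have "r \<in> digits" "r \<noteq> t" using r rest(1) by auto
      then have "\<exists>i. (r + s) $ i \<notin> \<int>" using digits_sum_int[OF _ s, of r] t_def by blast
      then show ?thesis using elliptic_G_nonzero[OF Q, of "s + r"] by (auto simp: add.commute)
    qed
    then have "(\<Prod>r\<leftarrow>rest. teval (twist (s + r) G_trig) 0) \<noteq> 0"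
      by (auto simp: teval_twist G_trig prod_list_zero_iff)
    then show ?thesis
      using mask_denom_nonzero by (simp add: teval_tpow N_def teval_tmul teval_tprod o_def del: tmul_simps)
  qed
  ultimately have "diff_op (tpow G_trig m) ?p = (\<lambda>x. 0)"
    by (intro diff_op_inj[of _ "tpow N m"] polys_diff_op p) (simp_all add: fun_eq_iff)
  then show ?thesis by (simp add: diff_op_tpow G_trig)
qed

lemma V_kernel:
  assumes "P \<in> V"
  shows "P \<in> kernel_of_power (quadratic_form_operator (Q ** Q)) m"
proof -
  have "(quadratic_form_operator (Q ** Q) ^^ m) (\<lambda>x. complex_of_real (P x)) = (\<lambda>x. 0)"
  proof (rule kernel_of_elliptic_diff[OF transpose_Q])
    show "(\<lambda>x. complex_of_real (P x)) \<in> polys" using assms by (auto simp: reproduced_iff intro: polys_of_real)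
    show "(elliptic_diff Q 1 ^^ m) (\<lambda>x. complex_of_real (P (t *\<^sub>R x))) = (\<lambda>x. 0)" for t
      using elliptic_diff_annihilates[OF V_scale[OF assms]] .
  qed
  then show ?thesis by (simp add: kernel_of_power_def)
qed

end

theorem theorem4p2:
  fixes A Q U :: "real^('n::{finite,linorder})^('n::{finite,linorder})"
    and m :: nat
    and \<phi> :: "('n::{finite,linorder}) distr"
  assumes "dilation_matrix A"
    and "isotropic A"
    and "isotropic_factorization A Q U"
    and "m \<ge> 1"
    and "scaling_function_of_order m A (elliptic_mask A Q) \<phi>"
  shows "(\<forall>P. real_polynomial_function P \<longrightarrow> in_shift_span \<phi> P \<longrightarrow>
            P \<in> kernel_of_power (quadratic_form_operator (Q ** Q)) m) \<and>
         affinely_invariant (reproduced_polynomials \<phi>)"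
proof -
  interpret elliptic_scaling A Q U m \<phi>
    using assms by unfold_locales
  show ?thesis
    using V_kernel V_affinely_invariant by (auto simp: reproduced_polynomials_def)
qed

end
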